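(* The product of Grassmann Schubert classes $[\Omega_\Box]_{\mathbb E}\cdot[\Omega_\Box]_{\mathbb E}$ in $\mathrm H_{\mathbb E}(G(2,2))$ is not a real linear combination of the Grassmann Schubert classes $[\Omega_{(2)}]_{\mathbb E}$ and $[\Omega_{(1,1)}]_{\mathbb E}$ of the Young diagrams $(2)$ (one row with two boxes) and $(1,1)$ (one column with two boxes).
   Context: Zonoids. For a finite-dimensional Euclidean space $W$, $\widehat{\mathcal Z}_o(W)$ is the real vector space of formal differences (Minkowski addition) of centered zonoids (zonoids = Hausdorff limits of finite Minkowski sums of segments; centered = symmetric about $0$). For an integrable random vector $\xi\in W$, $K(\xi)$ is the centered zonoid with support function $\frac12\mathbb E|\langle u,\xi\rangle|$; every centered zonoid is of this form. Algebra. For a Euclidean space $V$, $\Lambda^dV$ has the induced inner product; $\bigoplus_d\widehat{\mathcal Z}_o(\Lambda^dV)$ is a graded commutative algebra with bilinear product determined by $K(\xi_1)\wedge K(\xi_2)=K(\xi_1\wedge\xi_2)$ for independent integrable $\xi_i$. $\widehat{\mathcal G}_o^d(V)$ is the span of the $K(\xi)$ with $\xi\in\Lambda^dV$ integrable and a.s. simple ($=v_1\wedge\dots\wedge v_d$). With the pairing $\langle K(\xi),K(\zeta)\rangle=\mathbb E|\langle\xi,\zeta\rangle|$ ($\xi,\zeta$ independent), $\mathcal I^d(V)=\{K\in\widehat{\mathcal G}_o^d(V):\langle K,L\rangle=0\ \forall L\in\widehat{\mathcal G}_o^d(V)\}$; $\bigoplus_d\mathcal I^d(V)$ is an ideal and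 $\mathcal Q_o(V)=\bigoplus_d\widehat{\mathcal G}_o^d(V)/\mathcal I^d(V)$. Grassmannian. $G(2,2)=\mathrm O(4)/(\mathrm O(2)\times\mathrm O(2))$ is the space of $2$-dimensional subspaces $L$ of $\mathbb R^4$, with an $\mathrm O(4)$-invariant Riemannian metric; its cotangent space at the base point is $V=\mathbb R^2\otimes\mathbb R^2$ with the tensor action of $H=\mathrm O(2)\times\mathrm O(2)$. $\mathrm H_{\mathbb E}(G(2,2))=\mathcal Q_o(V)^H$. Fix a complete flag $V_1\subset V_2\subset V_3\subset V_4=\mathbb R^4$. For a Young diagram $\lambda\subseteq[2]\times[2]$, $\Omega_\lambda=\{L\mid\forall(i,j)\in\lambda:\dim(L\cap V_{2-j+i})\ge i\}$; thus $\Omega_\Box=\{L:\dim(L\cap V_2)\ge1\}$, $\Omega_{(2)}=\{L:V_1\subseteq L\}$, $\Omega_{(1,1)}=\{L:L\subseteq V_3\}$. Grassmann Schubert classes. $[\Omega_\lambda]_{\mathbb E}=[K_\lambda]$, where $K_\lambda$ is the Grassmann zonoid associated with the Schubert variety $\Omega_\lambda$; explicitly $K_\lambda=\frac{\mathrm{vol}(\Omega_\lambda)}{\mathrm{vol}(G(2,2))}K(h\cdot v_\lambda)$ with $h\in H$ uniformly random and $v_\lambda=\bigwedge_{(i,j)\in\lambda}e_i\otimes f_j$, for orthonormal bases $(e_1,e_2)$, $(f_1,f_2)$ of the two factors $\mathbb R^2$. *)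

theory Defs
  imports
    "HOL-Probability.Probability"
    "HOL-Algebra.QuotRing"
    "HOL-Algebra.Module"
begin

section \<open>Zonoids\<close>

text \<open>Sums of sets are Minkowski sums (\<^theory>\<open>HOL-Library.Set_Algebras\<close>).\<close>

definition zonotope :: "'a::euclidean_space set \<Rightarrow> bool" where
  "zonotope Z \<longleftrightarrow> (\<exists>ps. Z = (\<Sum>(a, b)\<leftarrow>ps. closed_segment a b))"

definition hausdorff_limit :: "(nat \<Rightarrow> 'a::metric_space set) \<Rightarrow> 'a set \<Rightarrow> bool" where
  "hausdorff_limit X Z \<longleftrightarrow> (\<forall>\<epsilon>>0. \<forall>\<^sub>F n in sequentially.
     (\<forall>x\<in>X n. \<exists>z\<in>Z. dist x z < \<epsilon>) \<and> (\<forall>z\<in>Z. \<exists>x\<in>X n. dist x z < \<epsilon>))"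

definition zonoid :: "'a::euclidean_space set \<Rightarrow> bool" where
  "zonoid Z \<longleftrightarrow> compact Z \<and> Z \<noteq> {} \<and> (\<exists>X. (\<forall>n. zonotope (X n)) \<and> hausdorff_limit X Z)"

definition centered :: "'a::real_vector set \<Rightarrow> bool" where
  "centered Z \<longleftrightarrow> uminus ` Z = Z"

lemma set_plus_memI: "a \<in> A \<Longrightarrow> b \<in> B \<Longrightarrow> a + b \<in> A + B"
  by (rule set_plus_intro)

lemma linear_image_plus:
  assumes "linear f" shows "f ` (A + B) = f ` A + f ` B"
proof
  show "f ` (A + B) \<subseteq> f ` A + f ` B"
    using assms by (auto simp: set_plus_def linear_add) blast
  show "f ` A + f ` B \<subseteq> f ` (A + B)"
  proof
    fix y assume "y \<in> f ` A + f ` B"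
    then obtain a b where "a \<in> A" "b \<in> B" "y = f a + f b"
      by (auto simp: set_plus_def)
    then have "y = f (a + b)" "a + b \<in> A + B"
      using assms by (auto simp: linear_add)
    then show "y \<in> f ` (A + B)" by blast
  qed
qed

lemma zonotope_0: "zonotope {0}"
  unfolding zonotope_def by (rule exI[of _ "[]"]) simp

lemma zonotope_plus:
  assumes "zonotope A" "zonotope B" shows "zonotope (A + B)"
proof -
  obtain ps qs where "A = (\<Sum>(a, b)\<leftarrow>ps. closed_segment a b)" "B = (\<Sum>(a, b)\<leftarrow>qs. closed_segment a b)"
    using assms by (auto simp: zonotope_def)
  then have "A + B = (\<Sum>(a, b)\<leftarrow>ps @ qs. closed_segment a b)" by simp
  then show ?thesis unfolding zonotope_def by blast
qed

lemma zonotope_convex: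
  assumes "zonotope Z" shows "convex Z"
proof -
  obtain ps where Z: "Z = (\<Sum>(a, b)\<leftarrow>ps. closed_segment a b)"
    using assms by (auto simp: zonotope_def)
  show ?thesis unfolding Z
    by (induction ps) (auto intro!: convex_set_plus)
qed

lemma zonotope_linear_image:
  assumes "zonotope Z" "linear f" shows "zonotope (f ` Z)"
proof -
  obtain ps where Z: "Z = (\<Sum>(a, b)\<leftarrow>ps. closed_segment a b)"
    using assms by (auto simp: zonotope_def)
  have "f ` (\<Sum>(a, b)\<leftarrow>ps. closed_segment a b)
      = (\<Sum>(a, b)\<leftarrow>map (\<lambda>(a, b). (f a, f b)) ps. closed_segment a b)"
  proof (induction ps)
    case Nil
    then show ?case using assms(2) by (simp add: linear_0)
  next
    case (Cons p ps)
    then show ?case using assms(2)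
      by (cases p) (simp add: linear_image_plus closed_segment_linear_image)
  qed
  then show ?thesis unfolding Z zonotope_def by blast
qed

lemma hausdorff_limit_plus:
  fixes A B :: "'a::real_normed_vector set"
  assumes "hausdorff_limit X A" "hausdorff_limit Y B"
  shows "hausdorff_limit (\<lambda>n. X n + Y n) (A + B)"
  unfolding hausdorff_limit_def
proof (intro allI impI)
  fix \<epsilon> :: real assume "\<epsilon> > 0"
  then have e: "\<epsilon> / 2 > 0" by simp
  have tri: "dist (a + b) (c + d) < \<epsilon>" if "dist a c < \<epsilon> / 2" "dist b d < \<epsilon> / 2" for a b c d :: 'a
    using that norm_triangle_ineq[of "a - c" "b - d"] by (simp add: dist_norm algebra_simps)
  show "\<forall>\<^sub>F n in sequentially. (\<forall>x\<in>X n + Y n. \<exists>z\<in>A + B. dist x z < \<epsilon>)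
      \<and> (\<forall>z\<in>A + B. \<exists>x\<in>X n + Y n. dist x z < \<epsilon>)"
    using assms(1)[unfolded hausdorff_limit_def, rule_format, OF e]
      assms(2)[unfolded hausdorff_limit_def, rule_format, OF e]
  proof eventually_elim
    case (elim n)
    show ?case
    proof (intro conjI ballI)
      fix x assume "x \<in> X n + Y n"
      then obtain a b where ab: "x = a + b" "a \<in> X n" "b \<in> Y n"
        by (auto simp: set_plus_def)
      with elim obtain c d where "c \<in> A" "dist a c < \<epsilon> / 2" "d \<in> B" "dist b d < \<epsilon> / 2" by blast
      with ab tri show "\<exists>z\<in>A + B. dist x z < \<epsilon>" by (blast intro: set_plus_memI)
    next
      fix z assume "z \<in> A + B"
      then obtain c d where cd: "z = c + d" "c \<in> A" "d \<in> B"
        by (auto simp: set_plus_def)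
      with elim obtain a b where "a \<in> X n" "dist a c < \<epsilon> / 2" "b \<in> Y n" "dist b d < \<epsilon> / 2" by blast
      with cd tri show "\<exists>x\<in>X n + Y n. dist x z < \<epsilon>" by (blast intro: set_plus_memI)
    qed
  qed
qed

lemma hausdorff_limit_scaleR:
  fixes A :: "'a::real_normed_vector set"
  assumes "hausdorff_limit X A"
  shows "hausdorff_limit (\<lambda>n. (*\<^sub>R) c ` X n) ((*\<^sub>R) c ` A)"
  unfolding hausdorff_limit_def
proof (intro allI impI)
  fix \<epsilon> :: real assume "\<epsilon> > 0"
  then have e: "\<epsilon> / (\<bar>c\<bar> + 1) > 0" by simp
  have tri: "dist (c *\<^sub>R a) (c *\<^sub>R b) < \<epsilon>" if "dist a b < \<epsilon> / (\<bar>c\<bar> + 1)" for a b :: 'a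
  proof -
    have "dist (c *\<^sub>R a) (c *\<^sub>R b) \<le> (\<bar>c\<bar> + 1) * dist a b"
      by (simp add: dist_norm scaleR_diff_right[symmetric] mult_right_mono)
    also have "\<dots> < \<epsilon>" using that by (simp add: field_simps)
    finally show ?thesis .
  qed
  show "\<forall>\<^sub>F n in sequentially. (\<forall>x\<in>(*\<^sub>R) c ` X n. \<exists>z\<in>(*\<^sub>R) c ` A. dist x z < \<epsilon>)
      \<and> (\<forall>z\<in>(*\<^sub>R) c ` A. \<exists>x\<in>(*\<^sub>R) c ` X n. dist x z < \<epsilon>)"
    using assms[unfolded hausdorff_limit_def, rule_format, OF e]
    by eventually_elim (use tri in blast)
qed

lemma zonoid_0: "zonoid {0}"
  unfolding zonoid_def hausdorff_limit_def
  by (auto intro!: exI[of _ "\<lambda>_. {0}"] zonotope_0)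

lemma zonoid_plus:
  assumes "zonoid A" "zonoid B" shows "zonoid (A + B)"
proof -
  obtain X Y where "\<forall>n. zonotope (X n)" "hausdorff_limit X A" "\<forall>n. zonotope (Y n)" "hausdorff_limit Y B"
    using assms by (auto simp: zonoid_def)
  then have "\<forall>n. zonotope (X n + Y n)" "hausdorff_limit (\<lambda>n. X n + Y n) (A + B)"
    by (auto intro: zonotope_plus hausdorff_limit_plus)
  moreover have "compact (A + B)"
    using assms compact_sums[of A B] by (simp add: zonoid_def set_plus_def Bex_def conj_ac)
  moreover have "A + B \<noteq> {}"
    using assms unfolding zonoid_def set_plus_def by blast
  ultimately show ?thesis
    unfolding zonoid_def by (intro conjI exI[of _ "\<lambda>n. X n + Y n"]) blast+
qed

lemma zonoid_scaleR:
  assumes "zonoid A" shows "zonoid ((*\<^sub>R) c ` A)"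
proof -
  obtain X where X: "\<forall>n. zonotope (X n)" "hausdorff_limit X A"
    using assms by (auto simp: zonoid_def)
  have "linear ((*\<^sub>R) c :: 'a \<Rightarrow> 'a)" by (rule linear_scaleR)
  then have "\<forall>n. zonotope ((*\<^sub>R) c ` X n)" using X(1) zonotope_linear_image by blast
  moreover have "compact ((*\<^sub>R) c ` A)" "(*\<^sub>R) c ` A \<noteq> {}"
    using assms by (auto simp: zonoid_def intro: compact_scaling)
  ultimately show ?thesis
    unfolding zonoid_def using hausdorff_limit_scaleR[OF X(2), of c]
    by (intro conjI exI[of _ "\<lambda>n. (*\<^sub>R) c ` X n"]) blast+
qed

lemma zonoid_convex:
  assumes "zonoid Z" shows "convex Z"
  unfolding convex_alt
proof (intro ballI allI impI)
  fix x y :: 'a and t :: real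
  assume xy: "x \<in> Z" "y \<in> Z" and t: "0 \<le> t \<and> t \<le> 1"
  define p where "p = (1 - t) *\<^sub>R x + t *\<^sub>R y"
  obtain X where X: "\<And>n. zonotope (X n)" "hausdorff_limit X Z"
    using assms by (auto simp: zonoid_def)
  have "p \<in> closure Z"
    unfolding closure_approachable
  proof (intro allI impI)
    fix \<epsilon> :: real assume "\<epsilon> > 0"
    then have "\<epsilon> / 2 > 0" by simp
    from X(2)[unfolded hausdorff_limit_def, rule_format, OF this]
    obtain n where n: "\<And>x. x \<in> X n \<Longrightarrow> \<exists>z\<in>Z. dist x z < \<epsilon> / 2"
      "\<And>z. z \<in> Z \<Longrightarrow> \<exists>x\<in>X n. dist x z < \<epsilon> / 2"
      unfolding eventually_sequentially by blast
    obtain x' y' where x'y': "x' \<in> X n" "dist x' x < \<epsilon> / 2" "y' \<in> X n" "dist y' y < \<epsilon> / 2"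
      using n(2) xy by metis
    define q where "q = (1 - t) *\<^sub>R x' + t *\<^sub>R y'"
    have "q \<in> X n"
      using zonotope_convex[OF X(1)] x'y' t unfolding convex_alt q_def by blast
    then obtain z where z: "z \<in> Z" "dist q z < \<epsilon> / 2" using n(1) by blast
    have "q - p = (1 - t) *\<^sub>R (x' - x) + t *\<^sub>R (y' - y)"
      by (simp add: q_def p_def algebra_simps)
    then have "norm (q - p) \<le> (1 - t) * norm (x' - x) + t * norm (y' - y)"
      using t norm_triangle_ineq[of "(1 - t) *\<^sub>R (x' - x)" "t *\<^sub>R (y' - y)"] by simp
    also have "\<dots> \<le> (1 - t) * (\<epsilon> / 2) + t * (\<epsilon> / 2)"
      using t x'y' by (intro add_mono mult_left_mono) (auto simp: dist_norm)
    also have "\<dots> = \<epsilon> / 2" by (simp add: field_simps)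
    finally have "dist q p \<le> \<epsilon> / 2" by (simp add: dist_norm)
    with z have "dist z p < \<epsilon>"
      using dist_triangle[of z p q] by (simp add: dist_commute)
    with z show "\<exists>z\<in>Z. dist z p < \<epsilon>" by blast
  qed
  moreover have "closed Z" using assms by (auto simp: zonoid_def compact_imp_closed)
  ultimately show "(1 - t) *\<^sub>R x + t *\<^sub>R y \<in> Z" by (simp add: p_def)
qed

lemma minkowski_cancel_subset:
  fixes A B E :: "'a::euclidean_space set"
  assumes "convex B" "compact B" "compact E" "E \<noteq> {}" "A + E \<subseteq> B + E"
  shows "A \<subseteq> B"
proof
  fix a assume "a \<in> A"
  show "a \<in> B"
  proof (rule ccontr)
    assume "a \<notin> B"
    then obtain u c where u: "u \<bullet> a < c" "\<forall>x\<in>B. u \<bullet> x > c"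
      using separating_hyperplane_closed_point[of B a] assms by (auto simp: compact_imp_closed)
    obtain e where e: "e \<in> E" "\<And>x. x \<in> E \<Longrightarrow> u \<bullet> e \<le> u \<bullet> x"
      using continuous_attains_inf[of E "\<lambda>x. u \<bullet> x"] assms(3,4) continuous_on_inner[of E "\<lambda>_. u" "\<lambda>x. x"]
      by (metis continuous_on_const continuous_on_id)
    have "a + e \<in> B + E" using \<open>a \<in> A\<close> e(1) assms(5) by blast
    then obtain b e' where "a + e = b + e'" "b \<in> B" "e' \<in> E" by (auto simp: set_plus_def)
    then have "u \<bullet> a + u \<bullet> e = u \<bullet> b + u \<bullet> e'" by (metis inner_add_right)
    with u e(2)[OF \<open>e' \<in> E\<close>] \<open>b \<in> B\<close> show False by fastforce
  qed
qed

section \<open>Virtual zonoids\<close>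

typedef (overloaded) 'a czonoid = "{Z :: 'a::euclidean_space set. zonoid Z \<and> centered Z}"
  by (rule exI[of _ "{0}"]) (simp add: zonoid_0 centered_def)

setup_lifting type_definition_czonoid

instantiation czonoid :: (euclidean_space) comm_monoid_add
begin

lift_definition zero_czonoid :: "'a czonoid" is "{0}"
  by (simp add: zonoid_0 centered_def)

lift_definition plus_czonoid :: "'a czonoid \<Rightarrow> 'a czonoid \<Rightarrow> 'a czonoid" is "(+)"
  by (auto simp: zonoid_plus centered_def linear_image_plus linear_uminus)

instance
proof
  fix A B C :: "'a czonoid"
  show "A + B + C = A + (B + C)" by transfer (simp add: add.assoc)
  show "A + B = B + A" by transfer (simp add: add.commute)
  show "0 + A = A" by transfer (simp add: set_plus_def)
qed

end

lemma czonoid_cancel: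
  fixes A B E :: "'a::euclidean_space czonoid"
  assumes "A + E = B + E" shows "A = B"
  using assms
proof transfer
  fix A B E :: "'a set"
  assume "zonoid A \<and> centered A" "zonoid B \<and> centered B" "zonoid E \<and> centered E" "A + E = B + E"
  then show "A = B"
    using minkowski_cancel_subset[of B E A] minkowski_cancel_subset[of A E B]
    by (auto simp: zonoid_convex zonoid_def)
qed

lift_definition czonoid_scale :: "real \<Rightarrow> 'a::euclidean_space czonoid \<Rightarrow> 'a czonoid"
  is "\<lambda>c Z. (*\<^sub>R) c ` Z"
proof -
  fix c :: real and Z :: "'a set"
  assume Z: "zonoid Z \<and> centered Z"
  then have "uminus ` (*\<^sub>R) c ` Z = (*\<^sub>R) c ` uminus ` Z"
    by (auto simp: image_image)
  with Z show "zonoid ((*\<^sub>R) c ` Z) \<and> centered ((*\<^sub>R) c ` Z)"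
    by (simp add: zonoid_scaleR centered_def)
qed

lemma czonoid_scale_add: "czonoid_scale c (A + B) = czonoid_scale c A + czonoid_scale c B"
  by transfer (simp add: linear_image_plus linear_scaleR)

lemma czonoid_scale_scale: "czonoid_scale c (czonoid_scale d A) = czonoid_scale (c * d) A"
  by transfer (simp add: image_image)

lemma czonoid_scale_1: "czonoid_scale 1 A = A"
  by transfer simp

lemma czonoid_scale_minus: "czonoid_scale (- c) A = czonoid_scale c A"
proof transfer
  fix c :: real and A :: "'a set"
  assume "zonoid A \<and> centered A"
  then have "uminus ` A = A" by (simp add: centered_def)
  then show "(*\<^sub>R) (- c) ` A = (*\<^sub>R) c ` A"
    using image_image[of "(*\<^sub>R) c" uminus A] by simp
qed

lemma czonoid_scale_plus:
  assumes "0 \<le> c" "0 \<le> d"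
  shows "czonoid_scale (c + d) A = czonoid_scale c A + czonoid_scale d A"
  using assms
proof transfer
  fix c d :: real and A :: "'a set"
  assume cd: "0 \<le> c" "0 \<le> d" and A: "zonoid A \<and> centered A"
  show "(*\<^sub>R) (c + d) ` A = (*\<^sub>R) c ` A + (*\<^sub>R) d ` A"
  proof
    show "(*\<^sub>R) (c + d) ` A \<subseteq> (*\<^sub>R) c ` A + (*\<^sub>R) d ` A"
      by (auto simp: scaleR_add_left intro: set_plus_memI)
    show "(*\<^sub>R) c ` A + (*\<^sub>R) d ` A \<subseteq> (*\<^sub>R) (c + d) ` A"
    proof
      fix z assume "z \<in> (*\<^sub>R) c ` A + (*\<^sub>R) d ` A"
      then obtain x y where z: "z = c *\<^sub>R x + d *\<^sub>R y" "x \<in> A" "y \<in> A"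
        by (auto simp: set_plus_def)
      show "z \<in> (*\<^sub>R) (c + d) ` A"
      proof (cases "c + d = 0")
        case True
        with cd have "c = 0" "d = 0" by auto
        with z show ?thesis by auto
      next
        case False
        have "(c / (c + d)) *\<^sub>R x + (d / (c + d)) *\<^sub>R y \<in> A"
          using zonoid_convex A z False cd
          by (intro convexD) (auto simp: add_divide_distrib[symmetric])
        moreover have "z = (c + d) *\<^sub>R ((c / (c + d)) *\<^sub>R x + (d / (c + d)) *\<^sub>R y)"
          using False z by (simp add: scaleR_add_right)
        ultimately show ?thesis by blast
      qed
    qed
  qed
qed

lemma czonoid_scale_0: "czonoid_scale 0 A = 0"
  by transfer (auto simp: zonoid_def)

definition vzonoid_rel ::
    "'a::euclidean_space czonoid \<times> 'a czonoid \<Rightarrow> 'a czonoid \<times> 'a czonoid \<Rightarrow> bool" where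
  "vzonoid_rel = (\<lambda>(A, B) (C, D). A + D = C + B)"

lemma vzonoid_rel_iff [simp]: "vzonoid_rel (A, B) (C, D) \<longleftrightarrow> A + D = C + B"
  by (simp add: vzonoid_rel_def)

quotient_type (overloaded) 'a vzonoid = "'a::euclidean_space czonoid \<times> 'a czonoid" / vzonoid_rel
proof (rule equivpI)
  show "reflp (vzonoid_rel :: 'a czonoid \<times> 'a czonoid \<Rightarrow> _)"
    by (auto simp: vzonoid_rel_def reflp_def)
  show "symp (vzonoid_rel :: 'a czonoid \<times> 'a czonoid \<Rightarrow> _)"
    by (auto simp: vzonoid_rel_def symp_def)
  show "transp (vzonoid_rel :: 'a czonoid \<times> 'a czonoid \<Rightarrow> _)"
  proof (rule transpI)
    fix x y z :: "'a czonoid \<times> 'a czonoid"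
    assume "vzonoid_rel x y" "vzonoid_rel y z"
    moreover obtain A B C D E F where "x = (A, B)" "y = (C, D)" "z = (E, F)"
      by (metis surj_pair)
    ultimately have xyz: "x = (A, B)" "z = (E, F)" and 1: "A + D = C + B" and 2: "C + F = E + D"
      by auto
    have "(A + F) + D = (A + D) + F" by (simp add: add_ac)
    also have "\<dots> = (C + F) + B" unfolding 1 by (simp add: add_ac)
    also have "\<dots> = (E + B) + D" unfolding 2 by (simp add: add_ac)
    finally have "A + F = E + B" by (rule czonoid_cancel)
    then show "vzonoid_rel x z" unfolding xyz by simp
  qed
qed

instantiation vzonoid :: (euclidean_space) ab_group_add
begin

lift_definition zero_vzonoid :: "'a vzonoid" is "(0, 0)" .

lift_definition plus_vzonoid :: "'a vzonoid \<Rightarrow> 'a vzonoid \<Rightarrow> 'a vzonoid"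
  is "\<lambda>x y. (fst x + fst y, snd x + snd y)"
proof -
  fix x y z w :: "'a czonoid \<times> 'a czonoid"
  assume "vzonoid_rel x y" "vzonoid_rel z w"
  then have "fst x + snd y = fst y + snd x" "fst z + snd w = fst w + snd z"
    by (auto simp: vzonoid_rel_def split: prod.splits)
  then have "(fst x + snd y) + (fst z + snd w) = (fst y + snd x) + (fst w + snd z)" by simp
  then show "vzonoid_rel (fst x + fst z, snd x + snd z) (fst y + fst w, snd y + snd w)"
    by (simp add: add_ac)
qed

lift_definition uminus_vzonoid :: "'a vzonoid \<Rightarrow> 'a vzonoid" is "\<lambda>x. (snd x, fst x)"
  by (auto simp: vzonoid_rel_def add.commute)

definition minus_vzonoid :: "'a vzonoid \<Rightarrow> 'a vzonoid \<Rightarrow> 'a vzonoid" where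
  "minus_vzonoid x y = x + - y"

instance
proof
  fix x y z :: "'a vzonoid"
  show "x + y + z = x + (y + z)" by transfer (simp add: add_ac)
  show "x + y = y + x" by transfer (simp add: add_ac)
  show "0 + x = x" by transfer (auto simp: add_ac)
  show "- x + x = 0" by transfer (simp add: add_ac)
  show "x - y = x + - y" by (simp add: minus_vzonoid_def)
qed

end

text \<open>For a negative factor \<open>c (A - B) = \<bar>c\<bar> B - \<bar>c\<bar> A\<close>; the Minkowski dilate \<open>c A\<close> of a
  centered set only depends on \<open>\<bar>c\<bar>\<close>.\<close>

instantiation vzonoid :: (euclidean_space) real_vector
begin

lift_definition scaleR_vzonoid :: "real \<Rightarrow> 'a vzonoid \<Rightarrow> 'a vzonoid"
  is "\<lambda>c x. if 0 \<le> c then (czonoid_scale c (fst x), czonoid_scale c (snd x))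
            else (czonoid_scale c (snd x), czonoid_scale c (fst x))"
proof -
  fix c :: real and x y :: "'a czonoid \<times> 'a czonoid"
  assume "vzonoid_rel x y"
  then have "fst x + snd y = fst y + snd x"
    by (auto simp: vzonoid_rel_def split: prod.splits)
  then have "czonoid_scale c (fst x) + czonoid_scale c (snd y)
      = czonoid_scale c (fst y) + czonoid_scale c (snd x)"
    by (metis czonoid_scale_add)
  then show "vzonoid_rel
      (if 0 \<le> c then (czonoid_scale c (fst x), czonoid_scale c (snd x))
       else (czonoid_scale c (snd x), czonoid_scale c (fst x)))
      (if 0 \<le> c then (czonoid_scale c (fst y), czonoid_scale c (snd y))
       else (czonoid_scale c (snd y), czonoid_scale c (fst y)))"
    by (simp add: add.commute)
qed

lemma vzonoid_scale_nonneg: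
  "0 \<le> c \<Longrightarrow> 0 \<le> d \<Longrightarrow> (c + d) *\<^sub>R x = c *\<^sub>R x + d *\<^sub>R x" for x :: "'a vzonoid"
  by transfer (simp only: if_True add_nonneg_nonneg czonoid_scale_plus fst_conv snd_conv
      vzonoid_rel_iff add_ac)

lemma vzonoid_scale_minus: "(- c) *\<^sub>R x = - (c *\<^sub>R x)" for x :: "'a vzonoid"
proof transfer
  fix c :: real and x :: "'a czonoid \<times> 'a czonoid"
  show "vzonoid_rel
      (if 0 \<le> - c then (czonoid_scale (- c) (fst x), czonoid_scale (- c) (snd x))
       else (czonoid_scale (- c) (snd x), czonoid_scale (- c) (fst x)))
      (snd (if 0 \<le> c then (czonoid_scale c (fst x), czonoid_scale c (snd x))
            else (czonoid_scale c (snd x), czonoid_scale c (fst x))),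
       fst (if 0 \<le> c then (czonoid_scale c (fst x), czonoid_scale c (snd x))
            else (czonoid_scale c (snd x), czonoid_scale c (fst x))))"
    using linorder_less_linear[of c 0]
    by (elim disjE) (simp_all add: czonoid_scale_minus czonoid_scale_0)
qed

instance
proof
  fix x y :: "'a vzonoid" and c d :: real
  show "c *\<^sub>R (x + y) = c *\<^sub>R x + c *\<^sub>R y"
    by transfer (auto simp: czonoid_scale_add add_ac)
  show "1 *\<^sub>R x = x"
    by transfer (auto simp: czonoid_scale_1 vzonoid_rel_def)
  show "c *\<^sub>R d *\<^sub>R x = (c * d) *\<^sub>R x"
  proof transfer
    fix c d :: real and x :: "'a czonoid \<times> 'a czonoid"
    show "vzonoid_rel
      (if 0 \<le> c then (czonoid_scale c (fst (if 0 \<le> d then (czonoid_scale d (fst x), czonoid_scale d (snd x))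
                          else (czonoid_scale d (snd x), czonoid_scale d (fst x)))),
           czonoid_scale c (snd (if 0 \<le> d then (czonoid_scale d (fst x), czonoid_scale d (snd x))
                          else (czonoid_scale d (snd x), czonoid_scale d (fst x)))))
       else (czonoid_scale c (snd (if 0 \<le> d then (czonoid_scale d (fst x), czonoid_scale d (snd x))
                          else (czonoid_scale d (snd x), czonoid_scale d (fst x)))),
           czonoid_scale c (fst (if 0 \<le> d then (czonoid_scale d (fst x), czonoid_scale d (snd x))
                          else (czonoid_scale d (snd x), czonoid_scale d (fst x))))))
      (if 0 \<le> c * d then (czonoid_scale (c * d) (fst x), czonoid_scale (c * d) (snd x))
       else (czonoid_scale (c * d) (snd x), czonoid_scale (c * d) (fst x)))"
      using linorder_less_linear[of c 0] linorder_less_linear[of d 0]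
      by (elim disjE) (simp_all add: czonoid_scale_scale czonoid_scale_0 zero_le_mult_iff)
  qed
  have mixed: "(a - b) *\<^sub>R x = a *\<^sub>R x - b *\<^sub>R x" if "0 \<le> a" "0 \<le> b" for a b
  proof (cases "b \<le> a")
    case True
    then show ?thesis using vzonoid_scale_nonneg[of "a - b" b x] that by simp
  next
    case False
    then show ?thesis
      using vzonoid_scale_nonneg[of "b - a" a x] vzonoid_scale_minus[of "b - a" x] that
      by (simp add: algebra_simps)
  qed
  have minus: "e *\<^sub>R x = - ((- e) *\<^sub>R x)" for e
    using vzonoid_scale_minus[of e x] by simp
  consider "0 \<le> c" "0 \<le> d" | "0 \<le> c" "d < 0" | "c < 0" "0 \<le> d" | "c < 0" "d < 0" by linarith
  then show "(c + d) *\<^sub>R x = c *\<^sub>R x + d *\<^sub>R x"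
  proof cases
    case 1 then show ?thesis by (rule vzonoid_scale_nonneg)
  next
    case 2 then show ?thesis using mixed[of c "- d"] minus[of d] by simp
  next
    case 3 then show ?thesis using mixed[of d "- c"] minus[of c] by (simp add: add.commute)
  next
    case 4 then show ?thesis
      using vzonoid_scale_nonneg[of "- c" "- d" x] minus[of c] minus[of d] minus[of "c + d"] by simp
  qed
qed

end

definition vz_of :: "'a::euclidean_space czonoid \<Rightarrow> 'a vzonoid" where
  "vz_of A = abs_vzonoid (A, 0)"

section \<open>Zonoids of random vectors\<close>

text \<open>The convex body with support function \<open>u \<mapsto> 1/2 E\<bar>\<langle>u, \<xi>\<rangle>\<bar>\<close>.\<close>

definition zonoid_of :: "'b measure \<Rightarrow> ('b \<Rightarrow> 'a::euclidean_space) \<Rightarrow> 'a set" where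
  "zonoid_of M \<xi> = {x. \<forall>u. u \<bullet> x \<le> 1/2 * (\<integral>\<omega>. \<bar>u \<bullet> \<xi> \<omega>\<bar> \<partial>M)}"

definition vK :: "'b measure \<Rightarrow> ('b \<Rightarrow> 'a::euclidean_space) \<Rightarrow> 'a vzonoid" where
  "vK M \<xi> = vz_of (Abs_czonoid (zonoid_of M \<xi>))"

text \<open>Quantification over all integrable random vectors is quantification over their laws:
  HOL cannot quantify over the type of the sample space, but \<open>K(\<xi>) = K(id)\<close> on the sample
  space \<open>W\<close> equipped with the law of \<open>\<xi>\<close>.  Independent vectors with laws \<open>\<mu>\<close>, \<open>\<nu>\<close> are the two
  coordinates on the product space.\<close>

definition integrable_law :: "'a::euclidean_space measure \<Rightarrow> bool" where
  "integrable_law \<mu> \<longleftrightarrow> prob_space \<mu> \<and> sets \<mu> = sets borel \<and> integrable \<mu> (\<lambda>x. x)"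

section \<open>The exterior algebra of a Euclidean space\<close>

text \<open>For \<open>V = \<real>\<^sup>n\<close> with index type \<^typ>\<open>'n\<close>, ordered by \<^const>\<open>to_nat\<close>, the exterior algebra
  \<open>\<Lambda>V\<close> is \<^typ>\<open>real ^ ('n set)\<close>; the coordinate \<open>S\<close> belongs to the wedge product, in increasing
  order, of the standard basis vectors with index in \<open>S\<close>.  These are orthonormal for the induced
  inner product, so the inner product of \<^typ>\<open>real ^ ('n set)\<close> restricts to the induced one on
  every \<open>\<Lambda>\<^sup>dV\<close>.\<close>

definition wedge_sign :: "'n::countable set \<Rightarrow> 'n set \<Rightarrow> real" where
  "wedge_sign S T = (- 1) ^ card {(s, t). s \<in> S \<and> t \<in> T \<and> to_nat t < to_nat s}"

definition ext_wedge :: "real ^ ('n::finite set) \<Rightarrow> real ^ ('n set) \<Rightarrow> real ^ ('n set)" where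
  "ext_wedge x y = (\<chi> U. \<Sum>S\<in>Pow U. wedge_sign S (U - S) * x $ S * y $ (U - S))"

definition ext_one :: "real ^ ('n::finite set)" where
  "ext_one = axis {} 1"

definition ext_vec :: "real ^ 'n \<Rightarrow> real ^ ('n::finite set)" where
  "ext_vec v = (\<Sum>i\<in>UNIV. v $ i *\<^sub>R axis {i} 1)"

definition ext_prod :: "(real ^ 'n) list \<Rightarrow> real ^ ('n::finite set)" where
  "ext_prod vs = foldr (\<lambda>v x. ext_wedge (ext_vec v) x) vs ext_one"

text \<open>The scalar factor only matters for \<open>d = 0\<close>: all elements of \<open>\<Lambda>\<^sup>0V = \<real>\<close> are simple.\<close>

definition simple_vectors :: "nat \<Rightarrow> (real ^ ('n::finite set)) set" where
  "simple_vectors d = {c *\<^sub>R ext_prod vs | c vs. length vs = d}"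

text \<open>The algebra endomorphism of \<open>\<Lambda>V\<close> induced by a linear map \<open>\<phi> : V \<rightarrow> V\<close>.\<close>

definition ext_map :: "(real ^ 'n \<Rightarrow> real ^ 'n) \<Rightarrow> real ^ ('n set) \<Rightarrow> real ^ ('n::finite set)" where
  "ext_map \<phi> x = (\<Sum>S\<in>UNIV. x $ S *\<^sub>R
     ext_prod (map (\<lambda>i. \<phi> (axis i 1)) (sorted_key_list_of_set to_nat S)))"

section \<open>The ring of classes of Grassmann zonoids\<close>

text \<open>Since every centered zonoid is some \<open>K(\<xi>)\<close> and these span the virtual zonoids, the
  prescribed values determine the two bilinear maps below.  The product is defined on all virtual
  zonoids of \<open>\<Lambda>V\<close> and restricts to the graded product of the spaces of virtual zonoids of
  \<open>\<Lambda>\<^sup>dV\<close>.\<close>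

definition vwedge ::
    "(real ^ ('n::finite set)) vzonoid \<Rightarrow> (real ^ ('n set)) vzonoid \<Rightarrow> (real ^ ('n set)) vzonoid" where
  "vwedge = (SOME m. bilinear m \<and>
     (\<forall>\<mu> \<nu>. integrable_law \<mu> \<longrightarrow> integrable_law \<nu> \<longrightarrow>
        m (vK \<mu> (\<lambda>x. x)) (vK \<nu> (\<lambda>y. y)) = vK (\<mu> \<Otimes>\<^sub>M \<nu>) (\<lambda>(x, y). ext_wedge x y)))"

definition vpairing :: "'a::euclidean_space vzonoid \<Rightarrow> 'a vzonoid \<Rightarrow> real" where
  "vpairing = (SOME p. bilinear p \<and>
     (\<forall>\<mu> \<nu>. integrable_law \<mu> \<longrightarrow> integrable_law \<nu> \<longrightarrow>
        p (vK \<mu> (\<lambda>x. x)) (vK \<nu> (\<lambda>y. y)) = (\<integral>(x, y). \<bar>x \<bullet> y\<bar> \<partial>(\<mu> \<Otimes>\<^sub>M \<nu>))))"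

definition grassmann_vzonoids :: "nat \<Rightarrow> (real ^ ('n::finite set)) vzonoid set" where
  "grassmann_vzonoids d =
     span {vK \<mu> (\<lambda>x. x) | \<mu>. integrable_law \<mu> \<and> (AE x in \<mu>. x \<in> simple_vectors d)}"

definition null_vzonoids :: "nat \<Rightarrow> (real ^ ('n::finite set)) vzonoid set" where
  "null_vzonoids d =
     {x \<in> grassmann_vzonoids d. \<forall>y\<in>grassmann_vzonoids d. vpairing x y = 0}"

text \<open>The direct sums over the degree \<open>d\<close> are formed inside the virtual zonoids of \<open>\<Lambda>V\<close>.  There
  the sum is direct: the support functions of elements of degree \<open>d\<close> depend only on the component
  in \<open>\<Lambda>\<^sup>dV\<close> and vanish at \<open>0\<close>.\<close>

definition grassmann_ring :: "(real ^ ('n::finite set)) vzonoid ring" where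
  "grassmann_ring = \<lparr>carrier = span (\<Union>d. grassmann_vzonoids d), mult = vwedge,
     one = vK (return borel ext_one) (\<lambda>x. x), zero = 0, add = (+)\<rparr>"

definition null_ideal :: "(real ^ ('n::finite set)) vzonoid set" where
  "null_ideal = span (\<Union>d. null_vzonoids d)"

definition Q_ring :: "(real ^ ('n::finite set)) vzonoid set ring" where
  "Q_ring = grassmann_ring Quot null_ideal"

section \<open>The probabilistic intersection ring of \<open>G(2,2)\<close>\<close>

text \<open>\<open>V = \<real>\<^sup>2 \<otimes> \<real>\<^sup>2\<close> is \<^typ>\<open>real ^ (2 \<times> 2)\<close>.\<close>

definition tensor :: "real ^ 2 \<Rightarrow> real ^ 2 \<Rightarrow> real ^ (2 \<times> 2)" where
  "tensor e f = (\<chi> p. e $ fst p * f $ snd p)"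

definition H_group :: "((real ^ 2 ^ 2) \<times> (real ^ 2 ^ 2)) set" where
  "H_group = {g. orthogonal_matrix g} \<times> {k. orthogonal_matrix k}"

text \<open>\<open>(g, k)\<close> acts by \<open>g \<otimes> k\<close>.\<close>

definition H_act :: "(real ^ 2 ^ 2) \<times> (real ^ 2 ^ 2) \<Rightarrow> real ^ (2 \<times> 2) \<Rightarrow> real ^ (2 \<times> 2)" where
  "H_act h v = (\<chi> p. \<Sum>q\<in>UNIV. fst h $ fst p $ fst q * snd h $ snd p $ snd q * v $ q)"

text \<open>The Haar probability measure.\<close>

definition H_uniform :: "((real ^ 2 ^ 2) \<times> (real ^ 2 ^ 2)) measure" where
  "H_uniform = (THE \<mu>. prob_space \<mu> \<and> sets \<mu> = sets (restrict_space borel H_group) \<and>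
     (\<forall>g\<in>H_group. distr \<mu> \<mu> (\<lambda>h. (fst g ** fst h, snd g ** snd h)) = \<mu>))"

text \<open>The map of virtual zonoids \<open>A - B \<mapsto> \<phi> A - \<phi> B\<close> induced by a linear map \<open>\<phi>\<close>, so that
  \<open>K(\<xi>) \<mapsto> K(\<phi> \<xi>)\<close>.\<close>

definition vz_map :: "('a \<Rightarrow> 'a) \<Rightarrow> 'a::euclidean_space vzonoid \<Rightarrow> 'a vzonoid" where
  "vz_map \<phi> x = (THE y. \<exists>A B. x = vz_of A - vz_of B \<and>
     y = vz_of (Abs_czonoid (\<phi> ` Rep_czonoid A)) - vz_of (Abs_czonoid (\<phi> ` Rep_czonoid B)))"

definition HE :: "(real, (real ^ ((2 \<times> 2) set)) vzonoid set) module" where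
  "HE = \<lparr>carrier = {X \<in> carrier Q_ring. \<forall>h\<in>H_group. vz_map (ext_map (H_act h)) ` X = X},
     mult = mult Q_ring, one = one Q_ring, zero = zero Q_ring, add = add Q_ring,
     smult = (\<lambda>c X. \<Union>x\<in>X. null_ideal +>\<^bsub>grassmann_ring\<^esub> (c *\<^sub>R x))\<rparr>"

section \<open>Schubert varieties and their volumes\<close>

text \<open>Hausdorff measure, normalised so that it agrees with Lebesgue measure on \<open>\<real>\<^sup>s\<close>.\<close>

definition hausdorff_content :: "nat \<Rightarrow> real \<Rightarrow> 'a::metric_space set \<Rightarrow> ennreal" where
  "hausdorff_content s \<delta> A =
     (INF C\<in>{C :: nat \<Rightarrow> 'a set. A \<subseteq> (\<Union>n. C n) \<and> (\<forall>n. bounded (C n) \<and> diameter (C n) \<le> \<delta>)}.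
        \<Sum>n. if C n = {} then 0 else ennreal (unit_ball_vol (real s) * (diameter (C n) / 2) ^ s))"

definition hausdorff_measure :: "nat \<Rightarrow> 'a::metric_space set \<Rightarrow> ennreal" where
  "hausdorff_measure s A = (SUP \<delta>\<in>{0<..}. hausdorff_content s \<delta> A)"

definition Gr22 :: "(real ^ 4) set set" where
  "Gr22 = {L. subspace L \<and> dim L = 2}"

text \<open>The \<open>O(4)\<close>-invariant Riemannian metrics on \<open>G(2,2)\<close> are unique up to scale.  A tangent
  vector \<open>\<alpha> : L \<rightarrow> L\<^sup>\<bottom>\<close> moves the orthogonal projection onto \<open>L\<close> by a matrix of Frobenius norm
  \<open>\<surd>2 \<parallel>\<alpha>\<parallel>\<close>.  Hence the map below embeds \<open>G(2,2)\<close> isometrically in the Euclidean space of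
  matrices when it carries \<open>r\<^sup>2\<close> times the metric that induces the standard inner product on
  \<open>\<real>\<^sup>2 \<otimes> \<real>\<^sup>2\<close>, and Riemannian volumes are Hausdorff measures of images.\<close>

definition Gr_embed :: "real \<Rightarrow> (real ^ 4) set \<Rightarrow> real ^ 4 ^ 4" where
  "Gr_embed r L = (r / sqrt 2) *\<^sub>R matrix (closest_point L)"

definition Gr_vol :: "real \<Rightarrow> nat \<Rightarrow> (real ^ 4) set set \<Rightarrow> real" where
  "Gr_vol r s X = enn2real (hausdorff_measure s (Gr_embed r ` X))"

definition complete_flag :: "(nat \<Rightarrow> (real ^ 4) set) \<Rightarrow> bool" where
  "complete_flag F \<longleftrightarrow> (\<forall>i\<in>{1..4}. subspace (F i) \<and> dim (F i) = i) \<and> (\<forall>i\<in>{1..3}. F i \<subseteq> F (Suc i))"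

definition young_diagram :: "nat list \<Rightarrow> (nat \<times> nat) set" where
  "young_diagram ls = {(i, j). 1 \<le> i \<and> i \<le> length ls \<and> 1 \<le> j \<and> j \<le> ls ! (i - 1)}"

definition schubert_variety :: "(nat \<Rightarrow> (real ^ 4) set) \<Rightarrow> (nat \<times> nat) set \<Rightarrow> (real ^ 4) set set" where
  "schubert_variety F D = {L \<in> Gr22. \<forall>(i, j)\<in>D. i \<le> dim (L \<inter> F (2 + i - j))}"

definition orthonormal_pair :: "(nat \<Rightarrow> real ^ 2) \<Rightarrow> bool" where
  "orthonormal_pair e \<longleftrightarrow> norm (e 1) = 1 \<and> norm (e 2) = 1 \<and> e 1 \<bullet> e 2 = 0"

text \<open>The order of the factors only affects the sign, and \<open>K(\<xi>) = K(- \<xi>)\<close>.\<close>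

definition schubert_vector ::
    "(nat \<Rightarrow> real ^ 2) \<Rightarrow> (nat \<Rightarrow> real ^ 2) \<Rightarrow> (nat \<times> nat) set \<Rightarrow> real ^ ((2 \<times> 2) set)" where
  "schubert_vector e f D =
     ext_prod (map (\<lambda>(i, j). tensor (e i) (f j)) (sorted_key_list_of_set to_nat D))"

text \<open>\<open>\<Omega>\<^sub>D\<close> has codimension \<open>card D\<close> in the 4-dimensional \<open>G(2,2)\<close>.  The space \<open>V\<close> is always
  identified with \<open>\<real>\<^sup>2 \<otimes> \<real>\<^sup>2\<close> by an isometry, so the scale \<open>r\<close> of the metric enters only through
  the volumes.\<close>

definition schubert_zonoid :: "real \<Rightarrow> (nat \<Rightarrow> (real ^ 4) set) \<Rightarrow> (nat \<Rightarrow> real ^ 2) \<Rightarrow>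
    (nat \<Rightarrow> real ^ 2) \<Rightarrow> (nat \<times> nat) set \<Rightarrow> (real ^ ((2 \<times> 2) set)) vzonoid" where
  "schubert_zonoid r F e f D =
     (Gr_vol r (4 - card D) (schubert_variety F D) / Gr_vol r 4 Gr22) *\<^sub>R
       vK H_uniform (\<lambda>h. ext_map (H_act h) (schubert_vector e f D))"

definition schubert_class :: "real \<Rightarrow> (nat \<Rightarrow> (real ^ 4) set) \<Rightarrow> (nat \<Rightarrow> real ^ 2) \<Rightarrow>
    (nat \<Rightarrow> real ^ 2) \<Rightarrow> (nat \<times> nat) set \<Rightarrow> (real ^ ((2 \<times> 2) set)) vzonoid set" where
  "schubert_class r F e f D = null_ideal +>\<^bsub>grassmann_ring\<^esub> schubert_zonoid r F e f D"

end

theory Submission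
  imports Defs
begin

text \<open>For a class \<open>K(\<xi>)\<close> of degree two consider \<open>E(\<bar>X\<bar> + \<bar>Y\<bar> - \<bar>X + Y\<bar>)\<close>, where
  \<open>X = \<langle>\<xi>, t\<^sub>1\<^sub>1 \<and> t\<^sub>1\<^sub>2\<rangle>\<close>, \<open>Y = \<langle>\<xi>, t\<^sub>1\<^sub>1 \<and> t\<^sub>2\<^sub>1\<rangle>\<close> and \<open>t\<^sub>i\<^sub>j\<close> is the standard basis of
  \<open>\<real>\<^sup>2 \<otimes> \<real>\<^sup>2\<close>.  Since \<open>t\<^sub>1\<^sub>1 \<and> t\<^sub>1\<^sub>2 + t\<^sub>1\<^sub>1 \<and> t\<^sub>2\<^sub>1 = t\<^sub>1\<^sub>1 \<and> (t\<^sub>1\<^sub>2 + t\<^sub>2\<^sub>1)\<close> is simple, this is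
  a combination of pairings with Grassmann zonoids and hence a linear functional that vanishes on the
  null ideal.  It vanishes on the two Schubert classes of codimension two, because there \<open>X = 0\<close> or
  \<open>Y = 0\<close> identically.  On the square of the codimension one class it is positive: \<open>X\<close> and \<open>Y\<close>
  have opposite signs on a nonempty open set, which has positive Haar measure.  The scalar factor of
  the codimension one class is positive, as the volumes in it are positive and finite: charts by
  normalised bases are bi-Lipschitz.\<close>

text \<open>Most objects are introduced through a choice operator or an abstraction function
  (\<open>SOME\<close> for \<open>vwedge\<close> and \<open>vpairing\<close>, \<open>THE\<close> for
  \<open>H_uniform\<close>, \<open>Abs_czonoid\<close> in \<open>vK\<close>), so nothing can be
  computed before the intended object is shown to exist. This is why the proof has to establish that
  K(\<xi>) is a centered zonoid, that the values prescribed on generators respect all linear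
  relations (tested through support functions), and that O(2) x O(2) carries exactly one left
  invariant probability measure. Pairing with a point mass at L then becomes the explicit integral
  E|<\<xi>, L>|. The integrand |X| + |Y| - |X + Y| is nonnegative, and positive exactly when X and Y
  have strictly opposite signs. A row diagram gives planes x \<otimes> R^2, a column diagram planes
  R^2 \<otimes> y, and each kind is orthogonal to one of the two test planes. A product of two
  codimension one classes also produces planes spanned by x \<otimes> y and x' \<otimes> y' with
  both factors different, and these can meet the two test planes with opposite signs.\<close>

section \<open>Convex bodies and their support functions\<close>

text \<open>Requiring the bound to be attained expresses \<open>h\<close> as a maximum without
  \<open>Sup\<close> and forces \<open>Z\<close> to be nonempty.\<close>

definition has_support :: "'a::euclidean_space set \<Rightarrow> ('a \<Rightarrow> real) \<Rightarrow> bool" where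
  "has_support Z h \<longleftrightarrow> compact Z \<and> convex Z \<and>
     (\<forall>u. (\<forall>x\<in>Z. u \<bullet> x \<le> h u) \<and> (\<exists>x\<in>Z. u \<bullet> x = h u))"

text \<open>Let \<open>z\<close> be the point of \<open>Z'\<close> nearest to \<open>x\<close> and d
  = x - z. As \<open>d\<close> is an outer normal of \<open>Z'\<close> at \<open>z\<close>, h' d
  \<le> d . z, whence |d|^2 = d . x - d . z \<le> h d - h' d \<le> \<epsilon> |d|. The case
  \<epsilon> = 0 gives uniqueness of the body; small \<epsilon> gives Hausdorff closeness.\<close>

lemma has_support_near:
  assumes Z: "has_support Z h" and Z': "has_support Z' h'"
    and le: "\<And>u. h u \<le> h' u + \<epsilon> * norm u" and "0 \<le> \<epsilon>" and "x \<in> Z"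
  shows "\<exists>z\<in>Z'. dist x z \<le> \<epsilon>"
proof -
  have cc: "closed Z'" "convex Z'" "Z' \<noteq> {}"
    using Z' by (auto simp: has_support_def compact_imp_closed)
  define z where "z = closest_point Z' x"
  have z: "z \<in> Z'" unfolding z_def using cc by (simp add: closest_point_in_set)
  define d where "d = x - z"
  obtain y where y: "y \<in> Z'" "d \<bullet> y = h' d" using Z' by (auto simp: has_support_def)
  have "d \<bullet> (y - z) \<le> 0"
    using closest_point_dot[OF cc(2,1) y(1), of x] by (simp add: d_def z_def)
  moreover have "d \<bullet> x \<le> h d" using Z \<open>x \<in> Z\<close> by (auto simp: has_support_def)
  moreover have "d \<bullet> d = d \<bullet> x - d \<bullet> z" by (simp add: d_def inner_diff_right)
  ultimately have "d \<bullet> d \<le> \<epsilon> * norm d" using le[of d] y by (simp add: inner_diff_right)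
  then have "norm d * norm d \<le> \<epsilon> * norm d" by (simp add: power2_norm_eq_inner[symmetric] power2_eq_square)
  then have "norm d \<le> \<epsilon>" using \<open>0 \<le> \<epsilon>\<close> by (cases "norm d = 0") auto
  then show ?thesis using z by (auto simp: d_def dist_norm)
qed

lemma has_support_unique:
  assumes "has_support Z h" "has_support Z' h" shows "Z = Z'"
  using has_support_near[OF assms, of 0] has_support_near[OF assms(2,1), of 0] by auto

lemma has_support_0: "has_support {0} (\<lambda>u. 0)"
  by (simp add: has_support_def)

lemma has_support_plus:
  assumes A: "has_support A g" and B: "has_support B h"
  shows "has_support (A + B) (\<lambda>u. g u + h u)"
  unfolding has_support_def
proof (intro conjI allI ballI)
  show "compact (A + B)"
    using assms compact_sums[of A B] by (simp add: has_support_def set_plus_def Bex_def conj_ac)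
  show "convex (A + B)" using assms by (simp add: has_support_def convex_set_plus)
  fix u
  show "u \<bullet> x \<le> g u + h u" if "x \<in> A + B" for x
    using that assms by (fastforce simp: has_support_def set_plus_def inner_add_right intro: add_mono)
  obtain x where "x \<in> A" "u \<bullet> x = g u" using A unfolding has_support_def by blast
  moreover obtain y where "y \<in> B" "u \<bullet> y = h u" using B unfolding has_support_def by blast
  ultimately
  show "\<exists>x\<in>A + B. u \<bullet> x = g u + h u"
    by (intro bexI[of _ "x + y"]) (auto simp: inner_add_right)
qed

lemma has_support_linear_image:
  assumes "has_support A g" "linear f" "\<And>u x. u \<bullet> f x = f' u \<bullet> x"
  shows "has_support (f ` A) (\<lambda>u. g (f' u))"
  using assms unfolding has_support_def
  by (auto intro!: compact_continuous_image linear_continuous_on convex_linear_image simp: linear_conv_bounded_linear)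

lemma has_support_uminus:
  assumes "has_support A g" shows "has_support (uminus ` A) (\<lambda>u. g (- u))"
  by (rule has_support_linear_image[OF assms linear_uminus]) simp

lemma has_support_scaleR:
  assumes "has_support A g" shows "has_support ((*\<^sub>R) c ` A) (\<lambda>u. g (c *\<^sub>R u))"
  by (rule has_support_linear_image[OF assms linear_scaleR]) simp

lemma has_support_segment: "has_support (closed_segment (- a) a) (\<lambda>u. \<bar>u \<bullet> a\<bar>)"
  unfolding has_support_def
proof (intro conjI allI ballI)
  fix u x assume "x \<in> closed_segment (- a) a"
  then obtain t where t: "0 \<le> t" "t \<le> 1" "x = (1 - t) *\<^sub>R (- a) + t *\<^sub>R a"
    by (auto simp: in_segment)
  have "u \<bullet> x = (2 * t - 1) * (u \<bullet> a)" unfolding t(3) inner_add_right by (simp add: algebra_simps)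
  also have "\<dots> \<le> \<bar>2 * t - 1\<bar> * \<bar>u \<bullet> a\<bar>" by (metis abs_ge_self abs_mult)
  also have "\<dots> \<le> 1 * \<bar>u \<bullet> a\<bar>" using t by (intro mult_right_mono) auto
  finally show "u \<bullet> x \<le> \<bar>u \<bullet> a\<bar>" by simp
next
  fix u
  show "\<exists>x\<in>closed_segment (- a) a. u \<bullet> x = \<bar>u \<bullet> a\<bar>"
  proof (cases "0 \<le> u \<bullet> a")
    case True then show ?thesis by (intro bexI[of _ a]) auto
  next
    case False then show ?thesis by (intro bexI[of _ "- a"]) auto
  qed
qed auto

lemma has_support_zonotope:
  "has_support (\<Sum>(a, b)\<leftarrow>map (\<lambda>y. (- y, y)) ys. closed_segment a b) (\<lambda>u. \<Sum>y\<leftarrow>ys. \<bar>u \<bullet> y\<bar>)"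
proof (induction ys)
  case Nil
  then show ?case using has_support_0 by (simp add: set_zero)
next
  case (Cons y ys)
  then show ?case using has_support_plus[OF has_support_segment Cons] by simp
qed

text \<open>The point of the epigraph cone below \<open>(u, h u)\<close> is separated from the cone; the
  separating functional is a point of the level set that almost attains \<open>h u\<close>.\<close>

lemma sublinear_has_support:
  fixes h :: "'a::euclidean_space \<Rightarrow> real"
  assumes add: "\<And>u v. h (u + v) \<le> h u + h v"
    and scale: "\<And>c u. 0 \<le> c \<Longrightarrow> h (c *\<^sub>R u) = c * h u"
    and cont: "continuous_on UNIV h" and bound: "\<And>u. h u \<le> C * norm u"
  shows "has_support {x. \<forall>u. u \<bullet> x \<le> h u} h"
proof -
  define K where "K = {x. \<forall>u. u \<bullet> x \<le> h u}"
  have K_Int: "K = (\<Inter>u. {x. u \<bullet> x \<le> h u})" by (auto simp: K_def)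
  have "closed K" unfolding K_Int by (intro closed_INT ballI closed_halfspace_le)
  moreover have "convex K" unfolding K_Int by (intro convex_INT convex_halfspace_le)
  moreover have "bounded K"
    unfolding bounded_iff
  proof (intro exI[of _ "C"] ballI)
    fix x assume "x \<in> K"
    then have "x \<bullet> x \<le> h x" by (simp add: K_def)
    then have "x \<bullet> x \<le> C * norm x" using bound[of x] by (rule order.trans)
    then have *: "norm x * norm x \<le> C * norm x" by (simp add: power2_norm_eq_inner[symmetric] power2_eq_square)
    show "norm x \<le> C"
    proof (cases "x = 0")
      case True
      \<comment> \<open>For x = 0 the claim is C \<ge> 0; this follows from 0 = h 0 \<le> h b + h
        (-b) \<le> 2 C for a unit vector \<open>b\<close>.\<close>
      obtain b :: 'a where "b \<in> Basis" using nonempty_Basis by blast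
      moreover have "h b + h (- b) \<ge> 0" using add[of b "- b"] scale[of 0 0] by simp
      ultimately show ?thesis using True bound[of b] bound[of "- b"] by simp
    qed (use * in simp)
  qed
  ultimately have K: "compact K" "convex K" by (auto simp: compact_eq_bounded_closed)
  have near: "\<exists>x\<in>K. h u - \<epsilon> < u \<bullet> x" if "\<epsilon> > 0" for u \<epsilon>
  proof -
    define E where "E = {p :: 'a \<times> real. h (fst p) \<le> snd p}"
    have "convex E"
      unfolding convex_def
    proof (intro ballI allI impI)
      fix p q and s t :: real assume pq: "p \<in> E" "q \<in> E" "0 \<le> s" "0 \<le> t" "s + t = 1"
      have "h (s *\<^sub>R fst p + t *\<^sub>R fst q) \<le> s * h (fst p) + t * h (fst q)"
        using add[of "s *\<^sub>R fst p" "t *\<^sub>R fst q"] pq by (simp add: scale)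
      also have "\<dots> \<le> s * snd p + t * snd q"
        using pq by (intro add_mono mult_left_mono) (auto simp: E_def)
      finally show "s *\<^sub>R p + t *\<^sub>R q \<in> E" by (simp add: E_def)
    qed
    moreover have "closed E"
      unfolding E_def
      by (intro closed_Collect_le continuous_intros continuous_on_compose2[OF cont]) auto
    moreover have "(u, h u - \<epsilon>) \<notin> E" using that by (simp add: E_def)
    ultimately obtain p c where p: "p \<bullet> (u, h u - \<epsilon>) < c" "\<And>y. y \<in> E \<Longrightarrow> p \<bullet> y > c"
      using separating_hyperplane_closed_point[of E "(u, h u - \<epsilon>)"] by blast
    obtain a b where ab: "p = (a, b)" by (cases p)
    have "0 \<in> E" using scale[of 0 0] by (simp add: E_def zero_prod_def)
    then have "c < 0" using p(2)[of 0] by simp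
    \<comment> \<open>\<open>E\<close> is a cone: a point with negative value could be scaled until
      the functional equals \<open>c\<close>, which the strict separation excludes.\<close>
    have cone: "p \<bullet> y \<ge> 0" if "y \<in> E" for y
    proof (rule ccontr)
      assume "\<not> ?thesis"
      then have neg: "p \<bullet> y < 0" by simp
      define t where "t = c / (p \<bullet> y)"
      have "t \<ge> 0" using neg \<open>c < 0\<close> by (simp add: t_def divide_nonpos_nonpos)
      then have "t *\<^sub>R y \<in> E" using that by (auto simp: E_def scale mult_left_mono)
      then have "p \<bullet> (t *\<^sub>R y) > c" by (rule p(2))
      then show False using neg by (simp add: t_def)
    qed
    have "p \<bullet> (u, h u) \<ge> 0" by (rule cone) (simp add: E_def)
    then have "b * \<epsilon> > 0" using p(1) \<open>c < 0\<close> by (simp add: ab algebra_simps)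
    then have b: "b > 0" using that by (simp add: zero_less_mult_iff)
    define x where "x = (- 1 / b) *\<^sub>R a"
    have "x \<in> K" unfolding K_def
    proof (intro CollectI allI)
      fix v
      have "p \<bullet> (v, h v) \<ge> 0" by (rule cone) (simp add: E_def)
      then have "a \<bullet> v + b * h v \<ge> 0" by (simp add: ab)
      then show "v \<bullet> x \<le> h v" using b by (simp add: x_def inner_commute field_simps)
    qed
    moreover have "h u - \<epsilon> < u \<bullet> x"
    proof -
      have "a \<bullet> u + b * (h u - \<epsilon>) < 0" using p(1) \<open>c < 0\<close> by (simp add: ab)
      then show ?thesis using b by (simp add: x_def inner_commute field_simps)
    qed
    ultimately show ?thesis by blast
  qed
  have "\<exists>x\<in>K. u \<bullet> x = h u" for u
  proof -
    have "K \<noteq> {}" using near[of 1 0] by auto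
    moreover have "continuous_on K (\<lambda>x. u \<bullet> x)" by (intro continuous_intros)
    ultimately obtain x where x: "x \<in> K" "\<And>y. y \<in> K \<Longrightarrow> u \<bullet> y \<le> u \<bullet> x"
      using continuous_attains_sup[OF K(1), of "\<lambda>x. u \<bullet> x"] by auto
    have "h u \<le> u \<bullet> x + \<epsilon>" if "\<epsilon> > 0" for \<epsilon> using near[OF that, of u] x(2) by fastforce
    then have "h u \<le> u \<bullet> x" by (rule field_le_epsilon)
    then show ?thesis using x(1) by (intro bexI[of _ x] antisym) (auto simp: K_def)
  qed
  then show ?thesis using K unfolding has_support_def K_def[symmetric] by (auto simp: K_def)
qed

section \<open>The zonoid of an integrable random vector\<close>

text \<open>Up to the factor 1/2 this is the cosine transform of the law of \<xi>; with the factor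
  it is the support function of \<open>zonoid_of M \<xi>\<close> for integrable \<xi>.\<close>

definition cosine :: "'b measure \<Rightarrow> ('b \<Rightarrow> 'a::euclidean_space) \<Rightarrow> 'a \<Rightarrow> real" where
  "cosine M \<xi> u = 1/2 * (\<integral>\<omega>. \<bar>u \<bullet> \<xi> \<omega>\<bar> \<partial>M)"

lemma integrable_abs_inner [simp]:
  "integrable M \<xi> \<Longrightarrow> integrable M (\<lambda>\<omega>. \<bar>u \<bullet> \<xi> \<omega>\<bar>)"
  by (intro integrable_abs integrable_inner_right)

lemma cosine_diff_le:
  assumes "integrable M \<xi>" "integrable M \<zeta>"
  shows "cosine M \<xi> u \<le> cosine M \<zeta> u + (1/2 * (\<integral>\<omega>. norm (\<xi> \<omega> - \<zeta> \<omega>) \<partial>M)) * norm u"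
proof -
  have "(\<integral>\<omega>. \<bar>u \<bullet> \<xi> \<omega>\<bar> \<partial>M) \<le> (\<integral>\<omega>. \<bar>u \<bullet> \<zeta> \<omega>\<bar> + norm u * norm (\<xi> \<omega> - \<zeta> \<omega>) \<partial>M)"
  proof (rule integral_mono)
    fix \<omega>
    have "u \<bullet> \<xi> \<omega> = u \<bullet> \<zeta> \<omega> + u \<bullet> (\<xi> \<omega> - \<zeta> \<omega>)" by (simp add: inner_diff_right)
    then show "\<bar>u \<bullet> \<xi> \<omega>\<bar> \<le> \<bar>u \<bullet> \<zeta> \<omega>\<bar> + norm u * norm (\<xi> \<omega> - \<zeta> \<omega>)"
      using Cauchy_Schwarz_ineq2[of u "\<xi> \<omega> - \<zeta> \<omega>"] by linarith
  qed (use assms in auto)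
  then show ?thesis using assms by (simp add: cosine_def algebra_simps)
qed

lemma cosine_Lipschitz:
  assumes "integrable M \<xi>"
  shows "\<bar>cosine M \<xi> u - cosine M \<xi> v\<bar> \<le> (1/2 * (\<integral>\<omega>. norm (\<xi> \<omega>) \<partial>M)) * norm (u - v)"
proof -
  have "\<bar>(\<integral>\<omega>. \<bar>u \<bullet> \<xi> \<omega>\<bar> \<partial>M) - (\<integral>\<omega>. \<bar>v \<bullet> \<xi> \<omega>\<bar> \<partial>M)\<bar> = \<bar>\<integral>\<omega>. \<bar>u \<bullet> \<xi> \<omega>\<bar> - \<bar>v \<bullet> \<xi> \<omega>\<bar> \<partial>M\<bar>"
    using assms by simp
  also have "\<dots> \<le> (\<integral>\<omega>. \<bar>\<bar>u \<bullet> \<xi> \<omega>\<bar> - \<bar>v \<bullet> \<xi> \<omega>\<bar>\<bar> \<partial>M)" by (rule integral_abs_bound)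
  also have "\<dots> \<le> (\<integral>\<omega>. norm (u - v) * norm (\<xi> \<omega>) \<partial>M)"
  proof (rule integral_mono)
    fix \<omega>
    have "\<bar>\<bar>u \<bullet> \<xi> \<omega>\<bar> - \<bar>v \<bullet> \<xi> \<omega>\<bar>\<bar> \<le> \<bar>u \<bullet> \<xi> \<omega> - v \<bullet> \<xi> \<omega>\<bar>" by linarith
    also have "\<dots> = \<bar>(u - v) \<bullet> \<xi> \<omega>\<bar>" by (simp add: inner_diff_left)
    also have "\<dots> \<le> norm (u - v) * norm (\<xi> \<omega>)" by (rule Cauchy_Schwarz_ineq2)
    finally show "\<bar>\<bar>u \<bullet> \<xi> \<omega>\<bar> - \<bar>v \<bullet> \<xi> \<omega>\<bar>\<bar> \<le> norm (u - v) * norm (\<xi> \<omega>)" .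
  qed (use assms in auto)
  finally have "\<bar>(\<integral>\<omega>. \<bar>u \<bullet> \<xi> \<omega>\<bar> \<partial>M) - (\<integral>\<omega>. \<bar>v \<bullet> \<xi> \<omega>\<bar> \<partial>M)\<bar> \<le> norm (u - v) * (\<integral>\<omega>. norm (\<xi> \<omega>) \<partial>M)"
    by simp
  moreover have eq: "cosine M \<xi> u - cosine M \<xi> v
      = 1/2 * ((\<integral>\<omega>. \<bar>u \<bullet> \<xi> \<omega>\<bar> \<partial>M) - (\<integral>\<omega>. \<bar>v \<bullet> \<xi> \<omega>\<bar> \<partial>M))"
    by (simp add: cosine_def field_simps)
  ultimately show ?thesis unfolding eq abs_mult by (simp add: mult.commute)
qed

lemma has_support_zonoid_of:
  fixes \<xi> :: "'b \<Rightarrow> 'a::euclidean_space"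
  assumes "integrable M \<xi>"
  shows "has_support (zonoid_of M \<xi>) (cosine M \<xi>)"
  unfolding zonoid_of_def cosine_def[symmetric]
proof (rule sublinear_has_support)
  fix u v :: 'a and c :: real
  have "(\<integral>\<omega>. \<bar>(u + v) \<bullet> \<xi> \<omega>\<bar> \<partial>M) \<le> (\<integral>\<omega>. \<bar>u \<bullet> \<xi> \<omega>\<bar> + \<bar>v \<bullet> \<xi> \<omega>\<bar> \<partial>M)"
    by (rule integral_mono) (use assms in \<open>auto simp: inner_add_left\<close>)
  then show "cosine M \<xi> (u + v) \<le> cosine M \<xi> u + cosine M \<xi> v" using assms by (simp add: cosine_def)
  show "cosine M \<xi> (c *\<^sub>R u) = c * cosine M \<xi> u" if "0 \<le> c" using that by (simp add: cosine_def abs_mult)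
  show "continuous_on UNIV (cosine M \<xi>)"
  proof (rule lipschitz_on_continuous_on)
    show "(1/2 * (\<integral>\<omega>. norm (\<xi> \<omega>) \<partial>M))-lipschitz_on UNIV (cosine M \<xi>)"
      using cosine_Lipschitz[OF assms] by (intro lipschitz_onI) (auto simp: dist_norm)
  qed
  show "cosine M \<xi> u \<le> (1/2 * (\<integral>\<omega>. norm (\<xi> \<omega>) \<partial>M)) * norm u"
    using cosine_Lipschitz[OF assms, of u 0] by (simp add: cosine_def)
qed

text \<open>If \<xi> takes the value y with mass m(y), the support function is the finite sum of |u
  . z| over z = (m(y) / 2) y. The sum of the segments [-z, z] has the same support function, hence
  is the same body.\<close>

lemma zonotope_zonoid_of_simple:
  fixes s :: "'b \<Rightarrow> 'a::euclidean_space"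
  assumes s: "Bochner_Integration.simple_bochner_integrable M s"
  shows "zonotope (zonoid_of M s)"
proof -
  have int: "integrable M s"
    using has_bochner_integral_simple_bochner_integrable[OF s] by (auto simp: integrable.simps)
  have fin: "finite (s ` space M)" using s by (simp add: Bochner_Integration.simple_bochner_integrable.simps simple_function_def)
  obtain ys where ys: "set ys = s ` space M" "distinct ys" using finite_distinct_list[OF fin] by blast
  define m where "m y = measure M {x \<in> space M. s x = y}" for y
  define zs where "zs = map (\<lambda>y. (m y / 2) *\<^sub>R y) ys"
  have "cosine M s u = (\<Sum>y\<leftarrow>zs. \<bar>u \<bullet> y\<bar>)" for u
  proof -
    have sb: "Bochner_Integration.simple_bochner_integrable M (\<lambda>x. \<bar>u \<bullet> s x\<bar>)"
      using simple_bochner_integrable_compose2[of "\<lambda>a b. \<bar>u \<bullet> a\<bar>", OF _ s s] by simp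
    have "(\<integral>x. \<bar>u \<bullet> s x\<bar> \<partial>M) = Bochner_Integration.simple_bochner_integral M (\<lambda>x. \<bar>u \<bullet> s x\<bar>)"
      using sb by (rule simple_bochner_integrable_eq_integral[symmetric])
    also have "\<dots> = (\<Sum>y\<in>s ` space M. m y *\<^sub>R \<bar>u \<bullet> y\<bar>)"
      unfolding m_def
      by (rule simple_bochner_integral_partition[OF sb])
        (use s in \<open>auto simp: Bochner_Integration.simple_bochner_integrable.simps\<close>)
    also have "\<dots> = (\<Sum>y\<leftarrow>ys. m y * \<bar>u \<bullet> y\<bar>)"
      using ys by (simp add: sum_list_distinct_conv_sum_set)
    finally show ?thesis
      by (simp add: cosine_def zs_def sum_list_const_mult[symmetric] o_def abs_mult m_def)
  qed
  then have "cosine M s = (\<lambda>u. \<Sum>y\<leftarrow>zs. \<bar>u \<bullet> y\<bar>)" by auto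
  then have "zonoid_of M s = (\<Sum>(a, b)\<leftarrow>map (\<lambda>y. (- y, y)) zs. closed_segment a b)"
    using has_support_zonoid_of[OF int] has_support_zonotope[of zs] has_support_unique by metis
  then show ?thesis unfolding zonotope_def by blast
qed

text \<open>Unfolding Bochner integrability supplies simple functions converging to \<xi> in L^1.
  Half the L^1 distance bounds the difference of the support functions on unit vectors, so the
  zonotopes of the simple functions converge in the Hausdorff sense. This is what gives
  \<open>Abs_czonoid\<close> in \<open>vK\<close> its meaning.\<close>

lemma zonoid_zonoid_of:
  fixes \<xi> :: "'b \<Rightarrow> 'a::euclidean_space"
  assumes int: "integrable M \<xi>"
  shows "zonoid (zonoid_of M \<xi>)"
proof -
  from int obtain s where meas: "\<xi> \<in> borel_measurable M"
    and s: "\<And>i. Bochner_Integration.simple_bochner_integrable M (s i)"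
    and lim: "(\<lambda>i. \<integral>\<^sup>+x. norm (\<xi> x - s i x) \<partial>M) \<longlonglongrightarrow> 0"
    unfolding integrable.simps has_bochner_integral.simps by blast
  have ints: "integrable M (s i)" for i
    using has_bochner_integral_simple_bochner_integrable[OF s] by (auto simp: integrable.simps)
  define d where "d i = (\<integral>x. norm (\<xi> x - s i x) \<partial>M)" for i
  have "ennreal (d i) = (\<integral>\<^sup>+x. norm (\<xi> x - s i x) \<partial>M)" for i
    unfolding d_def using int ints by (intro nn_integral_eq_integral[symmetric]) auto
  with lim have "(\<lambda>i. ennreal (d i)) \<longlonglongrightarrow> ennreal 0" by simp
  then have d0: "d \<longlonglongrightarrow> 0" by (rule tendsto_ennrealD) (auto simp: d_def)
  have "hausdorff_limit (\<lambda>i. zonoid_of M (s i)) (zonoid_of M \<xi>)"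
    unfolding hausdorff_limit_def
  proof (intro allI impI)
    fix \<epsilon> :: real assume "\<epsilon> > 0"
    with d0 have "\<forall>\<^sub>F i in sequentially. d i < \<epsilon>" by (rule order_tendstoD)
    then show "\<forall>\<^sub>F i in sequentially. (\<forall>x\<in>zonoid_of M (s i). \<exists>z\<in>zonoid_of M \<xi>. dist x z < \<epsilon>)
      \<and> (\<forall>z\<in>zonoid_of M \<xi>. \<exists>x\<in>zonoid_of M (s i). dist x z < \<epsilon>)"
    proof eventually_elim
      case (elim i)
      have "0 \<le> d i" by (simp add: d_def)
      then have d: "1/2 * d i < \<epsilon>" "0 \<le> 1/2 * d i" using elim by auto
      have "cosine M (s i) u \<le> cosine M \<xi> u + (1/2 * d i) * norm u" for u
        using cosine_diff_le[OF ints int, of i u] by (simp add: d_def norm_minus_commute)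
      moreover have "cosine M \<xi> u \<le> cosine M (s i) u + (1/2 * d i) * norm u" for u
        using cosine_diff_le[OF int ints, of u i] by (simp add: d_def)
      ultimately show ?case
        using has_support_near[OF has_support_zonoid_of[OF ints] has_support_zonoid_of[OF int] _ d(2)]
          has_support_near[OF has_support_zonoid_of[OF int] has_support_zonoid_of[OF ints] _ d(2)] d(1)
        by (smt (verit, best) dist_commute)
    qed
  qed
  moreover have "compact (zonoid_of M \<xi>)" "zonoid_of M \<xi> \<noteq> {}"
    using has_support_zonoid_of[OF int] by (auto simp: has_support_def)
  moreover have "\<forall>i. zonotope (zonoid_of M (s i))" using s by (simp add: zonotope_zonoid_of_simple)
  ultimately show ?thesis
    unfolding zonoid_def by (intro conjI exI[of _ "\<lambda>i. zonoid_of M (s i)"]) simp_all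
qed

lemma centered_zonoid_of:
  assumes "integrable M \<xi>" shows "centered (zonoid_of M \<xi>)"
proof -
  have "(\<lambda>u. cosine M \<xi> (- u)) = cosine M \<xi>" by (simp add: cosine_def fun_eq_iff)
  then show ?thesis
    using has_support_uminus[OF has_support_zonoid_of[OF assms]] has_support_zonoid_of[OF assms]
    unfolding centered_def by (metis has_support_unique)
qed

lemma Rep_czonoid_zonoid_of:
  "integrable M \<xi> \<Longrightarrow> Rep_czonoid (Abs_czonoid (zonoid_of M \<xi>)) = zonoid_of M \<xi>"
  by (simp add: Abs_czonoid_inverse zonoid_zonoid_of centered_zonoid_of)

section \<open>Support functions of virtual zonoids\<close>

definition csupp :: "'a::euclidean_space czonoid \<Rightarrow> 'a \<Rightarrow> real" where
  "csupp A u = (SUP x\<in>Rep_czonoid A. u \<bullet> x)"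

lemma csupp_eqI:
  assumes "has_support (Rep_czonoid A) h" shows "csupp A = h"
proof
  fix u
  obtain x where "x \<in> Rep_czonoid A" "u \<bullet> x = h u" "\<And>y. y \<in> Rep_czonoid A \<Longrightarrow> u \<bullet> y \<le> h u"
    using assms by (auto simp: has_support_def)
  then show "csupp A u = h u"
    unfolding csupp_def by (intro cSup_eq_maximum) (auto intro!: image_eqI[of _ _ x])
qed

lemma has_support_csupp: "has_support (Rep_czonoid A) (csupp A)"
proof -
  define Z where "Z = Rep_czonoid A"
  have Z: "compact Z" "convex Z" "Z \<noteq> {}"
    using Rep_czonoid[of A] by (auto simp: Z_def zonoid_def zonoid_convex)
  have "(\<forall>x\<in>Z. u \<bullet> x \<le> csupp A u) \<and> (\<exists>x\<in>Z. u \<bullet> x = csupp A u)" for u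
  proof -
    have "continuous_on Z (\<lambda>x. u \<bullet> x)" by (intro continuous_intros)
    then obtain x where x: "x \<in> Z" "\<And>y. y \<in> Z \<Longrightarrow> u \<bullet> y \<le> u \<bullet> x"
      using continuous_attains_sup[OF Z(1,3)] by blast
    then have "csupp A u = u \<bullet> x"
      unfolding csupp_def Z_def[symmetric] by (intro cSup_eq_maximum) auto
    with x show ?thesis by auto
  qed
  with Z show ?thesis by (simp add: has_support_def Z_def)
qed

lemma csupp_bounds:
  "(\<forall>x\<in>Rep_czonoid A. u \<bullet> x \<le> csupp A u) \<and> (\<exists>x\<in>Rep_czonoid A. u \<bullet> x = csupp A u)"
  using has_support_csupp[of A] by (simp add: has_support_def)

lemma csupp_inject: "csupp A = csupp B \<longleftrightarrow> A = B"
  using has_support_unique[of "Rep_czonoid A" "csupp A" "Rep_czonoid B"] has_support_csupp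
  by (metis Rep_czonoid_inject)

lemma csupp_0: "csupp (0 :: 'a::euclidean_space czonoid) u = 0"
  using csupp_eqI[of "0 :: 'a czonoid" "\<lambda>u. 0"] has_support_0 by (metis zero_czonoid.rep_eq)

lemma csupp_plus: "csupp (A + B) u = csupp A u + csupp B u"
  using csupp_eqI[of "A + B"] has_support_plus[OF has_support_csupp has_support_csupp]
  by (metis plus_czonoid.rep_eq)

lemma csupp_homogeneous:
  assumes "0 \<le> c" shows "csupp A (c *\<^sub>R u) = c * csupp A u"
proof -
  note H = csupp_bounds[of A]
  obtain x where x: "x \<in> Rep_czonoid A" "u \<bullet> x = csupp A u" using H by blast
  obtain y where y: "y \<in> Rep_czonoid A" "(c *\<^sub>R u) \<bullet> y = csupp A (c *\<^sub>R u)" using H by blast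
  have "(c *\<^sub>R u) \<bullet> x \<le> csupp A (c *\<^sub>R u)" using H x by blast
  moreover have "c * (u \<bullet> y) \<le> c * csupp A u" using H y assms by (blast intro: mult_left_mono)
  ultimately show ?thesis using x y by simp
qed

lemma csupp_scale:
  assumes "0 \<le> c" shows "csupp (czonoid_scale c A) u = c * csupp A u"
proof -
  have "has_support (Rep_czonoid (czonoid_scale c A)) (\<lambda>u. csupp A (c *\<^sub>R u))"
    unfolding czonoid_scale.rep_eq by (rule has_support_scaleR[OF has_support_csupp])
  then show ?thesis using assms by (simp add: csupp_eqI csupp_homogeneous)
qed

lemma csupp_Lipschitz: "\<exists>C. \<forall>u v. \<bar>csupp A u - csupp A v\<bar> \<le> C * norm (u - v)"
proof -
  note H = csupp_bounds[of A]
  have "bounded (Rep_czonoid A)"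
    using has_support_csupp[of A] by (simp add: has_support_def compact_imp_bounded)
  then obtain C where C: "\<And>x. x \<in> Rep_czonoid A \<Longrightarrow> norm x \<le> C"
    by (auto simp: bounded_iff)
  have one: "csupp A u - csupp A v \<le> C * norm (u - v)" for u v
  proof -
    obtain x where x: "x \<in> Rep_czonoid A" "u \<bullet> x = csupp A u" using H by blast
    have "csupp A u - csupp A v \<le> u \<bullet> x - v \<bullet> x" using x H by fastforce
    also have "\<dots> = (u - v) \<bullet> x" by (simp add: inner_diff_left)
    also have "\<dots> \<le> norm (u - v) * norm x" by (rule norm_cauchy_schwarz)
    also have "\<dots> \<le> norm (u - v) * C" by (intro mult_left_mono C x norm_ge_zero)
    finally show ?thesis by (simp add: mult.commute)
  qed
  then have "\<forall>u v. \<bar>csupp A u - csupp A v\<bar> \<le> C * norm (u - v)"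
    by (metis abs_le_iff minus_diff_eq norm_minus_commute)
  then show ?thesis by blast
qed

text \<open>Support functions turn Minkowski sums into sums, so the difference depends only on the
  class. The result is a faithful linear representation of virtual zonoids by Lipschitz functions,
  which serves to compare and to separate them.\<close>

lift_definition vsupp :: "'a::euclidean_space vzonoid \<Rightarrow> 'a \<Rightarrow> real"
  is "\<lambda>p u. csupp (fst p) u - csupp (snd p) u"
proof -
  fix p q :: "'a czonoid \<times> 'a czonoid"
  assume "vzonoid_rel p q"
  then have *: "fst p + snd q = fst q + snd p" by (auto simp: vzonoid_rel_def split: prod.splits)
  have "csupp (fst p) u + csupp (snd q) u = csupp (fst q) u + csupp (snd p) u" for u
    using * by (metis csupp_plus)
  then show "(\<lambda>u. csupp (fst p) u - csupp (snd p) u) = (\<lambda>u. csupp (fst q) u - csupp (snd q) u)"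
    by (simp add: fun_eq_iff algebra_simps)
qed

lemma linear_vsupp: "linear (\<lambda>x. vsupp x u)"
proof
  show "vsupp (x + y) u = vsupp x u + vsupp y u" for x y
    by transfer (simp add: csupp_plus)
  show "vsupp (c *\<^sub>R x) u = c *\<^sub>R vsupp x u" for c x
  proof transfer
    fix c :: real and x :: "'a czonoid \<times> 'a czonoid" and u :: 'a
    have "csupp (czonoid_scale c A) u = - c * csupp A u" if "c < 0" for A
      using csupp_scale[of "- c" A u] that by (simp add: czonoid_scale_minus)
    then show "csupp (fst (if 0 \<le> c then (czonoid_scale c (fst x), czonoid_scale c (snd x))
          else (czonoid_scale c (snd x), czonoid_scale c (fst x)))) u
        - csupp (snd (if 0 \<le> c then (czonoid_scale c (fst x), czonoid_scale c (snd x))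
          else (czonoid_scale c (snd x), czonoid_scale c (fst x)))) u
        = c *\<^sub>R (csupp (fst x) u - csupp (snd x) u)"
      by (simp add: csupp_scale algebra_simps)
  qed
qed

lemma vsupp_eq_0:
  assumes "\<And>u. vsupp x u = 0" shows "x = 0"
  using assms
proof transfer
  fix x :: "'a czonoid \<times> 'a czonoid"
  assume "\<And>u. csupp (fst x) u - csupp (snd x) u = 0"
  then have "csupp (fst x) = csupp (snd x)" by (simp add: fun_eq_iff)
  then show "vzonoid_rel x (0, 0)" by (simp add: csupp_inject vzonoid_rel_def split_beta)
qed

lemma vsupp_Lipschitz: "\<exists>C. \<forall>u v. \<bar>vsupp x u - vsupp x v\<bar> \<le> C * norm (u - v)"
proof transfer
  fix x :: "'a czonoid \<times> 'a czonoid"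
  obtain C D where CD: "\<And>u v. \<bar>csupp (fst x) u - csupp (fst x) v\<bar> \<le> C * norm (u - v)"
    "\<And>u v. \<bar>csupp (snd x) u - csupp (snd x) v\<bar> \<le> D * norm (u - v)"
    using csupp_Lipschitz by metis
  show "\<exists>C. \<forall>u v. \<bar>csupp (fst x) u - csupp (snd x) u - (csupp (fst x) v - csupp (snd x) v)\<bar> \<le> C * norm (u - v)"
  proof (intro exI[of _ "C + D"] allI)
    fix u v
    show "\<bar>csupp (fst x) u - csupp (snd x) u - (csupp (fst x) v - csupp (snd x) v)\<bar> \<le> (C + D) * norm (u - v)"
      using CD[of u v] by (simp add: distrib_right)
  qed
qed

lemma vsupp_0_right: "vsupp x 0 = 0"
  by transfer (metis csupp_homogeneous diff_self mult_zero_left order_refl scaleR_zero_left)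

lemma vsupp_continuous: "continuous_on UNIV (vsupp x)"
proof -
  obtain C where C: "\<forall>u v. \<bar>vsupp x u - vsupp x v\<bar> \<le> C * norm (u - v)" using vsupp_Lipschitz by blast
  have "\<bar>C\<bar>-lipschitz_on UNIV (vsupp x)"
  proof (rule lipschitz_onI)
    fix u v
    have "dist (vsupp x u) (vsupp x v) \<le> C * norm (u - v)" using C by (simp add: dist_real_def)
    also have "\<dots> \<le> \<bar>C\<bar> * norm (u - v)" by (intro mult_right_mono) auto
    finally show "dist (vsupp x u) (vsupp x v) \<le> \<bar>C\<bar> * dist u v" by (simp add: dist_norm)
  qed simp
  then show ?thesis by (rule lipschitz_on_continuous_on)
qed

lemma vsupp_vK:
  assumes "integrable M \<xi>" shows "vsupp (vK M \<xi>) = cosine M \<xi>"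
proof -
  have "csupp (Abs_czonoid (zonoid_of M \<xi>)) = cosine M \<xi>"
    by (rule csupp_eqI) (simp add: Rep_czonoid_zonoid_of assms has_support_zonoid_of)
  then show ?thesis
    unfolding vK_def vz_of_def vsupp.abs_eq by (simp add: csupp_0)
qed

section \<open>Bilinear extension from generators\<close>

text \<open>The issue is that every linear relation among the \<open>k i\<close> must hold among the
  \<open>g i\<close>. The functionals \<open>\<phi> u\<close> separate points, so it is enough to
  test the relation after applying each of them, where the value is already a linear function
  \<open>T\<close> of \<open>k i\<close>.\<close>

lemma linear_extension:
  fixes k :: "'i \<Rightarrow> 'x::real_vector" and g :: "'i \<Rightarrow> 'y::real_vector" and \<phi> :: "'u \<Rightarrow> 'y \<Rightarrow> real"
  assumes \<phi>: "\<And>u. linear (\<phi> u)" and sep: "\<And>y. (\<And>u. \<phi> u y = 0) \<Longrightarrow> y = 0"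
    and T: "\<And>u. \<exists>T. linear T \<and> (\<forall>i\<in>I. \<phi> u (g i) = T (k i))"
  shows "\<exists>G. linear G \<and> (\<forall>i\<in>I. G (k i) = g i)"
proof -
  obtain B where B: "B \<subseteq> k ` I" "independent B" "k ` I \<subseteq> span B"
    using maximal_independent_subset .
  then have "\<forall>b\<in>B. \<exists>i\<in>I. b = k i" by blast
  then obtain i where i: "\<And>b. b \<in> B \<Longrightarrow> i b \<in> I \<and> b = k (i b)" by metis
  obtain G where G: "linear G" "\<And>b. b \<in> B \<Longrightarrow> G b = g (i b)"
    using linear_independent_extend[OF B(2), of "\<lambda>b. g (i b)"] by blast
  have "G (k j) = g j" if j: "j \<in> I" for j
  proof -
    have "\<phi> u (G (k j) - g j) = 0" for u
    proof -
      obtain T where T: "linear T" "\<And>i. i \<in> I \<Longrightarrow> \<phi> u (g i) = T (k i)" using T by blast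
      have "(\<phi> u \<circ> G) (k j) = T (k j)"
      proof (rule linear_eq_on[where f = "\<phi> u \<circ> G" and g = T and x = "k j" and B = B])
        show "linear (\<phi> u \<circ> G)" by (rule linear_compose[OF G(1) \<phi>])
        show "k j \<in> span B" using B(3) j by blast
        show "(\<phi> u \<circ> G) b = T b" if "b \<in> B" for b
          using G(2)[OF that] T(2)[of "i b"] i[OF that] by simp
      qed (rule T(1))
      then show ?thesis using T(2)[OF j] by (simp add: linear_diff[OF \<phi>])
    qed
    then show ?thesis using sep[of "G (k j) - g j"] by simp
  qed
  with G(1) show ?thesis by blast
qed

text \<open>Extend in each variable separately. Then \<open>m\<close> is built from a basis of
  generators in the first variable, with the extensions \<open>G'\<close> in the second variable as
  values. For fixed \<open>l\<close> it agrees with the other extension \<open>G l\<close> on the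
  basis, hence at every generator.\<close>

lemma bilinear_extension:
  fixes k :: "'i \<Rightarrow> 'x::real_vector" and g :: "'i \<Rightarrow> 'i \<Rightarrow> 'y::real_vector" and \<phi> :: "'u \<Rightarrow> 'y \<Rightarrow> real"
  assumes \<phi>: "\<And>u. linear (\<phi> u)" and sep: "\<And>y. (\<And>u. \<phi> u y = 0) \<Longrightarrow> y = 0"
    and T1: "\<And>u l. l \<in> I \<Longrightarrow> \<exists>T. linear T \<and> (\<forall>i\<in>I. \<phi> u (g i l) = T (k i))"
    and T2: "\<And>u i. i \<in> I \<Longrightarrow> \<exists>T. linear T \<and> (\<forall>l\<in>I. \<phi> u (g i l) = T (k l))"
  shows "\<exists>m. bilinear m \<and> (\<forall>i\<in>I. \<forall>l\<in>I. m (k i) (k l) = g i l)"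
proof -
  have "\<forall>l\<in>I. \<exists>G. linear G \<and> (\<forall>i\<in>I. G (k i) = g i l)"
  proof
    fix l assume "l \<in> I"
    show "\<exists>G. linear G \<and> (\<forall>i\<in>I. G (k i) = g i l)"
      by (rule linear_extension[OF \<phi> sep T1[OF \<open>l \<in> I\<close>]])
  qed
  then obtain G where G: "\<And>l. l \<in> I \<Longrightarrow> linear (G l)" "\<And>l i. l \<in> I \<Longrightarrow> i \<in> I \<Longrightarrow> G l (k i) = g i l"
    by metis
  have "\<forall>i\<in>I. \<exists>G. linear G \<and> (\<forall>l\<in>I. G (k l) = g i l)"
  proof
    fix i assume "i \<in> I"
    show "\<exists>G. linear G \<and> (\<forall>l\<in>I. G (k l) = g i l)"
      by (rule linear_extension[OF \<phi> sep T2[OF \<open>i \<in> I\<close>]])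
  qed
  then obtain G' where G': "\<And>i. i \<in> I \<Longrightarrow> linear (G' i)" "\<And>l i. l \<in> I \<Longrightarrow> i \<in> I \<Longrightarrow> G' i (k l) = g i l"
    by metis
  obtain B where B: "B \<subseteq> k ` I" "independent B" "k ` I \<subseteq> span B"
    using maximal_independent_subset .
  then have "\<forall>b\<in>B. \<exists>i\<in>I. b = k i" by blast
  then obtain j where j: "\<And>b. b \<in> B \<Longrightarrow> j b \<in> I \<and> b = k (j b)" by metis
  define m where "m x y = construct B (\<lambda>b. G' (j b) y) x" for x y
  have lin1: "linear (\<lambda>x. m x y)" for y
    unfolding m_def by (rule linear_construct[OF B(2)])
  have lin2: "linear (m x)" for x
  proof
    fix y z :: 'x and c :: real
    have "m x (y + z) = construct B (\<lambda>b. G' (j b) y + G' (j b) z) x"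
      unfolding m_def using j by (intro fun_cong[OF construct_cong]) (simp add: G' linear_add)
    then show "m x (y + z) = m x y + m x z" by (simp add: m_def construct_add[OF B(2)])
    have "m x (c *\<^sub>R y) = construct B (\<lambda>b. c *\<^sub>R G' (j b) y) x"
      unfolding m_def using j by (intro fun_cong[OF construct_cong]) (simp add: G' linear_scale)
    then show "m x (c *\<^sub>R y) = c *\<^sub>R m x y" by (simp add: m_def construct_scale[OF B(2)])
  qed
  have "m (k i) (k l) = g i l" if il: "i \<in> I" "l \<in> I" for i l
  proof -
    have "m (k i) (k l) = G l (k i)"
    proof (rule linear_eq_on[where g = "G l" and x = "k i" and B = B, OF lin1])
      show "linear (G l)" using G il by simp
      show "k i \<in> span B" using B(3) il by blast
      show "m b (k l) = G l b" if b: "b \<in> B" for b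
        using j[OF b] il G(2)[of l "j b"] G'(2)[of l "j b"] by (simp add: m_def construct_basis[OF B(2) b])
    qed
    then show ?thesis using G il by simp
  qed
  then show ?thesis using lin1 lin2 by (intro exI[of _ m]) (simp add: bilinear_def)
qed

section \<open>Existence of the product and of the pairing\<close>

lemma integrable_law_prob: "integrable_law \<mu> \<Longrightarrow> prob_space \<mu>"
  and integrable_law_sets: "integrable_law \<mu> \<Longrightarrow> sets \<mu> = sets borel"
  and integrable_law_integrable: "integrable_law \<mu> \<Longrightarrow> integrable \<mu> (\<lambda>x. x)"
  by (simp_all add: integrable_law_def)

lemma continuous_on_bilinear:
  fixes b :: "'a::euclidean_space \<Rightarrow> 'b::euclidean_space \<Rightarrow> 'c::real_normed_vector"
  assumes "bilinear b" shows "continuous_on UNIV (\<lambda>(x, y). b x y)"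
proof -
  have "bounded_bilinear b" using assms by (simp add: bilinear_conv_bounded_bilinear)
  then show ?thesis
    unfolding split_beta by (rule bounded_bilinear.continuous_on) (auto intro: continuous_intros)
qed

text \<open>The bound |b x y| \<le> K |x| |y| suffices with first moments only, because under the
  product measure the two factors are independent.\<close>

lemma integrable_bilinear:
  fixes b :: "'a::euclidean_space \<Rightarrow> 'b::euclidean_space \<Rightarrow> 'c::euclidean_space"
  assumes b: "bilinear b" and \<mu>: "integrable_law \<mu>" and \<nu>: "integrable_law \<nu>"
  shows "integrable (\<mu> \<Otimes>\<^sub>M \<nu>) (\<lambda>(x, y). b x y)"
proof -
  interpret \<mu>: prob_space \<mu> using \<mu> by (rule integrable_law_prob)
  interpret \<nu>: prob_space \<nu> using \<nu> by (rule integrable_law_prob)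
  interpret pair_sigma_finite \<mu> \<nu> ..
  have [measurable_cong]: "sets \<mu> = sets borel" "sets \<nu> = sets borel"
    using \<mu> \<nu> by (simp_all add: integrable_law_sets)
  obtain K where K: "\<And>x y. norm (b x y) \<le> norm x * norm y * K"
    using b unfolding bilinear_conv_bounded_bilinear by (metis bounded_bilinear.bounded)
  have nn: "integrable (\<mu> \<Otimes>\<^sub>M \<nu>) (\<lambda>(x, y). norm x * norm y)"
  proof (rule Fubini_integrable)
    show "AE x in \<mu>. integrable \<nu> (\<lambda>y. case (x, y) of (x, y) \<Rightarrow> norm x * norm y)"
      using integrable_law_integrable[OF \<nu>] by simp
    show "integrable \<mu> (\<lambda>x. LINT y|\<nu>. norm (case (x, y) of (x, y) \<Rightarrow> norm x * norm y))"
      using integrable_law_integrable[OF \<mu>] by (simp add: abs_mult)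
  qed measurable
  have "(\<lambda>(x, y). b x y) \<in> borel_measurable (borel \<Otimes>\<^sub>M borel)"
    using borel_measurable_continuous_onI[OF continuous_on_bilinear[OF b]] by (simp add: borel_prod)
  then have meas: "(\<lambda>(x, y). b x y) \<in> borel_measurable (\<mu> \<Otimes>\<^sub>M \<nu>)"
    by (simp cong: measurable_cong_sets add: sets_pair_measure_cong[of \<mu> borel \<nu> borel] integrable_law_sets \<mu> \<nu>)
  have int: "integrable (\<mu> \<Otimes>\<^sub>M \<nu>) (\<lambda>p. K * (case p of (x, y) \<Rightarrow> norm x * norm y))"
    using nn by simp
  have "AE p in \<mu> \<Otimes>\<^sub>M \<nu>. norm (case p of (x, y) \<Rightarrow> b x y)
      \<le> norm (K * (case p of (x, y) \<Rightarrow> norm x * norm y))"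
    using K by (auto simp: mult_ac intro!: AE_I2 order.trans[OF _ abs_ge_self])
  then show ?thesis by (rule Bochner_Integration.integrable_bound[OF int meas])
qed

lemma integral_bilinear:
  fixes b :: "'a::euclidean_space \<Rightarrow> 'b::euclidean_space \<Rightarrow> 'c::euclidean_space"
  assumes b: "bilinear b" and \<mu>: "integrable_law \<mu>" and \<nu>: "integrable_law \<nu>"
  shows "(\<integral>(x, y). \<bar>u \<bullet> b x y\<bar> \<partial>(\<mu> \<Otimes>\<^sub>M \<nu>)) = (\<integral>x. (\<integral>y. \<bar>u \<bullet> b x y\<bar> \<partial>\<nu>) \<partial>\<mu>)"
    and "(\<integral>(x, y). \<bar>u \<bullet> b x y\<bar> \<partial>(\<mu> \<Otimes>\<^sub>M \<nu>)) = (\<integral>y. (\<integral>x. \<bar>u \<bullet> b x y\<bar> \<partial>\<mu>) \<partial>\<nu>)"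
proof -
  interpret \<mu>: prob_space \<mu> using \<mu> by (rule integrable_law_prob)
  interpret \<nu>: prob_space \<nu> using \<nu> by (rule integrable_law_prob)
  interpret pair_sigma_finite \<mu> \<nu> ..
  have "integrable (\<mu> \<Otimes>\<^sub>M \<nu>) (\<lambda>(x, y). \<bar>u \<bullet> b x y\<bar>)"
    using integrable_abs_inner[OF integrable_bilinear[OF assms], of u] by (simp add: case_prod_unfold)
  from integral_fst[OF this, symmetric] integral_snd[OF this, symmetric]
  show "(\<integral>(x, y). \<bar>u \<bullet> b x y\<bar> \<partial>(\<mu> \<Otimes>\<^sub>M \<nu>)) = (\<integral>x. (\<integral>y. \<bar>u \<bullet> b x y\<bar> \<partial>\<nu>) \<partial>\<mu>)"
    and "(\<integral>(x, y). \<bar>u \<bullet> b x y\<bar> \<partial>(\<mu> \<Otimes>\<^sub>M \<nu>)) = (\<integral>y. (\<integral>x. \<bar>u \<bullet> b x y\<bar> \<partial>\<mu>) \<partial>\<nu>)"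
    .
qed

text \<open>Supplies the linear maps \<open>T\<close> demanded by \<open>bilinear_extension\<close>.
  The integral exists because \<open>vsupp x\<close> is Lipschitz and vanishes at 0, so it grows at
  most linearly and \<nu> has a first moment.\<close>

lemma linear_integral_vsupp:
  fixes w :: "'b::euclidean_space \<Rightarrow> 'a::euclidean_space"
  assumes w: "linear w" and \<nu>: "integrable_law \<nu>"
  shows "linear (\<lambda>x. \<integral>y. vsupp x (w y) \<partial>\<nu>)"
proof -
  have [measurable_cong]: "sets \<nu> = sets borel" using \<nu> by (rule integrable_law_sets)
  have int: "integrable \<nu> (\<lambda>y. vsupp x (w y))" for x
  proof -
    obtain C where C: "\<forall>u v. \<bar>vsupp x u - vsupp x v\<bar> \<le> C * norm (u - v)" using vsupp_Lipschitz by blast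
    have bl: "bounded_linear w" using w by (simp add: linear_conv_bounded_linear)
    have "continuous_on UNIV (\<lambda>y. vsupp x (w y))"
      by (rule continuous_on_compose2[OF vsupp_continuous linear_continuous_on[OF bl]]) auto
    then have [measurable]: "(\<lambda>y. vsupp x (w y)) \<in> borel_measurable \<nu>"
      using borel_measurable_continuous_onI measurable_cong_sets[OF \<open>sets \<nu> = sets borel\<close> refl] by blast
    have "integrable \<nu> (\<lambda>y. C * norm (w y))"
      by (intro integrable_mult_right integrable_norm integrable_bounded_linear[OF bl] integrable_law_integrable[OF \<nu>])
    then show ?thesis
    proof (rule Bochner_Integration.integrable_bound)
      have "norm (vsupp x (w y)) \<le> norm (C * norm (w y))" for y
      proof -
        have "\<bar>vsupp x (w y)\<bar> \<le> C * norm (w y)" using C[rule_format, of "w y" 0] by (simp add: vsupp_0_right)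
        also have "\<dots> \<le> \<bar>C * norm (w y)\<bar>" by (rule abs_ge_self)
        finally show ?thesis by simp
      qed
      then show "AE y in \<nu>. norm (vsupp x (w y)) \<le> norm (C * norm (w y))" by simp
    qed measurable
  qed
  show ?thesis
    by (rule linearI)
      (simp_all add: linear_add[OF linear_vsupp] linear_scale[OF linear_vsupp] int)
qed

lemma bilinear_adjoint_left:
  fixes b :: "'a::euclidean_space \<Rightarrow> 'b::euclidean_space \<Rightarrow> 'c::euclidean_space"
  assumes b: "bilinear b"
  obtains w where "linear w" "\<And>x y. u \<bullet> b x y = w y \<bullet> x"
proof
  define w where "w y = (\<Sum>e\<in>Basis. (u \<bullet> b e y) *\<^sub>R e)" for y
  show "linear w"
    by (rule linearI)
      (simp_all add: w_def bilinear_radd[OF b] bilinear_rmul[OF b] inner_add_right scaleR_add_left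
        sum.distrib scaleR_sum_right)
  show "u \<bullet> b x y = w y \<bullet> x" for x y
  proof -
    have lin: "linear (\<lambda>x. b x y)" using b by (simp add: bilinear_def)
    have "u \<bullet> b x y = u \<bullet> b (\<Sum>e\<in>Basis. (x \<bullet> e) *\<^sub>R e) y" by (simp add: euclidean_representation)
    also have "b (\<Sum>e\<in>Basis. (x \<bullet> e) *\<^sub>R e) y = (\<Sum>e\<in>Basis. (x \<bullet> e) *\<^sub>R b e y)"
      by (simp add: linear_sum[OF lin] linear_scale[OF lin])
    finally show ?thesis by (simp add: w_def inner_sum_left inner_sum_right inner_commute mult.commute)
  qed
qed

text \<open>Moving \<open>b\<close> to the other side gives u . b x y = w y . x; integrating over x
  first leaves the \<nu>-average of the support function of K(\<mu>) at the points w y. The value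
  therefore depends on \<mu> only through its zonoid, and linearly.\<close>

lemma cosine_bilinear_left:
  fixes b :: "'a::euclidean_space \<Rightarrow> 'b::euclidean_space \<Rightarrow> 'c::euclidean_space"
  assumes b: "bilinear b" and \<nu>: "integrable_law \<nu>"
  shows "\<exists>T. linear T \<and> (\<forall>\<mu>. integrable_law \<mu> \<longrightarrow>
    cosine (\<mu> \<Otimes>\<^sub>M \<nu>) (\<lambda>(x, y). b x y) u = T (vK \<mu> (\<lambda>x. x)))"
proof -
  obtain w where w: "linear w" "\<And>x y. u \<bullet> b x y = w y \<bullet> x" using bilinear_adjoint_left[OF b] by blast
  have "cosine (\<mu> \<Otimes>\<^sub>M \<nu>) (\<lambda>(x, y). b x y) u = (\<integral>y. vsupp (vK \<mu> (\<lambda>x. x)) (w y) \<partial>\<nu>)"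
    if \<mu>: "integrable_law \<mu>" for \<mu>
    using integral_bilinear(2)[OF b \<mu> \<nu>, of u] w(2)
    by (simp add: cosine_def vsupp_vK[OF integrable_law_integrable[OF \<mu>]] case_prod_unfold)
  then show ?thesis using linear_integral_vsupp[OF w(1) \<nu>] by blast
qed

lemma cosine_bilinear_right:
  fixes b :: "'a::euclidean_space \<Rightarrow> 'b::euclidean_space \<Rightarrow> 'c::euclidean_space"
  assumes b: "bilinear b" and \<mu>: "integrable_law \<mu>"
  shows "\<exists>T. linear T \<and> (\<forall>\<nu>. integrable_law \<nu> \<longrightarrow>
    cosine (\<mu> \<Otimes>\<^sub>M \<nu>) (\<lambda>(x, y). b x y) u = T (vK \<nu> (\<lambda>x. x)))"
proof -
  have "bilinear (\<lambda>y x. b x y)" using b by (simp add: bilinear_def)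
  from bilinear_adjoint_left[OF this]
  obtain w where w: "linear w" "\<And>y x. u \<bullet> b x y = w x \<bullet> y" by blast
  have "cosine (\<mu> \<Otimes>\<^sub>M \<nu>) (\<lambda>(x, y). b x y) u = (\<integral>x. vsupp (vK \<nu> (\<lambda>x. x)) (w x) \<partial>\<mu>)"
    if \<nu>: "integrable_law \<nu>" for \<nu>
    using integral_bilinear(1)[OF b \<mu> \<nu>, of u] w(2)
    by (simp add: cosine_def vsupp_vK[OF integrable_law_integrable[OF \<nu>]] case_prod_unfold)
  then show ?thesis using linear_integral_vsupp[OF w(1) \<mu>] by blast
qed

lemma bilinear_inner: "bilinear (\<lambda>x y :: 'a::euclidean_space. x \<bullet> y)"
  by (simp add: bilinear_conv_bounded_bilinear bounded_bilinear_inner)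

text \<open>A \<open>SOME\<close> term inherits its specification only from a witness;
  \<open>bilinear_extension\<close> provides one.\<close>

lemma vpairing_spec:
  "bilinear (vpairing :: 'a::euclidean_space vzonoid \<Rightarrow> _)"
  "integrable_law \<mu> \<Longrightarrow> integrable_law \<nu> \<Longrightarrow>
     vpairing (vK \<mu> (\<lambda>x. x)) (vK \<nu> (\<lambda>y :: 'a. y)) = (\<integral>(x, y). \<bar>x \<bullet> y\<bar> \<partial>(\<mu> \<Otimes>\<^sub>M \<nu>))"
proof -
  let ?g = "\<lambda>(\<mu> :: 'a measure) (\<nu> :: 'a measure). (\<integral>(x, y). \<bar>x \<bullet> y\<bar> \<partial>(\<mu> \<Otimes>\<^sub>M \<nu>))"
  have g: "?g \<mu> \<nu> / 2 = cosine (\<mu> \<Otimes>\<^sub>M \<nu>) (\<lambda>(x, y). x \<bullet> y) (1 :: real)" for \<mu> \<nu>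
    by (simp add: cosine_def case_prod_unfold)
  have "\<exists>m. bilinear m \<and> (\<forall>\<mu>\<in>Collect integrable_law. \<forall>\<nu>\<in>Collect integrable_law.
      m (vK \<mu> (\<lambda>x. x)) (vK \<nu> (\<lambda>x. x)) = ?g \<mu> \<nu>)"
  \<comment> \<open>The target is the real line, so one nonzero functional separates points; halving
    matches the factor 1/2 in \<open>cosine\<close> evaluated at 1.\<close>
  proof (rule bilinear_extension[where \<phi> = "\<lambda>_::unit. \<lambda>x. x / 2"])
    show "\<exists>T. linear T \<and> (\<forall>i\<in>Collect integrable_law. ?g i \<nu> / 2 = T (vK i (\<lambda>x. x)))"
      if "\<nu> \<in> Collect integrable_law" for \<nu>
      unfolding g using that cosine_bilinear_left[OF bilinear_inner] by force
    show "\<exists>T. linear T \<and> (\<forall>i\<in>Collect integrable_law. ?g \<mu> i / 2 = T (vK i (\<lambda>x. x)))"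
      if "\<mu> \<in> Collect integrable_law" for \<mu>
      unfolding g using that cosine_bilinear_right[OF bilinear_inner] by force
  qed (auto intro: linearI simp: add_divide_distrib)
  then have "\<exists>p. bilinear p \<and>
     (\<forall>\<mu> \<nu>. integrable_law \<mu> \<longrightarrow> integrable_law \<nu> \<longrightarrow>
        p (vK \<mu> (\<lambda>x. x)) (vK \<nu> (\<lambda>y. y)) = ?g \<mu> \<nu>)"
    by auto
  from someI_ex[OF this]
  show "bilinear (vpairing :: 'a vzonoid \<Rightarrow> _)"
    "integrable_law \<mu> \<Longrightarrow> integrable_law \<nu> \<Longrightarrow>
     vpairing (vK \<mu> (\<lambda>x. x)) (vK \<nu> (\<lambda>y :: 'a. y)) = (\<integral>(x, y). \<bar>x \<bullet> y\<bar> \<partial>(\<mu> \<Otimes>\<^sub>M \<nu>))"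
    unfolding vpairing_def[symmetric] by auto
qed

lemma bilinear_ext_wedge: "bilinear (ext_wedge :: real ^ ('n::finite set) \<Rightarrow> _)"
  unfolding bilinear_def
proof (intro conjI allI)
  fix x :: "real ^ ('n set)"
  show "linear (ext_wedge x)"
    by (rule linearI)
      (simp_all add: ext_wedge_def vec_eq_iff algebra_simps sum.distrib sum_distrib_left)
  show "linear (\<lambda>y. ext_wedge y x)"
    by (rule linearI)
      (simp_all add: ext_wedge_def vec_eq_iff algebra_simps sum.distrib sum_distrib_left)
qed

text \<open>As for the pairing, with values in virtual zonoids separated by the evaluations of their
  support functions at all u.\<close>

lemma vwedge_spec:
  "bilinear (vwedge :: (real ^ ('n::finite set)) vzonoid \<Rightarrow> _)"
  "integrable_law \<mu> \<Longrightarrow> integrable_law \<nu> \<Longrightarrow>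
     vwedge (vK \<mu> (\<lambda>x :: real ^ ('n set). x)) (vK \<nu> (\<lambda>y. y)) = vK (\<mu> \<Otimes>\<^sub>M \<nu>) (\<lambda>(x, y). ext_wedge x y)"
proof -
  let ?g = "\<lambda>(\<mu> :: (real ^ ('n set)) measure) \<nu>. vK (\<mu> \<Otimes>\<^sub>M \<nu>) (\<lambda>(x, y). ext_wedge x y)"
  have g: "vsupp (?g \<mu> \<nu>) u = cosine (\<mu> \<Otimes>\<^sub>M \<nu>) (\<lambda>(x, y). ext_wedge x y) u"
    if "integrable_law \<mu>" "integrable_law \<nu>" for \<mu> \<nu> u
    by (simp add: vsupp_vK[OF integrable_bilinear[OF bilinear_ext_wedge that]])
  have "\<exists>m. bilinear m \<and> (\<forall>\<mu>\<in>Collect integrable_law. \<forall>\<nu>\<in>Collect integrable_law.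
      m (vK \<mu> (\<lambda>x. x)) (vK \<nu> (\<lambda>x. x)) = ?g \<mu> \<nu>)"
  proof (rule bilinear_extension[where \<phi> = "\<lambda>u x. vsupp x u"])
    fix u :: "real ^ ('n set)"
    show "\<exists>T. linear T \<and> (\<forall>i\<in>Collect integrable_law. vsupp (?g i \<nu>) u = T (vK i (\<lambda>x. x)))"
      if "\<nu> \<in> Collect integrable_law" for \<nu>
      using that cosine_bilinear_left[OF bilinear_ext_wedge, of \<nu> u] by (simp add: g)
    show "\<exists>T. linear T \<and> (\<forall>i\<in>Collect integrable_law. vsupp (?g \<mu> i) u = T (vK i (\<lambda>x. x)))"
      if "\<mu> \<in> Collect integrable_law" for \<mu>
      using that cosine_bilinear_right[OF bilinear_ext_wedge, of \<mu> u] by (simp add: g)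
  qed (auto intro: linear_vsupp vsupp_eq_0)
  then have "\<exists>m. bilinear m \<and>
     (\<forall>\<mu> \<nu>. integrable_law \<mu> \<longrightarrow> integrable_law \<nu> \<longrightarrow>
        m (vK \<mu> (\<lambda>x. x)) (vK \<nu> (\<lambda>y. y)) = ?g \<mu> \<nu>)"
    by auto
  from someI_ex[OF this]
  show "bilinear (vwedge :: (real ^ ('n::finite set)) vzonoid \<Rightarrow> _)"
    "integrable_law \<mu> \<Longrightarrow> integrable_law \<nu> \<Longrightarrow>
     vwedge (vK \<mu> (\<lambda>x :: real ^ ('n set). x)) (vK \<nu> (\<lambda>y. y)) = vK (\<mu> \<Otimes>\<^sub>M \<nu>) (\<lambda>(x, y). ext_wedge x y)"
    unfolding vwedge_def[symmetric] by auto
qed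

section \<open>Bivectors\<close>

lemma linear_eq_axis:
  fixes f g :: "real ^ 'n \<Rightarrow> 'b::real_vector"
  assumes "linear f" "linear g" "\<And>i. f (axis i 1) = g (axis i 1)"
  shows "f x = g x"
proof (rule linear_eq_on[where B = Basis, OF assms(1,2)])
  show "f b = g b" if "b \<in> Basis" for b
    using that assms(3) by (auto simp: Basis_vec_def)
qed simp

lemma (in linorder) sorted_key_list_of_set_inj:
  assumes "inj f" "finite A"
  shows "set (sorted_key_list_of_set f A) = A" "distinct (sorted_key_list_of_set f A)"
    and "sorted (map f (sorted_key_list_of_set f A))"
proof -
  interpret folding_insort_key "(\<le>)" "(<)" UNIV f
    using assms(1) by unfold_locales
  show "set (sorted_key_list_of_set f A) = A" "sorted (map f (sorted_key_list_of_set f A))"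
    using assms by simp_all
  show "distinct (sorted_key_list_of_set f A)"
    using distinct_sorted_key_list_of_set[of A] by (simp add: distinct_map)
qed

lemmas sorted_key_list_of_set_to_nat = sorted_key_list_of_set_inj[OF inj_to_nat]

lemma sorted_key_list_of_set_singleton:
  "sorted_key_list_of_set to_nat {a :: 'a::countable} = [a]"
proof -
  let ?l = "sorted_key_list_of_set to_nat {a}"
  have "set ?l = {a}" "distinct ?l" by (simp_all add: sorted_key_list_of_set_to_nat)
  then show ?thesis
    by (metis distinct_card card_1_singleton_iff length_0_conv length_Suc_conv list.set_intros(1)
        One_nat_def singletonD)
qed

lemma sorted_key_list_of_set_pair:
  assumes "a \<noteq> (b :: 'a::countable)"
  shows "sorted_key_list_of_set to_nat {a, b} = (if to_nat a < to_nat b then [a, b] else [b, a])"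
proof -
  let ?l = "sorted_key_list_of_set to_nat {a, b}"
  have l: "set ?l = {a, b}" "distinct ?l" "sorted (map to_nat ?l)"
    by (simp_all add: sorted_key_list_of_set_to_nat)
  have "length ?l = 2" using distinct_card[OF l(2)] l(1) assms by simp
  then obtain c d where cd: "?l = [c, d]"
    by (metis (no_types, lifting) length_0_conv length_Suc_conv numeral_2_eq_2)
  have "to_nat c \<noteq> to_nat d" using l(2) cd by (simp add: inj_eq)
  with l cd show ?thesis by (auto simp: doubleton_eq_iff)
qed

lemma wedge_sign_empty: "wedge_sign S {} = 1"
  by (simp add: wedge_sign_def)

lemma ext_wedge_one_right: "ext_wedge x ext_one = x"
proof -
  have "(\<Sum>S\<in>Pow U. wedge_sign S (U - S) * x $ S * ext_one $ (U - S)) = x $ U" for U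
  proof -
    have "(\<Sum>S\<in>Pow U. wedge_sign S (U - S) * x $ S * ext_one $ (U - S))
        = (\<Sum>S\<in>Pow U. if S = U then x $ U else 0)"
      by (intro sum.cong) (auto simp: ext_one_def axis_def wedge_sign_empty)
    then show ?thesis by simp
  qed
  then show ?thesis by (simp add: ext_wedge_def vec_eq_iff)
qed

lemma linear_ext_vec: "linear ext_vec"
  by (rule linearI) (simp_all add: ext_vec_def scaleR_add_left sum.distrib scaleR_sum_right)

lemma ext_vec_axis: "ext_vec (axis i 1) = axis {i} 1"
proof -
  have "ext_vec (axis i 1 :: real ^ 'a) = (\<Sum>j\<in>UNIV. if j = i then axis {i} 1 else 0)"
    unfolding ext_vec_def by (intro sum.cong) (auto simp: axis_def)
  then show ?thesis by simp
qed

lemma ext_prod_single: "ext_prod [v] = ext_vec v"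
  by (simp add: ext_prod_def ext_wedge_one_right)

lemma ext_prod_pair: "ext_prod [v, w] = ext_wedge (ext_vec v) (ext_vec w)"
  by (simp add: ext_prod_def ext_wedge_one_right)

lemma bilinear_ext_prod: "bilinear (\<lambda>v w. ext_prod [v, w])"
proof -
  have 1: "linear (\<lambda>w. ext_wedge (ext_vec v) (ext_vec w))" for v :: "real ^ 'a"
    using linear_compose[OF linear_ext_vec, of "ext_wedge (ext_vec v)"] bilinear_ext_wedge
    unfolding bilinear_def o_def by blast
  have 2: "linear (\<lambda>v. ext_wedge (ext_vec v) (ext_vec w))" for w :: "real ^ 'a"
    using linear_compose[OF linear_ext_vec, of "\<lambda>x. ext_wedge x (ext_vec w)"] bilinear_ext_wedge
    unfolding bilinear_def o_def by blast
  show ?thesis unfolding bilinear_def ext_prod_pair using 1 2 by blast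
qed

lemma ext_prod_axis:
  "ext_prod [axis i 1, axis j 1] =
     (if i = j then 0 else if to_nat j < to_nat i then - axis {i, j} 1 else axis {i, j} 1)"
proof -
  have sgn: "wedge_sign {i} {j} = (if to_nat j < to_nat i then - 1 else 1)"
  proof -
    have "{(s, t). s \<in> {i} \<and> t \<in> {j} \<and> to_nat t < to_nat s} = (if to_nat j < to_nat i then {(i, j)} else {})"
      by auto
    then show ?thesis by (simp add: wedge_sign_def)
  qed
  have "ext_wedge (axis {i} 1) (axis {j} 1) $ U
      = (if i = j then 0 else if to_nat j < to_nat i then - axis {i, j} 1 else axis {i, j} 1) $ U" for U
  proof -
    have "ext_wedge (axis {i} 1) (axis {j} 1) $ U
        = (\<Sum>S\<in>Pow U. if S = {i} then (if U - {i} = {j} then wedge_sign {i} {j} else 0) else 0)"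
      unfolding ext_wedge_def vec_lambda_beta by (intro sum.cong) (auto simp: axis_def)
    also have "\<dots> = (if i \<in> U \<and> U - {i} = {j} then wedge_sign {i} {j} else 0)"
      by (simp add: sum.delta)
    also have "i \<in> U \<and> U - {i} = {j} \<longleftrightarrow> i \<noteq> j \<and> U = {i, j}" by auto
    finally show ?thesis by (auto simp: sgn axis_def)
  qed
  then show ?thesis by (simp add: ext_prod_pair ext_vec_axis vec_eq_iff)
qed

lemma to_nat_less_cases: "i \<noteq> j \<Longrightarrow> to_nat i < to_nat j \<or> to_nat j < to_nat i"
  by (metis inj_eq inj_to_nat linorder_neqE_nat)

lemma ext_prod_swap: "ext_prod [v, w] = - ext_prod [w, v]"
proof -
  have lin: "linear (\<lambda>v. ext_prod [v, w])" "linear (\<lambda>w. ext_prod [v, w])"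
    "linear (\<lambda>v. - ext_prod [v, w])" "linear (\<lambda>w. - ext_prod [v, w])" for v w :: "real ^ 'a"
    using bilinear_ext_prod by (auto simp: bilinear_def intro: linear_compose_neg)
  have "ext_prod [axis i 1, axis j 1] = - ext_prod [axis j 1, axis i 1]" for i j :: 'a
    using to_nat_less_cases[of i j] by (auto simp: ext_prod_axis insert_commute)
  then have "ext_prod [axis i 1, w] = - ext_prod [w, axis i 1]" for i and w :: "real ^ 'a"
    by (rule linear_eq_axis[where x = w, OF lin(2) lin(3)])
  then show ?thesis by (rule linear_eq_axis[where x = v, OF lin(1) lin(4)])
qed

lemma ext_prod_self: "ext_prod [v, v] = 0"
  using ext_prod_swap[of v v] by (simp add: eq_neg_iff_add_eq_0 flip: scaleR_2)

text \<open>The Gram determinant formula for bivectors. Both sides are linear in each argument, so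
  they are compared on basis vectors and extended one argument at a time.\<close>

lemma inner_ext_prod_pair:
  "ext_prod [v, w] \<bullet> ext_prod [x, y] = (v \<bullet> x) * (w \<bullet> y) - (v \<bullet> y) * (w \<bullet> x)"
proof -
  have bil: "linear (\<lambda>v. ext_prod [v, w])" "linear (\<lambda>w. ext_prod [v, w])" for v w :: "real ^ 'a"
    using bilinear_ext_prod by (auto simp: bilinear_def)
  note add = linear_add[OF bil(1)] linear_add[OF bil(2)] and sc = linear_scale[OF bil(1)] linear_scale[OF bil(2)]
  let ?l = "\<lambda>v w x y :: real ^ 'a. ext_prod [v, w] \<bullet> ext_prod [x, y]"
  let ?r = "\<lambda>v w x y :: real ^ 'a. (v \<bullet> x) * (w \<bullet> y) - (v \<bullet> y) * (w \<bullet> x)"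
  have lin: "linear (\<lambda>v. ?l v w x y)" "linear (\<lambda>w. ?l v w x y)" "linear (\<lambda>x. ?l v w x y)" "linear (\<lambda>y. ?l v w x y)"
    "linear (\<lambda>v. ?r v w x y)" "linear (\<lambda>w. ?r v w x y)" "linear (\<lambda>x. ?r v w x y)" "linear (\<lambda>y. ?r v w x y)" for v w x y
    by (rule linearI; simp add: add sc inner_add_left inner_add_right algebra_simps)+
  have "?l (axis i 1) (axis j 1) (axis k 1) (axis l 1) = ?r (axis i 1) (axis j 1) (axis k 1) (axis l 1)" for i j k l
    using to_nat_less_cases[of i j] to_nat_less_cases[of k l]
    by (auto simp: ext_prod_axis inner_axis_axis doubleton_eq_iff)
  then have "?l (axis i 1) (axis j 1) (axis k 1) y = ?r (axis i 1) (axis j 1) (axis k 1) y" for i j k y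
    by (rule linear_eq_axis[where x = y, OF lin(4) lin(8)])
  then have "?l (axis i 1) (axis j 1) x y = ?r (axis i 1) (axis j 1) x y" for i j x y
    by (rule linear_eq_axis[where x = x, OF lin(3) lin(7)])
  then have "?l (axis i 1) w x y = ?r (axis i 1) w x y" for i w x y
    by (rule linear_eq_axis[where x = w, OF lin(2) lin(6)])
  then show ?thesis by (rule linear_eq_axis[where x = v, OF lin(1) lin(5)])
qed

lemma linear_ext_map: "linear (ext_map \<phi>)"
  by (rule linearI) (simp_all add: ext_map_def scaleR_add_left sum.distrib scaleR_sum_right)

lemma ext_map_axis:
  "ext_map \<phi> (axis S 1) = ext_prod (map (\<lambda>i. \<phi> (axis i 1)) (sorted_key_list_of_set to_nat S))"
proof -
  have "ext_map \<phi> (axis S 1) = (\<Sum>T\<in>UNIV. if T = S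
      then ext_prod (map (\<lambda>i. \<phi> (axis i 1)) (sorted_key_list_of_set to_nat S)) else 0)"
    unfolding ext_map_def by (intro sum.cong) (auto simp: axis_def)
  then show ?thesis by simp
qed

lemma ext_map_ext_vec:
  assumes "linear \<phi>" shows "ext_map \<phi> (ext_vec v) = ext_vec (\<phi> v)"
proof -
  have lin: "linear (\<lambda>v. ext_map \<phi> (ext_vec v))" "linear (\<lambda>v. ext_vec (\<phi> v))"
    using linear_compose[OF linear_ext_vec linear_ext_map] linear_compose[OF assms linear_ext_vec]
    by (simp_all add: o_def)
  show ?thesis
    by (rule linear_eq_axis[where x = v, OF lin])
      (simp add: ext_vec_axis ext_map_axis sorted_key_list_of_set_singleton ext_prod_single)
qed

text \<open>\<open>ext_map\<close> is prescribed only on increasingly ordered basis wedges; for a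
  pair in the opposite order the sign from antisymmetry appears on both sides, and bilinearity does
  the rest.\<close>

lemma ext_map_ext_prod_pair:
  assumes \<phi>: "linear \<phi>" shows "ext_map \<phi> (ext_prod [v, w]) = ext_prod [\<phi> v, \<phi> w]"
proof -
  have bil: "linear (\<lambda>v. ext_prod [v, w])" "linear (\<lambda>w. ext_prod [v, w])" for v w :: "real ^ 'a"
    using bilinear_ext_prod by (auto simp: bilinear_def)
  have lin: "linear (\<lambda>v. ext_map \<phi> (ext_prod [v, w]))" "linear (\<lambda>w. ext_map \<phi> (ext_prod [v, w]))"
    "linear (\<lambda>v. ext_prod [\<phi> v, \<phi> w])" "linear (\<lambda>w. ext_prod [\<phi> v, \<phi> w])" for v w
    using linear_compose[OF bil(1) linear_ext_map] linear_compose[OF bil(2) linear_ext_map]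
      linear_compose[OF \<phi> bil(1)] linear_compose[OF \<phi> bil(2)] by (simp_all add: o_def)
  have "ext_map \<phi> (ext_prod [axis i 1, axis j 1]) = ext_prod [\<phi> (axis i 1), \<phi> (axis j 1)]" for i j
  proof (cases "i = j")
    case True
    then show ?thesis by (simp add: ext_prod_self linear_0[OF linear_ext_map])
  next
    case False
    then have "to_nat i < to_nat j \<or> to_nat j < to_nat i" by (rule to_nat_less_cases)
    then show ?thesis
      using False ext_prod_swap[of "\<phi> (axis i 1)" "\<phi> (axis j 1)"]
      by (auto simp: ext_prod_axis ext_map_axis sorted_key_list_of_set_pair linear_neg[OF linear_ext_map])
  qed
  then have "ext_map \<phi> (ext_prod [axis i 1, w]) = ext_prod [\<phi> (axis i 1), \<phi> w]" for i w
    by (rule linear_eq_axis[where x = w, OF lin(2) lin(4)])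
  then show ?thesis by (rule linear_eq_axis[where x = v, OF lin(1) lin(3)])
qed

text \<open>Each factor \<open>ext_vec v\<close> is supported on singletons, so a wedge with it
  raises the cardinality of the index sets by one.\<close>

lemma ext_prod_grade: "card U \<noteq> length vs \<Longrightarrow> ext_prod vs $ U = 0"
proof (induction vs arbitrary: U)
  case Nil
  then show ?case by (auto simp: ext_prod_def ext_one_def axis_def)
next
  case (Cons v vs)
  have "ext_vec v $ S * ext_prod vs $ (U - S) = 0" if "S \<subseteq> U" for S
  proof (cases "\<exists>i. S = {i}")
    case True
    then have "card (U - S) = card U - 1" "card U > 0" using that by (auto simp: card_gt_0_iff)
    then have "card (U - S) \<noteq> length vs" using Cons.prems by auto
    then show ?thesis using Cons.IH by simp
  next
    case False
    then have "ext_vec v $ S = 0" by (auto simp: ext_vec_def axis_def intro!: sum.neutral)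
    then show ?thesis by simp
  qed
  then have "(\<Sum>S\<in>Pow U. wedge_sign S (U - S) * ext_vec v $ S * ext_prod vs $ (U - S)) = 0"
    by (intro sum.neutral) (auto simp: mult.assoc)
  then show ?case by (simp add: ext_prod_def ext_wedge_def)
qed

text \<open>All degrees live in one Euclidean space and \<open>null_ideal\<close> is a span over all
  of them; orthogonality makes the components of the wrong degree invisible to a test
  vector.\<close>

lemma simple_vectors_orthogonal:
  assumes "x \<in> simple_vectors d" "y \<in> simple_vectors d'" "d \<noteq> d'"
  shows "x \<bullet> y = 0"
proof -
  have "x $ U = 0 \<or> y $ U = 0" for U
    using assms by (auto simp: simple_vectors_def) (metis ext_prod_grade)
  then show ?thesis unfolding inner_vec_def by (intro sum.neutral) auto
qed

section \<open>The action of O(2) x O(2) on decomposable tensors\<close>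

lemma linear_H_act: "linear (H_act h)"
  by (rule linearI) (simp_all add: H_act_def vec_eq_iff algebra_simps sum.distrib sum_distrib_left)

lemma H_act_tensor: "H_act h (tensor x y) = tensor (fst h *v x) (snd h *v y)"
proof -
  have "(\<Sum>q\<in>UNIV. fst h $ i $ fst q * snd h $ j $ snd q * (x $ fst q * y $ snd q))
      = (\<Sum>k\<in>UNIV. fst h $ i $ k * x $ k) * (\<Sum>l\<in>UNIV. snd h $ j $ l * y $ l)" for i j
  proof -
    have "(\<Sum>k\<in>UNIV. fst h $ i $ k * x $ k) * (\<Sum>l\<in>UNIV. snd h $ j $ l * y $ l)
        = (\<Sum>q\<in>UNIV \<times> UNIV. (fst h $ i $ fst q * x $ fst q) * (snd h $ j $ snd q * y $ snd q))"
      by (simp add: sum_product sum.cartesian_product split_beta)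
    then show ?thesis by (simp add: mult_ac)
  qed
  then show ?thesis
    by (simp add: H_act_def tensor_def matrix_vector_mult_def vec_eq_iff)
qed

lemma inner_tensor: "tensor x y \<bullet> tensor x' y' = (x \<bullet> x') * (y \<bullet> y')"
proof -
  have "(x \<bullet> x') * (y \<bullet> y') = (\<Sum>q\<in>UNIV \<times> UNIV. (x $ fst q * x' $ fst q) * (y $ snd q * y' $ snd q))"
    by (simp add: inner_vec_def sum_product sum.cartesian_product split_beta)
  then show ?thesis by (simp add: inner_vec_def tensor_def mult_ac)
qed

section \<open>The Haar measure of the structure group\<close>

type_synonym mat22 = "real ^ 2 ^ 2"

definition H_mult :: "mat22 \<times> mat22 \<Rightarrow> mat22 \<times> mat22 \<Rightarrow> mat22 \<times> mat22" where
  "H_mult g h = (fst g ** fst h, snd g ** snd h)"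

definition H_inv :: "mat22 \<times> mat22 \<Rightarrow> mat22 \<times> mat22" where
  "H_inv g = (transpose (fst g), transpose (snd g))"

lemma H_group_iff: "h \<in> H_group \<longleftrightarrow> orthogonal_matrix (fst h) \<and> orthogonal_matrix (snd h)"
  by (auto simp: H_group_def mem_Times_iff)

lemma H_mult_in: "g \<in> H_group \<Longrightarrow> h \<in> H_group \<Longrightarrow> H_mult g h \<in> H_group"
  by (simp add: H_group_iff H_mult_def orthogonal_matrix_mul)

lemma H_inv_in: "g \<in> H_group \<Longrightarrow> H_inv g \<in> H_group"
  by (simp add: H_group_iff H_inv_def)

lemma H_inv_mult: "g \<in> H_group \<Longrightarrow> H_mult (H_inv g) (H_mult g h) = h"
  by (simp add: H_group_iff H_inv_def H_mult_def matrix_mul_assoc orthogonal_matrix_def)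

lemma H_mult_inv_right: "g \<in> H_group \<Longrightarrow> H_mult (H_mult h (H_inv g)) g = h"
  by (simp add: H_group_iff H_inv_def H_mult_def orthogonal_matrix_def flip: matrix_mul_assoc)

lemma H_inv_mult_distrib: "H_inv (H_mult g h) = H_mult (H_inv h) (H_inv g)"
  by (simp add: H_inv_def H_mult_def matrix_transpose_mul)

lemma H_inv_inv: "H_inv (H_inv g) = g"
  by (simp add: H_inv_def)

lemma continuous_on_matrix_mult [continuous_intros]:
  fixes f :: "'a::topological_space \<Rightarrow> real ^ 'n ^ 'm" and g :: "'a \<Rightarrow> real ^ 'k ^ 'n"
  assumes "continuous_on S f" "continuous_on S g"
  shows "continuous_on S (\<lambda>x. f x ** g x)"
  unfolding matrix_matrix_mult_def
  by (intro continuous_on_vec_lambda continuous_intros assms)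

lemma continuous_on_transpose [continuous_intros]:
  fixes f :: "'a::topological_space \<Rightarrow> real ^ 'n ^ 'm"
  assumes "continuous_on S f"
  shows "continuous_on S (\<lambda>x. transpose (f x))"
  unfolding transpose_def
  by (intro continuous_on_vec_lambda continuous_intros assms)

lemma compact_orthogonal_matrices: "compact {A :: real ^ 'n ^ 'n. orthogonal_matrix A}"
proof -
  have "closed {A :: real ^ 'n ^ 'n. transpose A ** A = mat 1}"
    by (intro closed_Collect_eq continuous_intros)
  then have "closed {A :: real ^ 'n ^ 'n. orthogonal_matrix A}" by (simp add: orthogonal_matrix)
  moreover have "bounded {A :: real ^ 'n ^ 'n. orthogonal_matrix A}"
    unfolding bounded_iff
  proof (intro exI[of _ "real CARD('n)"] ballI)
    fix A :: "real ^ 'n ^ 'n" assume "A \<in> {A. orthogonal_matrix A}"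
    then have row: "norm (A $ i) = 1" for i
      by (simp add: orthogonal_matrix_orthonormal_rows row_def)
    have "norm A \<le> (\<Sum>i\<in>UNIV. norm (A $ i))"
      unfolding norm_vec_def[of A] by (rule L2_set_le_sum) simp
    then show "norm A \<le> real CARD('n)" by (simp add: row)
  qed
  ultimately show ?thesis by (simp add: compact_eq_bounded_closed)
qed

lemma compact_H_group: "compact H_group"
  unfolding H_group_def by (intro compact_Times compact_orthogonal_matrices)

lemma H_group_borel: "H_group \<in> sets borel"
  using compact_H_group by (rule borel_compact)

abbreviation H_borel :: "(mat22 \<times> mat22) measure" where
  "H_borel \<equiv> restrict_space borel H_group"

lemma space_H_borel: "space H_borel = H_group"
  by (simp add: space_restrict_space)

lemma measurable_H_borel_borel:
  "continuous_on UNIV f \<Longrightarrow> f \<in> borel_measurable H_borel"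
  by (intro measurable_restrict_space1 borel_measurable_continuous_onI)

lemma continuous_on_H_mult:
  "continuous_on UNIV (\<lambda>p. H_mult (fst p) (snd p))"
  unfolding H_mult_def by (intro continuous_intros)

lemma continuous_on_H_inv: "continuous_on UNIV H_inv"
  unfolding H_inv_def by (intro continuous_intros)

lemma measurable_H_inv [measurable]: "H_inv \<in> H_borel \<rightarrow>\<^sub>M H_borel"
  by (intro measurable_restrict_space2 measurable_H_borel_borel continuous_on_H_inv)
    (auto simp: space_H_borel H_inv_in)

lemma measurable_H_pair:
  fixes f :: "(mat22 \<times> mat22) \<times> (mat22 \<times> mat22) \<Rightarrow> 'a::topological_space"
  assumes "continuous_on UNIV f" shows "f \<in> borel_measurable (H_borel \<Otimes>\<^sub>M H_borel)"
proof -
  have "(\<lambda>p. (fst p, snd p)) \<in> H_borel \<Otimes>\<^sub>M H_borel \<rightarrow>\<^sub>M borel \<Otimes>\<^sub>M borel"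
    by (intro measurable_Pair measurable_compose[OF measurable_fst] measurable_compose[OF measurable_snd]
        measurable_H_borel_borel continuous_intros)
  then have "(\<lambda>p. p) \<in> H_borel \<Otimes>\<^sub>M H_borel \<rightarrow>\<^sub>M borel" by (simp add: borel_prod)
  from measurable_compose[OF this borel_measurable_continuous_onI[OF assms]] show ?thesis .
qed

lemma measurable_H_mult: "(\<lambda>p. H_mult (fst p) (snd p)) \<in> H_borel \<Otimes>\<^sub>M H_borel \<rightarrow>\<^sub>M H_borel"
  by (intro measurable_restrict_space2 measurable_H_pair continuous_on_H_mult)
    (auto simp: space_pair_measure space_H_borel H_mult_in)

text \<open>Left invariance only, as in the description defining \<open>H_uniform\<close>;
  uniqueness is therefore obtained by way of inversion.\<close>

definition haar :: "(mat22 \<times> mat22) measure \<Rightarrow> bool" where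
  "haar \<mu> \<longleftrightarrow> prob_space \<mu> \<and> sets \<mu> = sets H_borel \<and> (\<forall>g\<in>H_group. distr \<mu> \<mu> (H_mult g) = \<mu>)"

lemma haar_space: "haar \<mu> \<Longrightarrow> space \<mu> = H_group"
  unfolding haar_def by (metis sets_eq_imp_space_eq space_H_borel)

lemma H_mult_measurable:
  assumes "g \<in> H_group" shows "H_mult g \<in> H_borel \<rightarrow>\<^sub>M H_borel"
proof -
  have "(\<lambda>h. (g, h)) \<in> H_borel \<rightarrow>\<^sub>M H_borel \<Otimes>\<^sub>M H_borel"
    using assms by (intro measurable_Pair1') (simp add: space_H_borel)
  from measurable_compose[OF this measurable_H_mult] show ?thesis by simp
qed

lemma haar_translate:
  assumes "haar \<mu>" "g \<in> H_group" "A \<in> sets H_borel"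
  shows "emeasure \<mu> {h \<in> H_group. H_mult g h \<in> A} = emeasure \<mu> A"
proof -
  have s: "sets \<mu> = sets H_borel" using assms by (simp add: haar_def)
  have "emeasure \<mu> A = emeasure (distr \<mu> \<mu> (H_mult g)) A"
    using assms by (simp add: haar_def)
  also have "\<dots> = emeasure \<mu> (H_mult g -` A \<inter> space \<mu>)"
    using assms H_mult_measurable[OF assms(2)] by (intro emeasure_distr) (simp_all add: s cong: measurable_cong_sets)
  also have "H_mult g -` A \<inter> space \<mu> = {h \<in> H_group. H_mult g h \<in> A}"
    using haar_space[OF assms(1)] by auto
  finally show ?thesis by simp
qed

text \<open>Integrating \<open>1\<^sub>A (g\<inverse> h)\<close> in both orders.\<close>

lemma haar_inverse:
  assumes \<mu>: "haar \<mu>" and \<nu>: "haar \<nu>" and A: "A \<in> sets H_borel"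
  shows "emeasure \<mu> A = emeasure \<nu> {h \<in> H_group. H_inv h \<in> A}"
proof -
  interpret \<mu>: prob_space \<mu> using \<mu> by (simp add: haar_def)
  interpret \<nu>: prob_space \<nu> using \<nu> by (simp add: haar_def)
  interpret pair_sigma_finite \<nu> \<mu> ..
  have s [measurable_cong]: "sets \<mu> = sets H_borel" "sets \<nu> = sets H_borel"
    using \<mu> \<nu> by (simp_all add: haar_def)
  have AH: "A \<subseteq> H_group" using sets.sets_into_space[OF A] by (simp add: space_H_borel)
  define S where "S = {p \<in> H_group \<times> H_group. H_mult (H_inv (fst p)) (snd p) \<in> A}"
  have "(\<lambda>p. (H_inv (fst p), snd p)) \<in> H_borel \<Otimes>\<^sub>M H_borel \<rightarrow>\<^sub>M H_borel \<Otimes>\<^sub>M H_borel" by measurable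
  from measurable_sets[OF measurable_compose[OF this measurable_H_mult] A]
  have "S \<in> sets (H_borel \<Otimes>\<^sub>M H_borel)"
    by (simp add: S_def space_pair_measure space_H_borel vimage_def Int_def conj_commute)
  then have S: "S \<in> sets (\<nu> \<Otimes>\<^sub>M \<mu>)"
    by (simp add: sets_pair_measure_cong[OF s(2) s(1)])
  have B: "{h \<in> H_group. H_inv h \<in> A} \<in> sets H_borel"
    using measurable_sets[OF measurable_H_inv A] by (simp add: space_H_borel vimage_def Int_def conj_commute)
  have "emeasure (\<nu> \<Otimes>\<^sub>M \<mu>) S = (\<integral>\<^sup>+g. emeasure \<mu> (Pair g -` S) \<partial>\<nu>)"
    using S by (rule \<mu>.emeasure_pair_measure_alt)
  also have "\<dots> = (\<integral>\<^sup>+g. emeasure \<mu> A \<partial>\<nu>)"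
  proof (rule nn_integral_cong)
    fix g assume "g \<in> space \<nu>"
    then have g: "g \<in> H_group" using haar_space[OF \<nu>] by simp
    then have "Pair g -` S = {h \<in> H_group. H_mult (H_inv g) h \<in> A}" by (auto simp: S_def)
    then show "emeasure \<mu> (Pair g -` S) = emeasure \<mu> A"
      using haar_translate[OF \<mu> H_inv_in[OF g] A] by simp
  qed
  finally have 1: "emeasure (\<nu> \<Otimes>\<^sub>M \<mu>) S = emeasure \<mu> A" by (simp add: \<nu>.emeasure_space_1)
  have "emeasure (\<nu> \<Otimes>\<^sub>M \<mu>) S = (\<integral>\<^sup>+h. emeasure \<nu> ((\<lambda>g. (g, h)) -` S) \<partial>\<mu>)"
    using S by (rule emeasure_pair_measure_alt2)
  also have "\<dots> = (\<integral>\<^sup>+h. emeasure \<nu> {h \<in> H_group. H_inv h \<in> A} \<partial>\<mu>)"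
  proof (rule nn_integral_cong)
    fix h assume "h \<in> space \<mu>"
    then have h: "h \<in> H_group" using haar_space[OF \<mu>] by simp
    \<comment> \<open>Rewrites the section of \<open>S\<close> at h as a left translate of the
      inverted set, so that left invariance of \<nu> applies to it.\<close>
    have "H_inv (H_mult (H_inv h) g) = H_mult (H_inv g) h" for g
      by (simp add: H_inv_mult_distrib H_inv_inv)
    then have "(\<lambda>g. (g, h)) -` S = {g \<in> H_group. H_mult (H_inv h) g \<in> {k \<in> H_group. H_inv k \<in> A}}"
      using h by (auto simp: S_def H_mult_in H_inv_in)
    then show "emeasure \<nu> ((\<lambda>g. (g, h)) -` S) = emeasure \<nu> {h \<in> H_group. H_inv h \<in> A}"
      using haar_translate[OF \<nu> H_inv_in[OF h] B] by simp
  qed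
  finally show ?thesis using 1 by (simp add: \<mu>.emeasure_space_1)
qed

text \<open>\<open>haar_inverse\<close> gives \<mu>(A) = \<nu>(A^-1); applied to the pair \<nu>,
  \<nu> it also gives \<nu>(A) = \<nu>(A^-1).\<close>

lemma haar_unique:
  assumes "haar \<mu>" "haar \<nu>" shows "\<mu> = \<nu>"
proof (rule measure_eqI)
  show "sets \<mu> = sets \<nu>" using assms by (simp add: haar_def)
  fix A assume "A \<in> sets \<mu>"
  then have A: "A \<in> sets H_borel" using assms by (simp add: haar_def)
  show "emeasure \<mu> A = emeasure \<nu> A"
    using haar_inverse[OF assms A] haar_inverse[OF assms(2,2) A] by (rule trans[OF _ sym])
qed

text \<open>The uniform distribution on an annulus is invariant under \<open>O(2)\<close>; its normalised first
  column together with a random sign determines a random orthogonal matrix.\<close>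

definition annulus :: "(real ^ 2) measure" where
  "annulus = uniform_measure lborel (cball 0 2 - ball 0 1)"

lemma annulus_finite: "emeasure lborel ((cball 0 2 - ball (0 :: real ^ 2) 1) \<inter> X) < \<infinity>"
proof (rule emeasure_bounded_finite)
  show "bounded ((cball 0 2 - ball (0 :: real ^ 2) 1) \<inter> X)"
    by (rule bounded_subset[OF bounded_cball[of 0 2]]) auto
qed

lemma annulus_set: "cball 0 2 - ball 0 1 \<in> sets (lborel :: (real ^ 2) measure)"
  "emeasure lborel (cball 0 2 - ball (0 :: real ^ 2) 1) \<noteq> 0"
  "emeasure lborel (cball 0 2 - ball (0 :: real ^ 2) 1) \<noteq> \<infinity>"
proof -
  show "cball 0 2 - ball 0 1 \<in> sets (lborel :: (real ^ 2) measure)" by simp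
  \<comment> \<open>This ball sits between the circles of radius 1 and 2, which makes the area of
    the annulus positive.\<close>
  have "ball (((3/2) *\<^sub>R axis 1 1)) (1/2) \<subseteq> cball 0 2 - ball (0 :: real ^ 2) 1"
  proof
    fix x :: "real ^ 2" assume x: "x \<in> ball (((3/2) *\<^sub>R axis 1 1)) (1/2)"
    define a :: "real ^ 2" where "a = ((3/2) *\<^sub>R axis 1 1)"
    have "norm a = 3/2" by (simp add: a_def norm_axis_1)
    moreover have "norm (a - x) < 1/2" using x by (simp add: dist_norm a_def)
    ultimately show "x \<in> cball 0 2 - ball 0 1"
      using norm_triangle_ineq2[of x a] norm_triangle_ineq2[of a x]
      by (simp add: norm_minus_commute)
  qed
  then have "emeasure lborel (ball (((3/2) *\<^sub>R axis 1 1)) (1/2) :: (real ^ 2) set)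
      \<le> emeasure lborel (cball 0 2 - ball (0 :: real ^ 2) 1)"
    by (intro emeasure_mono) auto
  moreover have "emeasure lborel (ball (((3/2) *\<^sub>R axis 1 1)) (1/2) :: (real ^ 2) set) > 0"
    by (simp add: emeasure_ball ennreal_zero_less_mult_iff)
  ultimately show "emeasure lborel (cball 0 2 - ball (0 :: real ^ 2) 1) \<noteq> 0" by auto
  show "emeasure lborel (cball 0 2 - ball (0 :: real ^ 2) 1) \<noteq> \<infinity>"
    using annulus_finite[of UNIV] by simp
qed

lemma prob_space_annulus: "prob_space annulus"
  unfolding annulus_def using annulus_set by (intro prob_space_uniform_measure)

lemma sets_annulus [measurable_cong]: "sets annulus = sets borel"
  by (simp add: annulus_def)

lemma matrix_vector_mult_measurable [measurable]:
  "(\<lambda>v. A *v v) \<in> borel_measurable (borel :: (real ^ 'n) measure)" for A :: "real ^ 'n ^ 'm"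
  by (intro borel_measurable_continuous_onI continuous_intros)

text \<open>An orthogonal map preserves norms, hence the annulus, and Lebesgue measure. The volume
  identity concerns images of Lebesgue measurable sets, so the preimage of A inside the annulus is
  written as a set with image A inside the annulus, and the result is carried from
  \<open>lebesgue\<close> back to \<open>lborel\<close>.\<close>

lemma annulus_invariant:
  assumes g: "orthogonal_matrix g"
  shows "distr annulus annulus (\<lambda>v. g *v v) = annulus"
proof (rule measure_eqI)
  fix A assume "A \<in> sets (distr annulus annulus (\<lambda>v. g *v v))"
  then have A: "A \<in> sets borel" by (simp add: sets_annulus)
  let ?C = "cball 0 2 - ball (0 :: real ^ 2) 1"
  let ?B = "(\<lambda>v. g *v v) -` A"
  have meas: "?B \<in> sets borel"
    using measurable_sets[OF matrix_vector_mult_measurable A, of g] by simp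
  have ort: "orthogonal_transformation (\<lambda>v. g *v v)"
    using g by (simp add: orthogonal_transformation_matrix)
  have C: "g *v v \<in> ?C \<longleftrightarrow> v \<in> ?C" for v
    using orthogonal_transformation_norm[OF ort, of v] by simp
  have surj: "surj (\<lambda>v. g *v v)" by (rule orthogonal_transformation_surj[OF ort])
  have img: "(\<lambda>v. g *v v) ` (?C \<inter> ?B) = ?C \<inter> A"
  proof
    show "?C \<inter> A \<subseteq> (\<lambda>v. g *v v) ` (?C \<inter> ?B)"
    proof
      fix y assume y: "y \<in> ?C \<inter> A"
      obtain x where "y = g *v x" using surj by blast
      then show "y \<in> (\<lambda>v. g *v v) ` (?C \<inter> ?B)" using y C[of x] by blast
    qed
  next
    show "(\<lambda>v. g *v v) ` (?C \<inter> ?B) \<subseteq> ?C \<inter> A" using C by blast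
  qed
  have lm: "?C \<inter> X \<in> lmeasurable" if "X \<in> sets borel" for X
    using annulus_finite[of X] that by (intro fmeasurableI) (auto simp: emeasure_completion)
  have "measure lebesgue (?C \<inter> A) = measure lebesgue (?C \<inter> ?B)"
    using measure_orthogonal_image[OF ort lm[OF meas]] unfolding img .
  then have "emeasure lebesgue (?C \<inter> A) = emeasure lebesgue (?C \<inter> ?B)"
    using lm A meas by (simp add: emeasure_eq_measure2)
  then have "emeasure lborel (?C \<inter> A) = emeasure lborel (?C \<inter> ?B)"
    using A meas by (simp add: emeasure_completion)
  then show "emeasure (distr annulus annulus (\<lambda>v. g *v v)) A = emeasure annulus A"
    using A meas annulus_set(1)
    by (subst emeasure_distr) (simp_all add: sets_annulus annulus_def emeasure_uniform_measure)
qed simp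

text \<open>The second column is the quarter turn of the first, up to the sign given by the boolean;
  for v \<noteq> 0 this sign is the determinant. For v = 0 division by zero yields the zero
  matrix.\<close>

definition frame :: "(real ^ 2) \<times> bool \<Rightarrow> mat22" where
  "frame p = (1 / norm (fst p)) *\<^sub>R (\<chi> i j. if j = 1 then fst p $ i
     else (if snd p then 1 else - 1) * (if i = 1 then - (fst p $ 2) else fst p $ 1))"

lemma frame_nth:
  "frame (v, b) $ 1 $ 1 = v $ 1 / norm v" "frame (v, b) $ 2 $ 1 = v $ 2 / norm v"
  "frame (v, b) $ 1 $ 2 = - (if b then 1 else - 1) * v $ 2 / norm v"
  "frame (v, b) $ 2 $ 2 = (if b then 1 else - 1) * v $ 1 / norm v"
  by (simp_all add: frame_def)

lemma orthogonal_matrix_22: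
  fixes g :: mat22
  shows "orthogonal_matrix g \<longleftrightarrow> g $ 1 $ 1 * g $ 1 $ 1 + g $ 2 $ 1 * g $ 2 $ 1 = 1 \<and>
    g $ 1 $ 2 * g $ 1 $ 2 + g $ 2 $ 2 * g $ 2 $ 2 = 1 \<and> g $ 1 $ 1 * g $ 1 $ 2 + g $ 2 $ 1 * g $ 2 $ 2 = 0"
proof -
  have "transpose g ** g = mat 1 \<longleftrightarrow> (\<forall>i j. (\<Sum>k\<in>UNIV. g $ k $ i * g $ k $ j) = (if i = j then 1 else 0))"
    by (simp only: matrix_matrix_mult_def transpose_def mat_def vec_eq_iff vec_lambda_beta)
  then show ?thesis
    unfolding orthogonal_matrix forall_2 sum_2 by (auto simp: mult.commute)
qed

lemma orthogonal_frame:
  assumes "v \<noteq> 0" shows "orthogonal_matrix (frame (v, b))"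
proof -
  have n: "v $ 1 * v $ 1 + v $ 2 * v $ 2 = norm v * norm v"
    by (simp add: norm_vec_def L2_set_def sum_2 power2_eq_square)
  define a where "a = v $ 1 / norm v"
  define c where "c = v $ 2 / norm v"
  define s :: real where "s = (if b then 1 else - 1)"
  have "a * a + c * c = 1"
    using n assms by (simp add: a_def c_def add_divide_distrib[symmetric])
  moreover have "s * s = 1" by (simp add: s_def)
  moreover have "frame (v, b) $ 1 $ 1 = a" "frame (v, b) $ 2 $ 1 = c"
    "frame (v, b) $ 1 $ 2 = - s * c" "frame (v, b) $ 2 $ 2 = s * a"
    by (simp_all only: frame_nth a_def c_def s_def times_divide_eq_right)
  ultimately show ?thesis
    unfolding orthogonal_matrix_22 by (simp add: algebra_simps)
qed

text \<open>For an orthogonal matrix the inverse is the transpose, so the matrix equals its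
  determinant times its cofactor matrix.\<close>

lemma orthogonal_matrix_2:
  fixes g :: mat22
  assumes "orthogonal_matrix g"
  shows "g $ 2 $ 2 = det g * g $ 1 $ 1" "g $ 2 $ 1 = - det g * g $ 1 $ 2"
    and "g $ 1 $ 1 = det g * g $ 2 $ 2" "g $ 1 $ 2 = - det g * g $ 2 $ 1"
proof -
  have t: "orthogonal_matrix (transpose g)" using assms by simp
  have c: "g $ 1 $ 1 * g $ 1 $ 1 + g $ 2 $ 1 * g $ 2 $ 1 = 1" "g $ 1 $ 2 * g $ 1 $ 2 + g $ 2 $ 2 * g $ 2 $ 2 = 1"
    "g $ 1 $ 1 * g $ 1 $ 2 + g $ 2 $ 1 * g $ 2 $ 2 = 0"
    using assms unfolding orthogonal_matrix_22 by blast+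
  have r: "g $ 1 $ 1 * g $ 1 $ 1 + g $ 1 $ 2 * g $ 1 $ 2 = 1" "g $ 1 $ 1 * g $ 2 $ 1 + g $ 1 $ 2 * g $ 2 $ 2 = 0"
    using t unfolding orthogonal_matrix_22 by (simp_all add: transpose_def)
  have row: "d = (a * d - b * c) * a" "c = - (a * d - b * c) * b"
    if "a * a + b * b = 1" "a * c + b * d = 0" for a b c d :: real
  proof -
    have "d - (a * d - b * c) * a = d * (1 - (a * a + b * b)) + b * (a * c + b * d)"
      "c - - (a * d - b * c) * b = c * (1 - (a * a + b * b)) + a * (a * c + b * d)"
      by (simp_all add: algebra_simps)
    with that show "d = (a * d - b * c) * a" "c = - (a * d - b * c) * b"
      by (simp_all only: diff_self mult_zero_right add_0_right right_minus_eq)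
  qed
  show "g $ 2 $ 2 = det g * g $ 1 $ 1" "g $ 2 $ 1 = - det g * g $ 1 $ 2"
    unfolding det_2 using row[OF r] by simp_all
  show "g $ 1 $ 1 = det g * g $ 2 $ 2" "g $ 1 $ 2 = - det g * g $ 2 $ 1"
    unfolding det_2 using row[of "g $ 2 $ 2" "g $ 1 $ 2" "g $ 2 $ 1" "g $ 1 $ 1"]
      row[of "g $ 1 $ 1" "g $ 2 $ 1" "g $ 1 $ 2" "g $ 2 $ 2"] c
    by (simp_all add: algebra_simps)
qed

text \<open>A rotation commutes with the quarter turn and a reflection anticommutes with it.
  Comparing the boolean with \<open>det g = 1\<close> keeps it for a rotation and negates it for a
  reflection.\<close>

lemma frame_equivariant:
  assumes g: "orthogonal_matrix g"
  shows "g ** frame (v, b) = frame (g *v v, b = (det g = 1))"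
proof -
  have ort: "orthogonal_transformation (\<lambda>v. g *v v)"
    using g by (simp add: orthogonal_transformation_matrix)
  have n: "norm (g *v v) = norm v" by (rule orthogonal_transformation_norm[OF ort])
  have gv: "(g *v v) $ i = g $ i $ 1 * v $ 1 + g $ i $ 2 * v $ 2" for i
    by (simp add: matrix_vector_mult_def sum_2)
  have m: "(g ** A) $ i $ j = g $ i $ 1 * A $ 1 $ j + g $ i $ 2 * A $ 2 $ j" for i j and A :: mat22
    by (simp add: matrix_matrix_mult_def sum_2)
  define d where "d = det g"
  note o = orthogonal_matrix_2[OF g, folded d_def]
  have "d = 1 \<or> d = - 1" using det_orthogonal_matrix[OF g] by (auto simp: d_def)
  with o show ?thesis
    by (elim disjE) (simp_all add: vec_eq_iff forall_2 m frame_nth n gv d_def[symmetric] add_divide_distrib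
        algebra_simps diff_divide_distrib)
qed

definition coin :: "bool measure" where "coin = uniform_count_measure UNIV"

lemma prob_space_coin: "prob_space coin"
  unfolding coin_def by (rule prob_space_uniform_count_measure) auto

lemma sets_coin [measurable_cong]: "sets coin = sets (count_space UNIV)"
  by (simp add: coin_def)

lemma coin_invariant: "distr coin coin (\<lambda>b. b = c) = coin"
proof (rule measure_eqI)
  fix A assume "A \<in> sets (distr coin coin (\<lambda>b. b = c))"
  have "bij (\<lambda>b. b = c)" by (rule bijI) (auto simp: inj_def surj_def)
  then have "card ((\<lambda>b. b = c) -` A) = card A"
    by (simp add: card_vimage_inj bij_def)
  then show "emeasure (distr coin coin (\<lambda>b. b = c)) A = emeasure coin A"
    by (subst emeasure_distr) (simp_all add: coin_def emeasure_uniform_count_measure space_uniform_count_measure)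
qed simp

text \<open>The uniform law on O(2), kept as a measure on all matrices: invariance is then an
  identity on \<open>borel\<close>, and concentration on orthogonal matrices is a separate almost
  sure statement.\<close>

definition O2_law :: "mat22 measure" where
  "O2_law = distr (annulus \<Otimes>\<^sub>M coin) borel frame"

lemma measurable_frame: "frame \<in> annulus \<Otimes>\<^sub>M coin \<rightarrow>\<^sub>M borel"
proof -
  have "(\<lambda>v. frame (v, b)) \<in> borel_measurable borel" for b
  proof -
    have "continuous_on UNIV (\<lambda>v :: real ^ 2. if j = 1 then v $ i
        else (if b then 1 else - 1) * (if i = 1 then - (v $ 2) else v $ 1))" for i j :: 2
      by (cases "j = 1"; cases "i = 1"; cases b) (auto intro!: continuous_intros)
    then have "(\<lambda>v :: real ^ 2. (\<chi> i j. if j = 1 then v $ i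
        else (if b then 1 else - 1) * (if i = 1 then - (v $ 2) else v $ 1)) :: mat22) \<in> borel_measurable borel"
      by (intro borel_measurable_continuous_onI continuous_on_vec_lambda)
    then show ?thesis unfolding frame_def fst_conv snd_conv by (rule borel_measurable_scaleR[rotated]) measurable
  qed
  then have "(\<lambda>(b, v). frame (v, b)) \<in> count_space UNIV \<Otimes>\<^sub>M borel \<rightarrow>\<^sub>M borel"
    by (intro measurable_pair_measure_countable1) auto
  moreover have "(\<lambda>p. (snd p, fst p)) \<in> annulus \<Otimes>\<^sub>M coin \<rightarrow>\<^sub>M count_space UNIV \<Otimes>\<^sub>M borel"
    by measurable
  ultimately have "(\<lambda>p. case (snd p, fst p) of (b, v) \<Rightarrow> frame (v, b)) \<in> annulus \<Otimes>\<^sub>M coin \<rightarrow>\<^sub>M borel"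
    by (rule measurable_compose[rotated])
  then show ?thesis
    by simp
qed

text \<open>By equivariance of \<open>frame\<close>, left multiplication by g corresponds to a map
  on vectors and signs that preserves both the annulus law and the coin.\<close>

lemma O2_law_invariant:
  assumes g: "orthogonal_matrix g" shows "distr O2_law borel (\<lambda>A. g ** A) = O2_law"
proof -
  let ?T = "\<lambda>(v, b). (g *v v, b = (det g = 1))"
  interpret coin: prob_space coin by (rule prob_space_coin)
  have mult: "(\<lambda>A. g ** A) \<in> borel \<rightarrow>\<^sub>M borel"
    by (intro borel_measurable_continuous_onI continuous_intros)
  have Tv: "(\<lambda>v. g *v v) \<in> annulus \<rightarrow>\<^sub>M annulus" by measurable
  have Tb: "(\<lambda>b. b = (det g = 1)) \<in> coin \<rightarrow>\<^sub>M coin" by (simp add: coin_def measurable_def space_uniform_count_measure)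
  have T: "?T \<in> annulus \<Otimes>\<^sub>M coin \<rightarrow>\<^sub>M annulus \<Otimes>\<^sub>M coin"
    unfolding split_beta
    by (intro measurable_Pair measurable_compose[OF measurable_fst Tv] measurable_compose[OF measurable_snd Tb])
  have inv: "distr (annulus \<Otimes>\<^sub>M coin) (annulus \<Otimes>\<^sub>M coin) ?T = annulus \<Otimes>\<^sub>M coin"
    by (rule pair_measure_distr[OF Tv Tb, unfolded annulus_invariant[OF g] coin_invariant,
          OF coin.sigma_finite_measure_axioms, symmetric])
  have "distr O2_law borel (\<lambda>A. g ** A) = distr (annulus \<Otimes>\<^sub>M coin) borel (\<lambda>p. g ** frame p)"
    unfolding O2_law_def by (simp add: distr_distr[OF mult measurable_frame] o_def)
  also have "(\<lambda>p. g ** frame p) = frame \<circ> ?T"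
    using frame_equivariant[OF g] by auto
  also have "distr (annulus \<Otimes>\<^sub>M coin) borel (frame \<circ> ?T) = O2_law"
    unfolding O2_law_def using distr_distr[OF measurable_frame T] inv by simp
  finally show ?thesis .
qed

lemma prob_space_O2_law: "prob_space O2_law"
proof -
  interpret annulus: prob_space annulus by (rule prob_space_annulus)
  interpret coin: prob_space coin by (rule prob_space_coin)
  interpret pair_prob_space annulus coin ..
  show ?thesis unfolding O2_law_def by (rule prob_space_distr[OF measurable_frame])
qed

lemma AE_O2_law: "AE A in O2_law. orthogonal_matrix A"
proof -
  interpret annulus: prob_space annulus by (rule prob_space_annulus)
  interpret coin: prob_space coin by (rule prob_space_coin)
  interpret pair_sigma_finite annulus coin ..
  have "AE v in annulus. v \<noteq> 0"
    unfolding annulus_def using annulus_set(1) by (intro AE_uniform_measureI) auto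
  then have "AE v in annulus. AE b in coin. orthogonal_matrix (frame (v, b))"
    by eventually_elim (simp add: orthogonal_frame)
  moreover have "{A :: mat22. orthogonal_matrix A} \<in> sets borel"
    using compact_orthogonal_matrices by (rule borel_compact)
  then have ort: "Measurable.pred borel (orthogonal_matrix :: mat22 \<Rightarrow> bool)" by (simp add: pred_def)
  ultimately have "AE p in annulus \<Otimes>\<^sub>M coin. orthogonal_matrix (frame p)"
    by (intro AE_pair_measure) (use measurable_compose[OF measurable_frame ort] in \<open>auto simp: pred_def\<close>)
  then show ?thesis
    unfolding O2_law_def using ort by (subst AE_distr_iff[OF measurable_frame]) (simp_all add: pred_def)
qed

text \<open>The product of two invariant laws is invariant under componentwise multiplication, and
  the restriction to \<open>H_group\<close> loses only a null set.\<close>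

lemma haar_exists: "haar (restrict_space (O2_law \<Otimes>\<^sub>M O2_law) H_group)"
proof -
  interpret \<sigma>: prob_space O2_law by (rule prob_space_O2_law)
  interpret pair_prob_space O2_law O2_law ..
  let ?P = "O2_law \<Otimes>\<^sub>M O2_law"
  have sO: "sets O2_law = sets borel" by (simp add: O2_law_def)
  have sP: "sets ?P = sets borel"
    unfolding borel_prod[symmetric] by (rule sets_pair_measure_cong[OF sO sO])
  have spP: "space ?P = UNIV" using sets_eq_imp_space_eq[OF sP] by simp
  have H: "H_group \<in> sets ?P" by (simp add: sP H_group_borel)
  have "AE h in ?P. h \<in> H_group"
  proof (rule AE_pair_measure)
    show "{x \<in> space ?P. x \<in> H_group} \<in> sets ?P" using H by (simp add: spP)
    show "AE x in O2_law. AE y in O2_law. (x, y) \<in> H_group"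
      using AE_O2_law by eventually_elim (use AE_O2_law in \<open>eventually_elim, simp add: H_group_iff\<close>)
  qed
  then have H1: "emeasure ?P H_group = 1"
    using H by (simp add: emeasure_eq_1_AE)
  have sets: "sets (restrict_space ?P H_group) = sets H_borel"
    by (rule sets_restrict_space_cong[OF sP])
  have "distr (restrict_space ?P H_group) (restrict_space ?P H_group) (H_mult g) = restrict_space ?P H_group"
    if g: "g \<in> H_group" for g
  proof (rule measure_eqI)
    fix A assume "A \<in> sets (distr (restrict_space ?P H_group) (restrict_space ?P H_group) (H_mult g))"
    then have A: "A \<in> sets H_borel" by (simp add: sets)
    then have AH: "A \<subseteq> H_group" using sets.sets_into_space[OF A] by (simp add: space_H_borel)
    have AP: "A \<in> sets ?P" using A H_group_borel by (simp add: sP sets_restrict_space_iff)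
    have mult: "(\<lambda>A. B ** A) \<in> O2_law \<rightarrow>\<^sub>M borel" for B :: mat22
      using borel_measurable_continuous_onI[of "\<lambda>A. B ** A"]
      by (simp add: continuous_intros measurable_cong_sets[OF sO refl])
    have prod_map: "(\<lambda>(x, y). (fst g ** x, snd g ** y)) = H_mult g" by (auto simp: H_mult_def)
    have O2: "distr O2_law borel (\<lambda>A. fst g ** A) = O2_law" "distr O2_law borel (\<lambda>A. snd g ** A) = O2_law"
      using g by (simp_all add: H_group_iff O2_law_invariant)
    have inv: "?P = distr ?P (borel \<Otimes>\<^sub>M borel) (H_mult g)"
      by (rule pair_measure_distr[OF mult[of "fst g"] mult[of "snd g"], unfolded O2 prod_map,
            OF \<sigma>.sigma_finite_measure_axioms])
    \<comment> \<open>Multiplying back by the inverse of g shows that the preimage of a subset of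
      the group already lies in the group.\<close>
    have pre: "H_mult g -` A \<inter> H_group = H_mult g -` A"
    proof -
      have "h \<in> H_group" if "H_mult g h \<in> A" for h
        using H_inv_mult[OF g, of h] H_mult_in[OF H_inv_in[OF g], of "H_mult g h"] that AH by auto
      then show ?thesis by auto
    qed
    have m: "H_mult g \<in> ?P \<rightarrow>\<^sub>M borel \<Otimes>\<^sub>M borel"
    proof -
      have "continuous_on UNIV (H_mult g)" unfolding H_mult_def by (intro continuous_intros)
      then have "H_mult g \<in> borel \<rightarrow>\<^sub>M borel" by (rule borel_measurable_continuous_onI)
      then show ?thesis by (simp add: borel_prod measurable_cong_sets[OF sP refl])
    qed
    have "emeasure (distr (restrict_space ?P H_group) (restrict_space ?P H_group) (H_mult g)) A
        = emeasure (restrict_space ?P H_group) (H_mult g -` A \<inter> H_group)"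
      using H_mult_measurable[OF g] A
      by (subst emeasure_distr) (simp_all add: sets space_restrict_space spP cong: measurable_cong_sets)
    also have "\<dots> = emeasure ?P (H_mult g -` A \<inter> H_group)"
      using H by (intro emeasure_restrict_space) auto
    also have "\<dots> = emeasure (distr ?P (borel \<Otimes>\<^sub>M borel) (H_mult g)) A"
      using m AP[unfolded sP, folded borel_prod] by (subst emeasure_distr) (simp_all add: spP pre)
    also have "\<dots> = emeasure ?P A" by (simp only: inv[symmetric])
    also have "\<dots> = emeasure (restrict_space ?P H_group) A"
      using H AH by (intro emeasure_restrict_space[symmetric]) auto
    finally show "emeasure (distr (restrict_space ?P H_group) (restrict_space ?P H_group) (H_mult g)) A
        = emeasure (restrict_space ?P H_group) A" .
  qed simp
  moreover have "prob_space (restrict_space ?P H_group)"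
    by (rule prob_spaceI) (use H H1 in \<open>simp add: space_restrict_space spP emeasure_restrict_space\<close>)
  ultimately show ?thesis unfolding haar_def using sets by blast
qed

lemma haar_H_uniform: "haar H_uniform"
proof -
  have eq: "H_uniform = (THE \<mu>. haar \<mu>)"
    unfolding H_uniform_def haar_def H_mult_def by simp
  show ?thesis
    unfolding eq by (rule theI[where P = haar, OF haar_exists]) (rule haar_unique[OF _ haar_exists])
qed

text \<open>By compactness finitely many left translates of U cover the group. They all have the
  measure of U, so a null U would make the whole group null.\<close>

lemma haar_open_pos:
  assumes \<mu>: "haar \<mu>" and U: "open U" and h0: "h0 \<in> U" "h0 \<in> H_group"
  shows "emeasure \<mu> (U \<inter> H_group) > 0"
proof (rule ccontr)
  assume "\<not> ?thesis"
  then have zero: "emeasure \<mu> (U \<inter> H_group) = 0" by simp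
  interpret prob_space \<mu> using \<mu> by (simp add: haar_def)
  have s: "sets \<mu> = sets H_borel" using \<mu> by (simp add: haar_def)
  have UH: "U \<inter> H_group \<in> sets H_borel"
    using U by (simp add: sets_restrict_space_iff H_group_borel sets.Int)
  let ?V = "\<lambda>g. H_mult (H_inv g) -` U"
  have opn: "open (?V g)" for g
  proof -
    have "continuous_on UNIV (H_mult (H_inv g))" unfolding H_mult_def by (intro continuous_intros)
    then show ?thesis using U by (simp add: continuous_on_open_vimage)
  qed
  have cover: "H_group \<subseteq> (\<Union>g\<in>H_group. ?V g)"
  proof
    fix h assume h: "h \<in> H_group"
    \<comment> \<open>The translation by h h0^-1 carries h0 to h, so the corresponding translate of
      U contains h.\<close>
    let ?g = "H_mult h (H_inv h0)"
    have "H_mult (H_inv ?g) h = H_mult (H_mult h0 (H_inv h)) h"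
      by (simp add: H_inv_mult_distrib H_inv_inv)
    also have "\<dots> = h0" using h by (rule H_mult_inv_right)
    finally have "h \<in> ?V ?g" using h0 by simp
    moreover have "?g \<in> H_group" using h h0 by (simp add: H_mult_in H_inv_in)
    ultimately show "h \<in> (\<Union>g\<in>H_group. ?V g)" by (rule UN_I[rotated])
  qed
  obtain K where K: "K \<subseteq> H_group" "finite K" "H_group \<subseteq> (\<Union>g\<in>K. ?V g)"
    by (rule compactE_image[OF compact_H_group opn cover])
  have null: "{h \<in> H_group. H_mult (H_inv g) h \<in> U \<inter> H_group} \<in> null_sets \<mu>" if "g \<in> K" for g
  proof -
    have g: "H_inv g \<in> H_group" using that K by (auto intro: H_inv_in)
    have "{h \<in> H_group. H_mult (H_inv g) h \<in> U \<inter> H_group} \<in> sets \<mu>"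
      using measurable_sets[OF H_mult_measurable[OF g] UH]
      by (simp add: s space_H_borel vimage_def Int_def conj_commute)
    then show ?thesis using haar_translate[OF \<mu> g UH] zero by (simp add: null_sets_def)
  qed
  have sub: "H_group \<subseteq> (\<Union>g\<in>K. {h \<in> H_group. H_mult (H_inv g) h \<in> U \<inter> H_group})"
  proof
    fix h assume h: "h \<in> H_group"
    then obtain g where g: "g \<in> K" "h \<in> ?V g" using K(3) by blast
    then have "H_mult (H_inv g) h \<in> H_group" using h K(1) by (blast intro: H_mult_in H_inv_in)
    then show "h \<in> (\<Union>g\<in>K. {h \<in> H_group. H_mult (H_inv g) h \<in> U \<inter> H_group})"
      using g h by blast
  qed
  have nl: "(\<Union>g\<in>K. {h \<in> H_group. H_mult (H_inv g) h \<in> U \<inter> H_group}) \<in> null_sets \<mu>"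
    by (rule null_sets_UN'[OF countable_finite[OF K(2)] null])
  have "H_group \<in> sets \<mu>" using haar_space[OF \<mu>] sets.top[of \<mu>] by simp
  then have "emeasure \<mu> H_group = 0" by (rule null_setsD1[OF null_sets_subset[OF nl _ sub]])
  then show False using emeasure_space_1 haar_space[OF \<mu>] by simp
qed

section \<open>Bounds for Hausdorff measures\<close>

text \<open>A cover of A pulls back along the expanding map to a cover of S by balls of radius L
  diam(C n). Their volume is (2 L)^s times the Hausdorff weight of C n, where s is the dimension, so
  the content at scale 1 is at least vol(S) / (2 L)^s.\<close>

lemma hausdorff_measure_pos:
  fixes \<Phi> :: "'a::euclidean_space \<Rightarrow> 'b::metric_space"
  assumes S: "S \<in> sets borel" "emeasure lborel S > 0" and L: "L > 0"
    and exp: "\<And>p q. p \<in> S \<Longrightarrow> q \<in> S \<Longrightarrow> dist p q \<le> L * dist (\<Phi> p) (\<Phi> q)"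
    and A: "\<Phi> ` S \<subseteq> A"
  shows "hausdorff_measure DIM('a) A > 0"
proof -
  let ?s = "DIM('a)"
  define K where "K = (2 * L) ^ ?s"
  have K: "K > 0" using L by (simp add: K_def)
  have le: "emeasure lborel S / ennreal K \<le> hausdorff_content ?s 1 A"
    unfolding hausdorff_content_def
  proof (rule INF_greatest)
    fix C :: "nat \<Rightarrow> 'b set"
    assume "C \<in> {C. A \<subseteq> (\<Union>n. C n) \<and> (\<forall>n. bounded (C n) \<and> diameter (C n) \<le> 1)}"
    then have C: "A \<subseteq> (\<Union>n. C n)" "\<And>n. bounded (C n)" by auto
    let ?t = "\<lambda>n. if C n = {} then 0 else ennreal (unit_ball_vol (real ?s) * (diameter (C n) / 2) ^ ?s)"
    define p where "p n = (SOME p. p \<in> S \<and> \<Phi> p \<in> C n)" for n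
    \<comment> \<open>Covering sets that miss the image of S receive the empty set, since
      \<open>p n\<close> is then an arbitrary default.\<close>
    define B where "B n = (if \<exists>p. p \<in> S \<and> \<Phi> p \<in> C n then cball (p n) (L * diameter (C n)) else {})" for n
    have "S \<subseteq> (\<Union>n. B n)"
    proof
      fix q assume q: "q \<in> S"
      then obtain n where n: "\<Phi> q \<in> C n" using A C(1) by blast
      have p: "p n \<in> S \<and> \<Phi> (p n) \<in> C n" unfolding p_def by (rule someI[of _ q]) (use q n in simp)
      have "dist (p n) q \<le> L * dist (\<Phi> (p n)) (\<Phi> q)" using p q by (intro exp) auto
      also have "\<dots> \<le> L * diameter (C n)"
        using p n L by (intro mult_left_mono diameter_bounded_bound C) auto
      finally have "q \<in> B n" using q n by (auto simp: B_def)
      then show "q \<in> (\<Union>n. B n)" by blast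
    qed
    moreover have B: "B n \<in> sets lborel" for n by (simp add: B_def)
    ultimately have "emeasure lborel S \<le> emeasure lborel (\<Union>n. B n)"
      by (intro emeasure_mono) auto
    also have "\<dots> \<le> (\<Sum>n. emeasure lborel (B n))"
      using B by (intro emeasure_subadditive_countably) auto
    also have "\<dots> \<le> (\<Sum>n. ennreal K * ?t n)"
    proof (rule suminf_le)
      fix n
      show "emeasure lborel (B n) \<le> ennreal K * ?t n"
      proof (cases "\<exists>p. p \<in> S \<and> \<Phi> p \<in> C n")
        case True
        then have "C n \<noteq> {}" by auto
        have "diameter (C n) \<ge> 0" by (rule diameter_ge_0[OF C(2)])
        then show ?thesis
          using True \<open>C n \<noteq> {}\<close> L
          by (simp add: B_def emeasure_cball K_def power_mult_distrib power_divide mult_ac flip: ennreal_mult'')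
      next
        case False
        then have "B n = {}" unfolding B_def by (rule if_not_P)
        then show ?thesis by simp
      qed
    qed auto
    also have "\<dots> = ennreal K * (\<Sum>n. ?t n)" by (rule ennreal_suminf_cmult)
    finally show "emeasure lborel S / ennreal K \<le> (\<Sum>n. ?t n)"
      using K by (intro divide_le_posI_ennreal) (auto simp: mult.commute)
  qed
  have "0 < emeasure lborel S / ennreal K"
    using S(2) K by (simp add: ennreal_zero_less_divide)
  also note le
  also have "hausdorff_content ?s 1 A \<le> hausdorff_measure ?s A"
    unfolding hausdorff_measure_def by (intro SUP_upper) auto
  finally show ?thesis .
qed

text \<open>Cut the cube [-1, 1]^s into cells of side 2 / N. There are at most (N + 1)^s \<le> (2
  N)^s cells per chart, and each image has diameter at most 2 L s / N; in the total weight N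
  cancels, which leaves the bound \<open>M\<close> for every scale \<delta>.\<close>

lemma hausdorff_measure_finite:
  fixes I :: "(real ^ 'n \<Rightarrow> 'b::metric_space) set"
  assumes I: "finite I" and L: "L > 0"
    and lip: "\<And>\<Phi> p q. \<Phi> \<in> I \<Longrightarrow> (\<And>i. \<bar>p $ i\<bar> \<le> 1) \<Longrightarrow> (\<And>i. \<bar>q $ i\<bar> \<le> 1) \<Longrightarrow>
      dist (\<Phi> p) (\<Phi> q) \<le> L * norm (p - q)"
    and A: "A \<subseteq> (\<Union>\<Phi>\<in>I. \<Phi> ` {p. \<forall>i. \<bar>p $ i\<bar> \<le> 1})"
  shows "hausdorff_measure CARD('n) A < \<infinity>"
proof -
  let ?s = "CARD('n)" and ?v = "unit_ball_vol (real CARD('n))"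
  define M where "M = real (card I) * ?v * (2 * L * ?s) ^ ?s"
  have "hausdorff_content ?s \<delta> A \<le> ennreal M" if \<delta>: "\<delta> > 0" for \<delta>
  proof -
    obtain N :: nat where N0: "2 * L * ?s / \<delta> < real N" using reals_Archimedean2 by blast
    have "0 < 2 * L * ?s / \<delta>" using L \<delta> by simp
    with N0 have "0 < real N" by linarith
    moreover have "2 * L * ?s \<le> \<delta> * N" using N0 \<delta> by (simp add: pos_divide_less_eq mult.commute)
    ultimately have N: "N > 0" "2 * L * ?s / N \<le> \<delta>" by (simp_all add: pos_divide_le_eq)
    \<comment> \<open>The floor runs through 0, ..., N; the last value occurs only on the face where
      the coordinate is 1, which is why there are N + 1 indices per direction.\<close>
    define cell where "cell k = {p :: real ^ 'n. \<forall>i. \<bar>p $ i\<bar> \<le> 1 \<and> \<lfloor>(p $ i + 1) * N / 2\<rfloor> = int (k i)}"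
      for k :: "'n \<Rightarrow> nat"
    define K where "K = PiE UNIV (\<lambda>_ :: 'n. {0..N})"
    define J where "J = I \<times> K"
    have cardJ: "finite J" "card J = card I * (N + 1) ^ ?s"
      using I by (simp_all add: J_def K_def finite_PiE card_cartesian_product card_PiE)
    obtain h where h: "bij_betw h {0..<card J} J" using ex_bij_betw_nat_finite[OF cardJ(1)] by blast
    \<comment> \<open>The finite cover is padded to a sequence by empty sets, to which
      \<open>hausdorff_content\<close> assigns weight 0.\<close>
    define C where "C n = (if n < card J then fst (h n) ` cell (snd (h n)) else {})" for n
    have dist: "dist x y \<le> 2 * L * ?s / N" if asm: "x \<in> \<Phi> ` cell k" "y \<in> \<Phi> ` cell k" "\<Phi> \<in> I" for x y \<Phi> k
    proof -
      obtain p q where pq: "x = \<Phi> p" "y = \<Phi> q" "p \<in> cell k" "q \<in> cell k" using asm by blast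
      have "\<bar>(p - q) $ i\<bar> \<le> 2 / N" for i
      proof -
        have "\<bar>(p $ i + 1) * N / 2 - (q $ i + 1) * N / 2\<bar> \<le> 1"
        proof -
          have "\<lfloor>(p $ i + 1) * N / 2\<rfloor> = \<lfloor>(q $ i + 1) * N / 2\<rfloor>" using pq(3,4) by (simp add: cell_def)
          then show ?thesis by linarith
        qed
        then have "\<bar>(p $ i - q $ i) * N / 2\<bar> \<le> 1" by (simp add: algebra_simps diff_divide_distrib add_divide_distrib)
        then have "\<bar>p $ i - q $ i\<bar> * N \<le> 2" by (simp add: abs_mult)
        then show ?thesis using N by (simp add: field_simps)
      qed
      then have "norm (p - q) \<le> (\<Sum>i\<in>(UNIV :: 'n set). 2 / N)"
        by (intro order.trans[OF norm_le_l1_cart] sum_mono)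
      then have "norm (p - q) \<le> ?s * (2 / N)" by simp
      then have "L * norm (p - q) \<le> L * (?s * (2 / N))" using L by (intro mult_left_mono) auto
      moreover have "dist x y \<le> L * norm (p - q)"
        unfolding pq by (rule lip[OF asm(3)]) (use pq in \<open>auto simp: cell_def\<close>)
      moreover have "L * (?s * (2 / N)) = 2 * L * ?s / N" by simp
      ultimately show ?thesis by linarith
    qed
    have CI: "fst (h n) \<in> I" if "n < card J" for n
      using bij_betwE[OF h] that by (auto simp: J_def mem_Times_iff)
    have Cb: "bounded (C n)" "diameter (C n) \<le> 2 * L * ?s / N" for n
    proof -
      have d: "dist x y \<le> 2 * L * ?s / N" if "x \<in> C n" "y \<in> C n" for x y
        using that dist CI by (auto simp: C_def split: if_splits)
      show "bounded (C n)"
      proof (cases "C n = {}")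
        case False
        then obtain x where "x \<in> C n" by blast
        then show ?thesis using d unfolding bounded_def by blast
      qed simp
      show "diameter (C n) \<le> 2 * L * ?s / N"
      proof (cases "C n = {}")
        case True
        then show ?thesis using L by simp
      next
        case False
        then have "(SUP (x, y)\<in>C n \<times> C n. dist x y) \<le> 2 * L * ?s / N"
          by (intro cSUP_least) (use d in auto)
        then show ?thesis using False by (simp add: diameter_def)
      qed
    qed
    have cover: "A \<subseteq> (\<Union>n. C n)"
    proof
      fix x assume "x \<in> A"
      then obtain \<Phi> p where p: "\<Phi> \<in> I" "x = \<Phi> p" "\<And>i. \<bar>p $ i\<bar> \<le> 1" using A by blast
      define k where "k i = nat \<lfloor>(p $ i + 1) * N / 2\<rfloor>" for i
      have pos: "0 \<le> (p $ i + 1) * N / 2" "(p $ i + 1) * N / 2 \<le> N" for i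
      proof -
        have "0 \<le> p $ i + 1" "p $ i + 1 \<le> 2" using p(3)[of i] by auto
        then have "0 \<le> (p $ i + 1) * N" "(p $ i + 1) * N \<le> 2 * N" by (auto intro: mult_right_mono)
        then show "0 \<le> (p $ i + 1) * N / 2" "(p $ i + 1) * N / 2 \<le> N" by simp_all
      qed
      have k: "\<lfloor>(p $ i + 1) * N / 2\<rfloor> = int (k i)" for i using pos(1)[of i] by (simp add: k_def)
      have "k i \<le> N" for i using k[of i] pos(2)[of i] by linarith
      then have "k \<in> K" by (auto simp: K_def PiE_UNIV_domain)
      then have "(\<Phi>, k) \<in> h ` {0..<card J}"
        unfolding bij_betw_imp_surj_on[OF h] using p by (simp add: J_def)
      then obtain n where n: "n < card J" "h n = (\<Phi>, k)" by auto
      have "p \<in> cell k" using p k by (simp add: cell_def)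
      then have "x \<in> C n" using n p by (simp add: C_def)
      then show "x \<in> (\<Union>n. C n)" by blast
    qed
    let ?t = "\<lambda>n. if C n = {} then 0 else ennreal (?v * (diameter (C n) / 2) ^ ?s)"
    define e where "e = ?v * (L * ?s / N) ^ ?s"
    have e0: "e \<ge> 0" using L by (simp add: e_def)
    have te: "?t n \<le> ennreal e" for n
    proof -
      have "2 * L * ?s / N = 2 * (L * ?s / N)" by simp
      then have "diameter (C n) / 2 \<le> L * ?s / N" using Cb(2)[of n] by linarith
      then have "(diameter (C n) / 2) ^ ?s \<le> (L * ?s / N) ^ ?s"
        using diameter_ge_0[OF Cb(1)] by (intro power_mono) auto
      then show ?thesis by (simp add: e_def ennreal_leI mult_left_mono)
    qed
    have "(\<Sum>n. ?t n) = (\<Sum>n<card J. ?t n)"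
      by (rule suminf_finite) (auto simp: C_def)
    also have "\<dots> \<le> (\<Sum>n<card J. ennreal e)" by (intro sum_mono te)
    also have "\<dots> = ennreal (real (card J) * e)" using e0 by (subst sum_ennreal) simp_all
    also have "\<dots> \<le> ennreal M"
    proof (rule ennreal_leI)
      have "real (N + 1) ^ ?s \<le> (2 * real N) ^ ?s" using N by (intro power_mono) auto
      then have "real (card I) * real (N + 1) ^ ?s * e \<le> real (card I) * (2 * real N) ^ ?s * e"
        using e0 by (intro mult_right_mono mult_left_mono) auto
      also have "\<dots> = M"
      proof -
        have "(2 * real N) ^ ?s * (L * ?s / N) ^ ?s = (2 * L * ?s) ^ ?s"
          unfolding power_mult_distrib[symmetric] using N by (intro arg_cong[where f = "\<lambda>x. x ^ ?s"]) simp
        then show ?thesis by (simp add: e_def M_def mult_ac)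
      qed
      finally show "real (card J) * e \<le> M" by (simp add: cardJ mult.assoc)
    qed
    finally have "(\<Sum>n. ?t n) \<le> ennreal M" .
    moreover have "C \<in> {C. A \<subseteq> (\<Union>n. C n) \<and> (\<forall>n. bounded (C n) \<and> diameter (C n) \<le> \<delta>)}"
      using cover Cb N(2) by (auto intro: order.trans)
    ultimately show ?thesis unfolding hausdorff_content_def by (intro INF_lower2)
  qed
  then have "hausdorff_measure ?s A \<le> ennreal M"
    unfolding hausdorff_measure_def by (intro SUP_least) auto
  then show ?thesis by (rule order.strict_trans1) simp
qed

section \<open>Orthogonal projections\<close>

lemma closest_point_subspace:
  fixes L :: "'a::euclidean_space set"
  assumes L: "subspace L"
  shows "closest_point L x \<in> L" "\<And>z. z \<in> L \<Longrightarrow> (x - closest_point L x) \<bullet> z = 0"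
    and "\<And>y. y \<in> L \<Longrightarrow> (\<And>z. z \<in> L \<Longrightarrow> (x - y) \<bullet> z = 0) \<Longrightarrow> closest_point L x = y"
proof -
  have uniq: "closest_point L x = y" if y: "y \<in> L" "\<And>z. z \<in> L \<Longrightarrow> (x - y) \<bullet> z = 0" for y
  proof (rule closest_point_unique[symmetric])
    show "convex L" "closed L" using L by (simp_all add: subspace_imp_convex closed_subspace)
    show "\<forall>z\<in>L. dist x y \<le> dist x z"
    proof
      fix z assume "z \<in> L"
      then have "y - z \<in> L" using y(1) L by (simp add: subspace_diff)
      then have "(x - y) \<bullet> (y - z) = 0" by (rule y(2))
      then have "norm (x - z) ^ 2 = norm (x - y) ^ 2 + norm (y - z) ^ 2"
        using norm_add_Pythagorean[of "x - y" "y - z"] by (simp add: orthogonal_def)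
      then have "norm (x - y) ^ 2 \<le> norm (x - z) ^ 2" by simp
      then show "dist x y \<le> dist x z" unfolding dist_norm by (rule power2_le_imp_le) simp
    qed
  qed (rule y(1))
  obtain y z where yz: "y \<in> span L" "\<And>w. w \<in> span L \<Longrightarrow> orthogonal z w" "x = y + z"
    using orthogonal_subspace_decomp_exists[of L x] by blast
  have "closest_point L x = y"
    using yz L by (intro uniq) (auto simp: orthogonal_def span_eq_iff[THEN iffD2])
  then show "closest_point L x \<in> L" "\<And>z. z \<in> L \<Longrightarrow> (x - closest_point L x) \<bullet> z = 0"
    using yz L by (auto simp: orthogonal_def span_eq_iff[THEN iffD2])
  show "\<And>y. y \<in> L \<Longrightarrow> (\<And>z. z \<in> L \<Longrightarrow> (x - y) \<bullet> z = 0) \<Longrightarrow> closest_point L x = y" by (rule uniq)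
qed

lemma linear_closest_point:
  fixes L :: "'a::euclidean_space set"
  assumes L: "subspace L" shows "linear (closest_point L)"
proof (rule linearI)
  note P = closest_point_subspace[OF L]
  show "closest_point L (x + y) = closest_point L x + closest_point L y" for x y
  proof (rule P(3))
    show "closest_point L x + closest_point L y \<in> L" using P(1) L by (simp add: subspace_add)
    fix z assume "z \<in> L"
    then show "(x + y - (closest_point L x + closest_point L y)) \<bullet> z = 0"
      using P(2)[of z x] P(2)[of z y] by (simp add: algebra_simps inner_diff_left inner_add_left)
  qed
  show "closest_point L (c *\<^sub>R x) = c *\<^sub>R closest_point L x" for c x
  proof (rule P(3))
    show "c *\<^sub>R closest_point L x \<in> L" using P(1) L by (simp add: subspace_scale)
    fix z assume "z \<in> L"
    then show "(c *\<^sub>R x - c *\<^sub>R closest_point L x) \<bullet> z = 0"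
      using P(2)[of z x] by (simp add: inner_diff_left)
  qed
qed

lemma closest_point_subspace_norm:
  fixes L :: "'a::euclidean_space set"
  assumes L: "subspace L"
  shows "norm (closest_point L x) \<le> norm x" "norm (x - closest_point L x) \<le> norm x"
proof -
  note P = closest_point_subspace[OF L]
  have "norm x ^ 2 = norm (x - closest_point L x) ^ 2 + norm (closest_point L x) ^ 2"
    using norm_add_Pythagorean[of "x - closest_point L x" "closest_point L x"] P(1,2)
    by (simp add: orthogonal_def)
  then have "norm (closest_point L x) ^ 2 \<le> norm x ^ 2" "norm (x - closest_point L x) ^ 2 \<le> norm x ^ 2" by simp_all
  then show "norm (closest_point L x) \<le> norm x" "norm (x - closest_point L x) \<le> norm x"
    by (auto intro: power2_le_imp_le)
qed

text \<open>With P, Q the projections onto L, L' and z = x - P x, one has P x - Q x = (P x - Q P x)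
  - Q z. The first term is bounded by the gap from L to L'. As z is orthogonal to L, |Q z|^2 = <Q z
  - P Q z, z> \<le> d |Q z| |z|, which uses the gap in the other direction.\<close>

lemma closest_point_gap:
  fixes L L' :: "'a::euclidean_space set"
  assumes L: "subspace L" "subspace L'" and "0 \<le> d"
    and gap: "\<And>y. y \<in> L \<Longrightarrow> norm (y - closest_point L' y) \<le> d * norm y"
      "\<And>y. y \<in> L' \<Longrightarrow> norm (y - closest_point L y) \<le> d * norm y"
  shows "norm (closest_point L x - closest_point L' x) \<le> 2 * d * norm x"
proof -
  let ?P = "closest_point L" and ?Q = "closest_point L'"
  note P = closest_point_subspace[OF L(1)] and Q = closest_point_subspace[OF L(2)]
  define z where "z = x - ?P x"
  have "?Q z \<bullet> ?Q z = ?Q z \<bullet> z" using Q(2)[of "?Q z" z] Q(1) by (simp add: inner_diff_left inner_commute[of z])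
  also have "\<dots> = (?Q z - ?P (?Q z)) \<bullet> z"
    using P(2)[of "?P (?Q z)" x] P(1) by (simp add: z_def inner_diff_left inner_diff_right inner_commute)
  also have "\<dots> \<le> norm (?Q z - ?P (?Q z)) * norm z" by (rule norm_cauchy_schwarz)
  also have "\<dots> \<le> d * norm (?Q z) * norm z" using gap(2)[OF Q(1)] by (intro mult_right_mono) auto
  finally have *: "norm (?Q z) * norm (?Q z) \<le> norm (?Q z) * (d * norm z)"
    by (simp add: power2_norm_eq_inner[symmetric] power2_eq_square mult_ac)
  have "norm (?Q z) \<le> d * norm z"
  proof (cases "norm (?Q z) = 0")
    case True then show ?thesis using \<open>0 \<le> d\<close> by simp
  next
    case False
    then have "0 < norm (?Q z)" by simp
    with * show ?thesis using mult_le_cancel_left_pos by blast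
  qed
  also have "\<dots> \<le> d * norm x"
    unfolding z_def using \<open>0 \<le> d\<close> by (intro mult_left_mono closest_point_subspace_norm L)
  finally have 1: "norm (?Q z) \<le> d * norm x" .
  have "norm (?P x - ?Q (?P x)) \<le> d * norm (?P x)" by (rule gap(1)[OF P(1)])
  also have "\<dots> \<le> d * norm x"
    using \<open>0 \<le> d\<close> by (intro mult_left_mono closest_point_subspace_norm L)
  finally have 2: "norm (?P x - ?Q (?P x)) \<le> d * norm x" .
  have eq: "?P x - ?Q x = (?P x - ?Q (?P x)) - ?Q z"
    by (simp add: z_def linear_diff[OF linear_closest_point[OF L(2)]])
  have "norm (?P x - ?Q x) \<le> norm (?P x - ?Q (?P x)) + norm (?Q z)"
    unfolding eq by (rule norm_triangle_ineq4)
  with 1 2 show ?thesis by simp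
qed

lemma span_pair: "x \<in> span {v, w} \<longleftrightarrow> (\<exists>\<alpha> \<beta>. x = \<alpha> *\<^sub>R v + \<beta> *\<^sub>R w)" for v :: "'a::real_vector"
proof -
  have "x - \<alpha> *\<^sub>R v = \<beta> *\<^sub>R w \<longleftrightarrow> x = \<alpha> *\<^sub>R v + \<beta> *\<^sub>R w" for \<alpha> \<beta> by (auto simp: algebra_simps)
  then show ?thesis by (simp add: span_breakdown_eq span_singleton image_iff)
qed

text \<open>Quantitative linear independence: the coefficients of a combination are controlled by
  its norm.\<close>

definition pivoted :: "real \<Rightarrow> 'a::real_normed_vector \<Rightarrow> 'a \<Rightarrow> bool" where
  "pivoted K v w \<longleftrightarrow> (\<forall>\<alpha> \<beta>. \<bar>\<alpha>\<bar> \<le> K * norm (\<alpha> *\<^sub>R v + \<beta> *\<^sub>R w) \<and> \<bar>\<beta>\<bar> \<le> K * norm (\<alpha> *\<^sub>R v + \<beta> *\<^sub>R w))"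

text \<open>Compare \<alpha> v + \<beta> w with \<alpha> v' + \<beta> w' in the other plane;
  \<open>pivoted\<close> bounds the coefficients, so both gaps are at most K (|v - v'| + |w -
  w'|).\<close>

lemma closest_point_span_Lipschitz:
  fixes v w v' w' :: "'a::euclidean_space"
  assumes "pivoted K v w" "pivoted K v' w'" "0 \<le> K"
  shows "norm (closest_point (span {v, w}) x - closest_point (span {v', w'}) x)
    \<le> 2 * (K * (norm (v - v') + norm (w - w'))) * norm x"
proof (rule closest_point_gap)
  have half: "norm (y - closest_point (span {v', w'}) y) \<le> K * (norm (v - v') + norm (w - w')) * norm y"
    if piv: "pivoted K v w" and y: "y \<in> span {v, w}" for y v w v' w' :: 'a
  proof -
    obtain \<alpha> \<beta> where ab: "y = \<alpha> *\<^sub>R v + \<beta> *\<^sub>R w" using y by (auto simp: span_pair)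
    then have le: "\<bar>\<alpha>\<bar> \<le> K * norm y" "\<bar>\<beta>\<bar> \<le> K * norm y" using piv by (auto simp: pivoted_def)
    have "norm (y - closest_point (span {v', w'}) y) \<le> norm (y - (\<alpha> *\<^sub>R v' + \<beta> *\<^sub>R w'))"
      using closest_point_le[of "span {v', w'}" "\<alpha> *\<^sub>R v' + \<beta> *\<^sub>R w'" y] by (auto simp: dist_norm span_pair)
    also have "y - (\<alpha> *\<^sub>R v' + \<beta> *\<^sub>R w') = \<alpha> *\<^sub>R (v - v') + \<beta> *\<^sub>R (w - w')" by (simp add: ab algebra_simps)
    also have "norm \<dots> \<le> \<bar>\<alpha>\<bar> * norm (v - v') + \<bar>\<beta>\<bar> * norm (w - w')"
      using norm_triangle_ineq[of "\<alpha> *\<^sub>R (v - v')" "\<beta> *\<^sub>R (w - w')"] by simp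
    also have "\<dots> \<le> K * norm y * norm (v - v') + K * norm y * norm (w - w')"
      using le by (intro add_mono mult_right_mono) auto
    finally show ?thesis by (simp add: algebra_simps)
  qed
  show "norm (y - closest_point (span {v', w'}) y) \<le> K * (norm (v - v') + norm (w - w')) * norm y"
    if "y \<in> span {v, w}" for y by (rule half[OF assms(1) that])
  show "norm (y - closest_point (span {v, w}) y) \<le> K * (norm (v - v') + norm (w - w')) * norm y"
    if "y \<in> span {v', w'}" for y using half[OF assms(2) that, of v w] by (simp add: norm_minus_commute)
qed (use assms(3) in auto)

text \<open>The converse direction: the plane determines v as its vector with coordinates 1 and 0
  along a and c. The projection of v to the other plane is \<alpha> v' + \<beta> w', and the inner
  products with a and c show that (\<alpha>, \<beta>) is within \<eta> of (1, 0) in each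
  entry.\<close>

lemma normalised_basis_Lipschitz:
  fixes v w v' w' a c :: "'a::euclidean_space"
  assumes ac: "norm a = 1" "norm c = 1"
    and n: "v \<bullet> a = 1" "v \<bullet> c = 0" "v' \<bullet> a = 1" "v' \<bullet> c = 0" "w' \<bullet> a = 0" "w' \<bullet> c = 1"
    and close: "norm (closest_point (span {v, w}) v - closest_point (span {v', w'}) v) \<le> \<eta>"
  shows "norm (v - v') \<le> \<eta> * (1 + norm v' + norm w')"
proof -
  let ?q = "closest_point (span {v', w'}) v"
  have "closest_point (span {v, w}) v = v" by (rule closest_point_self) (simp add: span_base)
  then have q: "norm (v - ?q) \<le> \<eta>" using close by simp
  have "?q \<in> span {v', w'}" by (rule closest_point_subspace) simp
  then obtain \<alpha> \<beta> where ab: "?q = \<alpha> *\<^sub>R v' + \<beta> *\<^sub>R w'" by (auto simp: span_pair)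
  have "\<alpha> - 1 = - ((v - ?q) \<bullet> a)" unfolding ab using n by (simp add: inner_diff_left inner_add_left)
  then have 1: "\<bar>\<alpha> - 1\<bar> \<le> \<eta>" using Cauchy_Schwarz_ineq2[of "v - ?q" a] ac q by simp
  have "\<beta> = - ((v - ?q) \<bullet> c)" unfolding ab using n by (simp add: inner_diff_left inner_add_left)
  then have 2: "\<bar>\<beta>\<bar> \<le> \<eta>" using Cauchy_Schwarz_ineq2[of "v - ?q" c] ac q by simp
  have eq: "v - v' = (v - ?q) + ((\<alpha> - 1) *\<^sub>R v' + \<beta> *\<^sub>R w')" unfolding ab by (simp add: algebra_simps)
  have "norm (v - v') \<le> norm (v - ?q) + norm ((\<alpha> - 1) *\<^sub>R v' + \<beta> *\<^sub>R w')"
    unfolding eq by (rule norm_triangle_ineq)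
  also have "norm ((\<alpha> - 1) *\<^sub>R v' + \<beta> *\<^sub>R w') \<le> \<bar>\<alpha> - 1\<bar> * norm v' + \<bar>\<beta>\<bar> * norm w'"
    using norm_triangle_ineq[of "(\<alpha> - 1) *\<^sub>R v'" "\<beta> *\<^sub>R w'"] by simp
  finally have "norm (v - v') \<le> norm (v - ?q) + (\<bar>\<alpha> - 1\<bar> * norm v' + \<bar>\<beta>\<bar> * norm w')" by simp
  also have "\<dots> \<le> \<eta> + (\<eta> * norm v' + \<eta> * norm w')"
    using q 1 2 by (intro add_mono mult_right_mono) auto
  finally show ?thesis by (simp add: algebra_simps)
qed

lemma norm_matrix_diff_le:
  fixes f g :: "real ^ 'n \<Rightarrow> real ^ 'm"
  assumes "\<And>x. norm (f x - g x) \<le> c * norm x"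
  shows "norm (matrix f - matrix g) \<le> real CARD('m) * real CARD('n) * c"
proof -
  have e: "\<bar>(matrix f - matrix g) $ i $ j\<bar> \<le> c" for i j
  proof -
    have "\<bar>(matrix f - matrix g) $ i $ j\<bar> = \<bar>(f (axis j 1) - g (axis j 1)) $ i\<bar>" by (simp add: matrix_def)
    also have "\<dots> \<le> norm (f (axis j 1) - g (axis j 1))" by (rule component_le_norm_cart)
    also have "\<dots> \<le> c" using assms[of "axis j 1"] by (simp add: norm_axis_1)
    finally show ?thesis .
  qed
  have "norm (matrix f - matrix g) \<le> (\<Sum>i\<in>UNIV. norm ((matrix f - matrix g) $ i))"
    unfolding norm_vec_def[of "matrix f - matrix g"] by (rule L2_set_le_sum) simp
  also have "\<dots> \<le> (\<Sum>i\<in>(UNIV :: 'm set). \<Sum>j\<in>(UNIV :: 'n set). c)"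
  proof (rule sum_mono)
    fix i
    show "norm ((matrix f - matrix g) $ i) \<le> (\<Sum>j\<in>(UNIV :: 'n set). c)"
      by (rule order.trans[OF norm_le_l1_cart]) (intro sum_mono e)
  qed
  finally show ?thesis by simp
qed

lemma norm_diff_le_matrix:
  fixes f g :: "real ^ 'n \<Rightarrow> real ^ 'm"
  assumes "linear f" "linear g"
  shows "norm (f x - g x) \<le> real CARD('m) * norm (matrix f - matrix g) * norm x"
proof -
  let ?A = "matrix f - matrix g"
  have "f x - g x = ?A *v x"
    using assms by (simp add: matrix_vector_mult_diff_rdistrib matrix_works linear_linear)
  moreover have "norm (?A *v x) \<le> (\<Sum>i\<in>(UNIV :: 'm set). norm ?A * norm x)"
  proof (intro order.trans[OF norm_le_l1_cart] sum_mono)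
    fix i
    have "\<bar>(?A *v x) $ i\<bar> \<le> norm (?A $ i) * norm x"
      by (metis matrix_vector_mul_component Cauchy_Schwarz_ineq2)
    also have "\<dots> \<le> norm ?A * norm x" by (intro mult_right_mono Finite_Cartesian_Product.norm_nth_le) auto
    finally show "\<bar>(?A *v x) $ i\<bar> \<le> norm ?A * norm x" .
  qed
  ultimately show ?thesis by simp
qed

section \<open>Volumes of the Grassmannian and of the codimension one Schubert variety\<close>

definition orthonormal_frame :: "(4 \<Rightarrow> real ^ 4) \<Rightarrow> bool" where
  "orthonormal_frame u \<longleftrightarrow> (\<forall>i j. u i \<bullet> u j = (if i = j then 1 else 0))"

lemma orthonormal_frame_expand:
  assumes u: "orthonormal_frame u"
  shows "(\<Sum>i\<in>UNIV. (x \<bullet> u i) *\<^sub>R u i) = x"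
proof -
  have ij: "u i \<bullet> u j = (if i = j then 1 else 0)" for i j using u by (simp add: orthonormal_frame_def)
  have inj: "inj u"
    by (rule injI) (metis ij zero_neq_one)
  have "pairwise orthogonal (range u)"
    by (auto simp: pairwise_def orthogonal_def ij)
  moreover have "0 \<notin> range u"
  proof
    assume "0 \<in> range u"
    then obtain i where "u i = 0" by auto
    then show False using ij[of i i] by simp
  qed
  ultimately have ind: "independent (range u)" by (rule pairwise_orthogonal_independent)
  have "card (range u) = DIM(real ^ 4)" using inj by (simp add: card_image)
  then have "span (range u) = UNIV"
    using card_ge_dim_independent[of "range u" UNIV] ind by (auto simp: dim_UNIV)
  define y where "y = x - (\<Sum>i\<in>UNIV. (x \<bullet> u i) *\<^sub>R u i)"
  have "y \<bullet> u j = 0" for j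
  proof -
    have "(\<Sum>i\<in>UNIV. (x \<bullet> u i) *\<^sub>R u i) \<bullet> u j = (\<Sum>i\<in>UNIV. if i = j then x \<bullet> u j else 0)"
      unfolding inner_sum_left by (intro sum.cong) (auto simp: ij)
    then show ?thesis by (simp add: y_def inner_diff_left)
  qed
  then have "orthogonal y z" if "z \<in> span (range u)" for z
    by (intro orthogonal_to_span[OF that]) (auto simp: orthogonal_def)
  then have "orthogonal y y" using \<open>span (range u) = UNIV\<close> by blast
  then show ?thesis by (simp add: orthogonal_def y_def)
qed

lemma orthonormal_frame_exists:
  assumes "subspace S" "dim S = 2"
  obtains u :: "4 \<Rightarrow> real ^ 4" where "orthonormal_frame u" "S = span {u 1, u 2}"
proof -
  obtain B where B: "B \<subseteq> S" "pairwise orthogonal B" "\<And>x. x \<in> B \<Longrightarrow> norm x = 1"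
    "independent B" "card B = dim S" "span B = S"
    using orthonormal_basis_subspace[OF assms(1)] by metis
  then obtain a b where ab: "B = {a, b}" "a \<noteq> b" using assms(2) by (metis card_2_iff)
  have ext: "\<exists>c. norm c = 1 \<and> (\<forall>x\<in>T. c \<bullet> x = 0)" if "finite T" "card T < 4" for T :: "(real ^ 4) set"
  proof -
    have "dim T < DIM(real ^ 4)" using dim_le_card'[OF that(1)] that(2) by simp
    then obtain x where x: "x \<noteq> 0" "\<And>y. y \<in> span T \<Longrightarrow> orthogonal x y"
      using orthogonal_to_subspace_exists[of T] by blast
    have "x \<bullet> y = 0" if "y \<in> T" for y using x(2)[OF span_base[OF that]] by (simp add: orthogonal_def)
    with x(1) show ?thesis by (intro exI[of _ "x /\<^sub>R norm x"]) auto
  qed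
  have "card {a, b} < 4" by (simp add: card_insert_if)
  then obtain c where c: "norm c = 1" "c \<bullet> a = 0" "c \<bullet> b = 0"
    using ext[of "{a, b}"] by auto
  have "card {a, b, c} < 4" by (simp add: card_insert_if)
  then obtain d where d: "norm d = 1" "d \<bullet> a = 0" "d \<bullet> b = 0" "d \<bullet> c = 0"
    using ext[of "{a, b, c}"] by auto
  define u :: "4 \<Rightarrow> real ^ 4" where "u i = (if i = 1 then a else if i = 2 then b else if i = 3 then c else d)" for i
  have n: "norm a = 1" "norm b = 1" "a \<bullet> b = 0"
    using B(2,3) ab by (auto simp: pairwise_def orthogonal_def)
  have "orthonormal_frame u"
    unfolding orthonormal_frame_def forall_4 u_def
    using n c d by (simp add: norm_eq_1 inner_commute)
  moreover have "S = span {u 1, u 2}" using B(6) ab by (simp add: u_def)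
  ultimately show ?thesis by (rule that)
qed

text \<open>The constant is 64 = 16 * 4: sixteen matrix entries, and a factor 2 each from the
  projection bound and from the two basis vectors. The factor 1 / sqrt 2 is estimated by 1.\<close>

lemma Gr_embed_Lipschitz:
  fixes v w v' w' :: "real ^ 4"
  assumes r: "r > 0" and K: "0 \<le> K"
    and piv: "pivoted K v w" "pivoted K v' w'"
    and vw: "norm (v - v') \<le> M * d" "norm (w - w') \<le> M * d"
  shows "dist (Gr_embed r (span {v, w})) (Gr_embed r (span {v', w'})) \<le> r * (64 * K * M) * d"
proof -
  let ?P = "closest_point (span {v, w})" and ?Q = "closest_point (span {v', w'})"
  have "norm (?P x - ?Q x) \<le> (4 * K * M * d) * norm x" for x
  proof -
    have "norm (?P x - ?Q x) \<le> 2 * (K * (norm (v - v') + norm (w - w'))) * norm x"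
      by (rule closest_point_span_Lipschitz[OF piv K])
    also have "\<dots> \<le> 2 * (K * (M * d + M * d)) * norm x"
      using vw K by (intro mult_right_mono mult_left_mono add_mono) auto
    finally show ?thesis by (simp add: algebra_simps)
  qed
  then have "norm (matrix ?P - matrix ?Q) \<le> real CARD(4) * real CARD(4) * (4 * K * M * d)"
    by (rule norm_matrix_diff_le)
  then have m: "norm (matrix ?P - matrix ?Q) \<le> 64 * K * M * d" by simp
  have "dist (Gr_embed r (span {v, w})) (Gr_embed r (span {v', w'})) = r / sqrt 2 * norm (matrix ?P - matrix ?Q)"
    using r by (simp add: Gr_embed_def dist_norm flip: scaleR_diff_right)
  also have "\<dots> \<le> r * norm (matrix ?P - matrix ?Q)"
    using r by (intro mult_right_mono) (auto simp: field_simps)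
  also have "\<dots> \<le> r * (64 * K * M * d)" using r m by (intro mult_left_mono) auto
  finally show ?thesis by (simp add: mult.assoc)
qed

text \<open>The distance D of the embedded planes bounds the difference of the projections on
  vectors of norm at most K by 4 (sqrt 2 / r) D K; \<open>normalised_basis_Lipschitz\<close>
  converts this into a bound for the bases, applied once more with the two vectors
  interchanged.\<close>

lemma Gr_embed_expand:
  assumes r: "r > 0" and ac: "norm a = 1" "norm c = 1"
    and n: "v \<bullet> a = 1" "v \<bullet> c = 0" "v' \<bullet> a = 1" "v' \<bullet> c = 0" "w \<bullet> a = 0" "w \<bullet> c = 1" "w' \<bullet> a = 0" "w' \<bullet> c = 1"
    and K: "norm v \<le> K" "norm w \<le> K" "norm v' \<le> K" "norm w' \<le> K"
  defines "D \<equiv> dist (Gr_embed r (span {v, w})) (Gr_embed r (span {v', w'}))"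
  shows "norm (v - v') \<le> 4 * sqrt 2 / r * K * (1 + 2 * K) * D"
    and "norm (w - w') \<le> 4 * sqrt 2 / r * K * (1 + 2 * K) * D"
proof -
  let ?P = "closest_point (span {v, w})" and ?Q = "closest_point (span {v', w'})"
  have K0: "0 \<le> K" using K(1) norm_ge_zero order.trans by blast
  have D: "D = r / sqrt 2 * norm (matrix ?P - matrix ?Q)"
    using r by (simp add: D_def Gr_embed_def dist_norm flip: scaleR_diff_right)
  then have m: "norm (matrix ?P - matrix ?Q) = sqrt 2 / r * D" using r by (simp add: field_simps)
  have D0: "D \<ge> 0" by (simp add: D_def)
  define \<eta> where "\<eta> = 4 * (sqrt 2 / r * D) * K"
  have \<eta>0: "\<eta> \<ge> 0" using D0 r K0 by (simp add: \<eta>_def)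
  have \<eta>: "norm (?P x - ?Q x) \<le> \<eta>" if "norm x \<le> K" for x
  proof -
    have "norm (?P x - ?Q x) \<le> real CARD(4) * norm (matrix ?P - matrix ?Q) * norm x"
      by (rule norm_diff_le_matrix) (simp_all add: linear_closest_point)
    also have "\<dots> \<le> real CARD(4) * norm (matrix ?P - matrix ?Q) * K" using that by (intro mult_left_mono) auto
    finally show ?thesis by (simp add: m \<eta>_def)
  qed
  have fin: "\<eta> * (1 + norm v' + norm w') \<le> 4 * sqrt 2 / r * K * (1 + 2 * K) * D"
  proof -
    have "\<eta> * (1 + norm v' + norm w') \<le> \<eta> * (1 + 2 * K)" using K \<eta>0 by (intro mult_left_mono) auto
    also have "\<dots> = 4 * sqrt 2 / r * K * (1 + 2 * K) * D" by (simp add: \<eta>_def)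
    finally show ?thesis .
  qed
  have "norm (v - v') \<le> \<eta> * (1 + norm v' + norm w')"
    by (rule normalised_basis_Lipschitz[OF ac n(1,2,3,4,7,8) \<eta>[OF K(1)]])
  with fin show "norm (v - v') \<le> 4 * sqrt 2 / r * K * (1 + 2 * K) * D" by linarith
  have "norm (w - w') \<le> \<eta> * (1 + norm w' + norm v')"
    using \<eta>[OF K(2)]
    by (intro normalised_basis_Lipschitz[where w = v and v = w and v' = w' and w' = v',
          OF ac(2,1) n(6,5,8,7,4,3)]) (simp add: insert_commute)
  with fin show "norm (w - w') \<le> 4 * sqrt 2 / r * K * (1 + 2 * K) * D" by (simp add: add_ac)
qed

lemma pivotedI:
  fixes v w :: "'a::real_inner"
  assumes "norm a = 1" "norm c = 1" "v \<bullet> a = 1" "v \<bullet> c = 0" "w \<bullet> a = 0" "w \<bullet> c = 1"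
  shows "pivoted 1 v w"
  unfolding pivoted_def
proof (intro allI conjI)
  fix \<alpha> \<beta>
  have "\<alpha> = (\<alpha> *\<^sub>R v + \<beta> *\<^sub>R w) \<bullet> a" "\<beta> = (\<alpha> *\<^sub>R v + \<beta> *\<^sub>R w) \<bullet> c"
    using assms by (simp_all add: inner_add_left)
  then show "\<bar>\<alpha>\<bar> \<le> 1 * norm (\<alpha> *\<^sub>R v + \<beta> *\<^sub>R w)" "\<bar>\<beta>\<bar> \<le> 1 * norm (\<alpha> *\<^sub>R v + \<beta> *\<^sub>R w)"
    using Cauchy_Schwarz_ineq2[of "\<alpha> *\<^sub>R v + \<beta> *\<^sub>R w" a] Cauchy_Schwarz_ineq2[of "\<alpha> *\<^sub>R v + \<beta> *\<^sub>R w" c] assms(1,2)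
    by simp_all
qed

lemma pivoted_mono: "pivoted K v w \<Longrightarrow> K \<le> K' \<Longrightarrow> pivoted K' v w"
  unfolding pivoted_def by (meson mult_right_mono norm_ge_zero order.trans)

section \<open>Charts of planes by normalised bases\<close>

text \<open>The affine chart whose planes are graphs of linear maps from the span of u_i, u_j to the
  span of u_k, u_l.\<close>

definition chart4 :: "(4 \<Rightarrow> real ^ 4) \<Rightarrow> 4 \<times> 4 \<times> 4 \<times> 4 \<Rightarrow> real ^ 4 \<Rightarrow> (real ^ 4) set" where
  "chart4 u = (\<lambda>(i, j, k, l) p. span {u i + p $ 1 *\<^sub>R u k + p $ 2 *\<^sub>R u l, u j + p $ 3 *\<^sub>R u k + p $ 4 *\<^sub>R u l})"

text \<open>For {i, j} = {1, 2} the first vector lies in the fixed plane of the Schubert condition,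
  and the second has its pivot at an index k outside {i, j}. Pivot j is left to
  \<open>chart3'\<close>. The other index tuples only enlarge a cover.\<close>

definition chart3 :: "(4 \<Rightarrow> real ^ 4) \<Rightarrow> 4 \<times> 4 \<times> 4 \<times> 4 \<Rightarrow> real ^ 3 \<Rightarrow> (real ^ 4) set" where
  "chart3 u = (\<lambda>(i, j, k, l) p. span {u i + p $ 1 *\<^sub>R u j, u k + p $ 2 *\<^sub>R u j + p $ 3 *\<^sub>R u l})"

definition chart3' :: "(4 \<Rightarrow> real ^ 4) \<Rightarrow> 4 \<times> 4 \<times> 4 \<times> 4 \<Rightarrow> real ^ 3 \<Rightarrow> (real ^ 4) set" where
  "chart3' u = (\<lambda>(i, j, k, l) p. span {u i + p $ 1 *\<^sub>R u j, u j + p $ 2 *\<^sub>R u k + p $ 3 *\<^sub>R u l})"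

lemma norm_combination_le:
  assumes "norm u = 1" "norm w = 1"
  shows "norm (\<alpha> *\<^sub>R u + \<beta> *\<^sub>R w) \<le> \<bar>\<alpha>\<bar> + \<bar>\<beta>\<bar>"
  using norm_triangle_ineq[of "\<alpha> *\<^sub>R u" "\<beta> *\<^sub>R w"] assms by simp

lemma frame_norm: "orthonormal_frame u \<Longrightarrow> norm (u i) = 1"
  by (simp add: orthonormal_frame_def norm_eq_1)

lemma frame_inner: "orthonormal_frame u \<Longrightarrow> u i \<bullet> u j = (if i = j then 1 else 0)"
  by (simp add: orthonormal_frame_def)

lemma combination_Lipschitz:
  fixes p q :: "real ^ 'n"
  assumes u: "orthonormal_frame u"
  shows "norm ((x + p $ a *\<^sub>R u k + p $ b *\<^sub>R u l) - (x + q $ a *\<^sub>R u k + q $ b *\<^sub>R u l)) \<le> 2 * norm (p - q)"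
    and "norm ((x + p $ a *\<^sub>R u k) - (x + q $ a *\<^sub>R u k)) \<le> 2 * norm (p - q)"
proof -
  have c: "\<bar>p $ i - q $ i\<bar> \<le> norm (p - q)" for i using component_le_norm_cart[of "p - q" i] by simp
  have "(x + p $ a *\<^sub>R u k + p $ b *\<^sub>R u l) - (x + q $ a *\<^sub>R u k + q $ b *\<^sub>R u l)
      = (p $ a - q $ a) *\<^sub>R u k + (p $ b - q $ b) *\<^sub>R u l" by (simp add: algebra_simps)
  then show "norm ((x + p $ a *\<^sub>R u k + p $ b *\<^sub>R u l) - (x + q $ a *\<^sub>R u k + q $ b *\<^sub>R u l)) \<le> 2 * norm (p - q)"
    using norm_combination_le[of "u k" "u l" "p $ a - q $ a" "p $ b - q $ b"] frame_norm[OF u] c[of a] c[of b]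
    by simp
  have "(x + p $ a *\<^sub>R u k) - (x + q $ a *\<^sub>R u k) = (p $ a - q $ a) *\<^sub>R u k" by (simp add: algebra_simps)
  then show "norm ((x + p $ a *\<^sub>R u k) - (x + q $ a *\<^sub>R u k)) \<le> 2 * norm (p - q)"
    using frame_norm[OF u] c[of a] norm_ge_zero[of "p - q"] by (simp del: norm_ge_zero)
qed

definition tuples :: "(4 \<times> 4 \<times> 4 \<times> 4) set" where
  "tuples = {(i, j, k, l). distinct [i, j, k, l]}"

lemma tuple_extend:
  assumes "i \<noteq> (j :: 4)" obtains k l where "(i, j, k, l) \<in> tuples"
proof -
  have "card {i, j} < card (UNIV :: 4 set)" using card_insert_le_m1[of 2 "{j}" i] by (simp add: card_insert_if)
  then obtain k where k: "k \<notin> {i, j}" by (metis UNIV_I less_irrefl subset_antisym subsetI)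
  have "card {i, j, k} < card (UNIV :: 4 set)" by (simp add: card_insert_if)
  then obtain l where l: "l \<notin> {i, j, k}" by (metis UNIV_I less_irrefl subset_antisym subsetI)
  show ?thesis using that[of k l] assms k l by (auto simp: tuples_def)
qed

lemma tuple_expand:
  assumes u: "orthonormal_frame u" and t: "(i, j, k, l) \<in> tuples"
  shows "(x \<bullet> u i) *\<^sub>R u i + (x \<bullet> u j) *\<^sub>R u j + (x \<bullet> u k) *\<^sub>R u k + (x \<bullet> u l) *\<^sub>R u l = x"
proof -
  have d: "distinct [i, j, k, l]" using t by (simp add: tuples_def)
  then have "card {i, j, k, l} = card (UNIV :: 4 set)" by simp
  then have "{i, j, k, l} = UNIV" by (intro card_subset_eq) auto
  then have "(\<Sum>m\<in>{i, j, k, l}. (x \<bullet> u m) *\<^sub>R u m) = x" using orthonormal_frame_expand[OF u, of x] by simp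
  then show ?thesis using d by (simp add: add.assoc)
qed

lemma pivoted_dim:
  fixes v w :: "'a::euclidean_space"
  assumes "pivoted K v w" shows "dim (span {v, w}) = 2"
proof -
  have w: "w \<noteq> 0" using assms[unfolded pivoted_def, rule_format, of 0 1] by auto
  have v: "v \<notin> span {w}"
  proof
    assume "v \<in> span {w}"
    then obtain \<beta> where "v = \<beta> *\<^sub>R w" by (auto simp: span_singleton)
    then have "norm (1 *\<^sub>R v + (- \<beta>) *\<^sub>R w) = 0" by simp
    then show False using assms[unfolded pivoted_def, rule_format, of 1 "- \<beta>"] by simp
  qed
  then have "v \<noteq> w" using span_base[of w "{w}"] by auto
  have "independent {v, w}" using v w \<open>v \<noteq> w\<close> by (simp add: independent_insert)
  then have "dim {v, w} = card {v, w}" by (rule dim_eq_card_independent)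
  then show ?thesis using \<open>v \<noteq> w\<close> by simp
qed

lemma finite_max_abs:
  fixes f :: "'i::finite \<Rightarrow> real"
  obtains i where "\<And>j. \<bar>f j\<bar> \<le> \<bar>f i\<bar>"
proof -
  have "Max (range (\<lambda>i. \<bar>f i\<bar>)) \<in> range (\<lambda>i. \<bar>f i\<bar>)" by (intro Max_in) auto
  then obtain i where i: "Max (range (\<lambda>i. \<bar>f i\<bar>)) = \<bar>f i\<bar>" by (rule imageE)
  have "\<bar>f j\<bar> \<le> \<bar>f i\<bar>" for j unfolding i[symmetric] by (intro Max_ge) auto
  then show ?thesis by (rule that)
qed

text \<open>The two coordinates are those of a maximal Pluecker coordinate of the plane.\<close>

lemma Gr22_normal_form:
  assumes u: "orthonormal_frame u" and L: "L \<in> Gr22"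
  obtains i j v w where "i \<noteq> j" "L = span {v, w}" "v \<bullet> u i = 1" "v \<bullet> u j = 0" "w \<bullet> u i = 0" "w \<bullet> u j = 1"
    "\<And>k. \<bar>v \<bullet> u k\<bar> \<le> 1" "\<And>k. \<bar>w \<bullet> u k\<bar> \<le> 1"
proof -
  have sub: "subspace L" "dim L = 2" using L by (auto simp: Gr22_def)
  obtain B where B: "B \<subseteq> L" "independent B" "L \<subseteq> span B" "card B = dim L" using basis_exists[of L] by metis
  then obtain x y where xy: "B = {x, y}" "x \<noteq> y" using sub(2) by (metis card_2_iff)
  have Lspan: "L = span {x, y}" using B sub(1) xy by (metis span_minimal subset_antisym)
  \<comment> \<open>These 2 x 2 minors are the Pluecker coordinates of the plane.\<close>
  define m where "m p = (x \<bullet> u (fst p)) * (y \<bullet> u (snd p)) - (x \<bullet> u (snd p)) * (y \<bullet> u (fst p))" for p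
  obtain ij where ij: "\<And>kl. \<bar>m kl\<bar> \<le> \<bar>m ij\<bar>" using finite_max_abs[of m] by blast
  obtain i j where ij_eq: "ij = (i, j)" by (cases ij)
  define d where "d = m ij"
  have "d \<noteq> 0"
  proof
    assume "d = 0"
    then have m0: "m kl = 0" for kl using ij[of kl] by (simp add: d_def)
    have "x \<noteq> 0" using B(2) xy dependent_zero[of B] by auto
    moreover have "x = 0" if "\<And>k. x \<bullet> u k = 0"
      using orthonormal_frame_expand[OF u, of x] that by simp
    ultimately obtain k where k: "x \<bullet> u k \<noteq> 0" by blast
    define c where "c = (y \<bullet> u k) / (x \<bullet> u k)"
    have c: "y \<bullet> u l = c * (x \<bullet> u l)" for l
      using m0[of "(k, l)"] k by (simp add: m_def c_def nonzero_eq_divide_eq mult_ac)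
    have "(\<Sum>l\<in>UNIV. (y \<bullet> u l) *\<^sub>R u l) = c *\<^sub>R (\<Sum>l\<in>UNIV. (x \<bullet> u l) *\<^sub>R u l)"
      unfolding scaleR_sum_right scaleR_scaleR c ..
    then have "y = c *\<^sub>R x" by (simp only: orthonormal_frame_expand[OF u])
    then have "y \<in> span {x}" unfolding span_singleton by blast
    then show False using B(2) xy by (simp add: insert_commute[of x y] independent_insert)
  qed
  \<comment> \<open>Cramer's rule: this basis has the identity matrix as its coordinates i, j. Its
    remaining coordinates are ratios of Pluecker coordinates to the maximal one, hence bounded by
    1.\<close>
  define v where "v = (1 / d) *\<^sub>R ((y \<bullet> u j) *\<^sub>R x - (x \<bullet> u j) *\<^sub>R y)"
  define w where "w = (1 / d) *\<^sub>R ((x \<bullet> u i) *\<^sub>R y - (y \<bullet> u i) *\<^sub>R x)"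
  have d: "d = (x \<bullet> u i) * (y \<bullet> u j) - (x \<bullet> u j) * (y \<bullet> u i)" by (simp add: d_def m_def ij_eq)
  have vk: "v \<bullet> u k = m (k, j) / d" and wk: "w \<bullet> u k = m (i, k) / d" for k
    by (simp_all add: v_def w_def m_def inner_diff_left mult_ac)
  show ?thesis
  proof (rule that[of i j v w])
    show "i \<noteq> j" using \<open>d \<noteq> 0\<close> by (auto simp: d)
    show "v \<bullet> u i = 1" "v \<bullet> u j = 0" "w \<bullet> u i = 0" "w \<bullet> u j = 1"
      unfolding vk wk using \<open>d \<noteq> 0\<close> by (simp_all add: m_def d)
    show "\<bar>v \<bullet> u k\<bar> \<le> 1" "\<bar>w \<bullet> u k\<bar> \<le> 1" for k
      unfolding vk wk using ij[of "(k, j)"] ij[of "(i, k)"] \<open>d \<noteq> 0\<close> by (simp_all add: d_def divide_le_eq)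
    have "x = (x \<bullet> u i) *\<^sub>R v + (x \<bullet> u j) *\<^sub>R w" "y = (y \<bullet> u i) *\<^sub>R v + (y \<bullet> u j) *\<^sub>R w"
    proof -
      have "(x \<bullet> u i) *\<^sub>R v + (x \<bullet> u j) *\<^sub>R w = (1 / d) *\<^sub>R (d *\<^sub>R x)"
        "(y \<bullet> u i) *\<^sub>R v + (y \<bullet> u j) *\<^sub>R w = (1 / d) *\<^sub>R (d *\<^sub>R y)"
        unfolding v_def w_def d by (simp_all add: algebra_simps)
      then show "x = (x \<bullet> u i) *\<^sub>R v + (x \<bullet> u j) *\<^sub>R w" "y = (y \<bullet> u i) *\<^sub>R v + (y \<bullet> u j) *\<^sub>R w"
        using \<open>d \<noteq> 0\<close> by simp_all
    qed
    then have "{x, y} \<subseteq> span {v, w}" using span_pair[of x v w] span_pair[of y v w] by blast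
    then have "L \<subseteq> span {v, w}" unfolding Lspan by (rule span_minimal) simp
    moreover have "{v, w} \<subseteq> L"
      unfolding Lspan v_def w_def by (auto intro!: span_scale span_diff intro: span_base)
    then have "span {v, w} \<subseteq> L" using sub(1) by (rule span_minimal)
    ultimately show "L = span {v, w}" by blast
  qed
qed

lemma tuple_inner:
  assumes u: "orthonormal_frame u" and t: "(i, j, k, l) \<in> tuples"
  shows "u i \<bullet> u j = 0" "u i \<bullet> u k = 0" "u i \<bullet> u l = 0" "u j \<bullet> u i = 0" "u j \<bullet> u k = 0" "u j \<bullet> u l = 0"
    "u k \<bullet> u i = 0" "u k \<bullet> u j = 0" "u k \<bullet> u l = 0" "u l \<bullet> u i = 0" "u l \<bullet> u j = 0" "u l \<bullet> u k = 0"
    "u m \<bullet> u m = 1"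
  using t by (auto simp: frame_inner[OF u] tuples_def)

lemma norm_coordinate_le:
  fixes p :: "real ^ 'n"
  assumes "norm p \<le> 1" shows "\<bar>p $ i\<bar> \<le> 1"
  using component_le_norm_cart[of p i] assms by simp

lemma norm_combination3_le:
  assumes u: "orthonormal_frame u" and "\<bar>a\<bar> \<le> 1" "\<bar>b\<bar> \<le> 1"
  shows "norm (u i + a *\<^sub>R u j + b *\<^sub>R u k) \<le> 3"
proof -
  have 1: "norm (u i + a *\<^sub>R u j) \<le> 1 + \<bar>a\<bar>"
    using norm_combination_le[of "u i" "u j" 1 a] frame_norm[OF u] by simp
  show "norm (u i + a *\<^sub>R u j + b *\<^sub>R u k) \<le> 3"
    using norm_triangle_ineq[of "u i + a *\<^sub>R u j" "b *\<^sub>R u k"] 1 assms frame_norm[OF u] by simp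
qed

lemma abs_inner_unit_le: "norm b = 1 \<Longrightarrow> norm x \<le> c \<Longrightarrow> \<bar>x \<bullet> b\<bar> \<le> c"
  using Cauchy_Schwarz_ineq2[of x b] by simp

lemma Gr22_volume_finite:
  assumes r: "r > 0"
  shows "hausdorff_measure 4 (Gr_embed r ` Gr22) < \<infinity>"
proof -
  define u :: "4 \<Rightarrow> real ^ 4" where "u i = axis i 1" for i
  have u: "orthonormal_frame u" by (simp add: orthonormal_frame_def u_def inner_axis_axis)
  let ?I = "(\<lambda>t p. Gr_embed r (chart4 u t p)) ` tuples"
  have "hausdorff_measure CARD(4) (Gr_embed r ` Gr22) < \<infinity>"
  proof (rule hausdorff_measure_finite)
    \<comment> \<open>The basis is pivoted with constant 1, and 2 is the Lipschitz constant of each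
      basis vector in the parameters.\<close>
    show "finite ?I" "r * (64 * 1 * 2) > 0" using r by simp_all
    fix \<Phi> and p q :: "real ^ 4" assume "\<Phi> \<in> ?I"
    then obtain i j k l where t: "(i, j, k, l) \<in> tuples" and \<Phi>: "\<Phi> = (\<lambda>p. Gr_embed r (chart4 u (i, j, k, l) p))"
      by auto
    show "dist (\<Phi> p) (\<Phi> q) \<le> r * (64 * 1 * 2) * norm (p - q)"
      unfolding \<Phi> chart4_def prod.case
    proof (rule Gr_embed_Lipschitz[OF r])
      have "pivoted 1 (u i + p $ 1 *\<^sub>R u k + p $ 2 *\<^sub>R u l) (u j + p $ 3 *\<^sub>R u k + p $ 4 *\<^sub>R u l)" for p :: "real ^ 4"
        by (rule pivotedI[of "u i" "u j"]) (simp_all add: frame_norm[OF u] tuple_inner[OF u t] inner_add_left)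
      then show "pivoted 1 (u i + p $ 1 *\<^sub>R u k + p $ 2 *\<^sub>R u l) (u j + p $ 3 *\<^sub>R u k + p $ 4 *\<^sub>R u l)"
        "pivoted 1 (u i + q $ 1 *\<^sub>R u k + q $ 2 *\<^sub>R u l) (u j + q $ 3 *\<^sub>R u k + q $ 4 *\<^sub>R u l)" by blast+
    qed (simp_all only: combination_Lipschitz[OF u] zero_le_one)
  next
    show "Gr_embed r ` Gr22 \<subseteq> (\<Union>\<Phi>\<in>?I. \<Phi> ` {p. \<forall>i. \<bar>p $ i\<bar> \<le> 1})"
    proof (rule image_subsetI)
      fix L assume "L \<in> Gr22"
      then obtain i j v w where n: "i \<noteq> j" "L = span {v, w}" "v \<bullet> u i = 1" "v \<bullet> u j = 0" "w \<bullet> u i = 0" "w \<bullet> u j = 1"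
        "\<And>k. \<bar>v \<bullet> u k\<bar> \<le> 1" "\<And>k. \<bar>w \<bullet> u k\<bar> \<le> 1"
        using Gr22_normal_form[OF u] by metis
      obtain k l where t: "(i, j, k, l) \<in> tuples" using tuple_extend[OF n(1)] by metis
      define p :: "real ^ 4" where "p = (\<chi> m. if m = 1 then v \<bullet> u k else if m = 2 then v \<bullet> u l
        else if m = 3 then w \<bullet> u k else w \<bullet> u l)"
      have p: "p $ 1 = v \<bullet> u k" "p $ 2 = v \<bullet> u l" "p $ 3 = w \<bullet> u k" "p $ 4 = w \<bullet> u l" by (simp_all add: p_def)
      have "u i + (v \<bullet> u k) *\<^sub>R u k + (v \<bullet> u l) *\<^sub>R u l = v" "u j + (w \<bullet> u k) *\<^sub>R u k + (w \<bullet> u l) *\<^sub>R u l = w"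
        using tuple_expand[OF u t, of v] tuple_expand[OF u t, of w] n by simp_all
      then have L: "L = chart4 u (i, j, k, l) p"
        unfolding chart4_def prod.case n(2) p by (simp only:)
      have "\<forall>i. \<bar>p $ i\<bar> \<le> 1" unfolding forall_4 p using n by blast
      then have "Gr_embed r L \<in> (\<lambda>p. Gr_embed r (chart4 u (i, j, k, l) p)) ` {p. \<forall>i. \<bar>p $ i\<bar> \<le> 1}"
        unfolding L by blast
      then show "Gr_embed r L \<in> (\<Union>\<Phi>\<in>?I. \<Phi> ` {p. \<forall>i. \<bar>p $ i\<bar> \<le> 1})" using t by blast
    qed
  qed
  then show ?thesis by simp
qed

lemma emeasure_unit_ball_pos: "emeasure lborel (ball (0 :: 'a::euclidean_space) 1) > 0"
  by (simp add: emeasure_ball ennreal_zero_less_mult_iff)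

text \<open>Every parameter is a coordinate of one of the two normalised basis vectors, so by
  \<open>Gr_embed_expand\<close> the chart is expanding on the unit ball up to a constant, and the
  image has positive measure.\<close>

lemma chart_volume_pos:
  fixes V W :: "real ^ 'n \<Rightarrow> real ^ 4"
  assumes r: "r > 0" and ac: "norm a = 1" "norm c = 1"
    and n: "\<And>p. V p \<bullet> a = 1" "\<And>p. V p \<bullet> c = 0" "\<And>p. W p \<bullet> a = 0" "\<And>p. W p \<bullet> c = 1"
    and K: "\<And>p. norm p \<le> 1 \<Longrightarrow> norm (V p) \<le> K" "\<And>p. norm p \<le> 1 \<Longrightarrow> norm (W p) \<le> K"
    and coords: "\<And>i. \<exists>b. norm b = 1 \<and> ((\<forall>p. V p \<bullet> b = p $ i) \<or> (\<forall>p. W p \<bullet> b = p $ i))"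
    and X: "\<And>p. span {V p, W p} \<in> Gr22 \<Longrightarrow> span {V p, W p} \<in> X"
  shows "hausdorff_measure CARD('n) (Gr_embed r ` X) > 0"
proof -
  let ?\<Phi> = "\<lambda>p. Gr_embed r (span {V p, W p})"
  have "norm (V 0) \<ge> 1" using abs_inner_unit_le[OF ac(1) order.refl, of "V 0"] n by simp
  then have K1: "K \<ge> 1" using K(1)[of 0] by simp
  define C where "C = 4 * sqrt 2 / r * K * (1 + 2 * K)"
  have C: "C > 0" using r K1 by (simp add: C_def)
  have "hausdorff_measure DIM(real ^ 'n) (Gr_embed r ` X) > 0"
  proof (rule hausdorff_measure_pos)
    show "ball 0 1 \<in> sets borel" "emeasure lborel (ball 0 1 :: (real ^ 'n) set) > 0"
      by (simp_all add: emeasure_unit_ball_pos)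
    show "real CARD('n) * C > 0" using C by simp
    show "?\<Phi> ` ball 0 1 \<subseteq> Gr_embed r ` X"
    proof (rule image_subsetI)
      fix p
      have "pivoted 1 (V p) (W p)" by (rule pivotedI[OF ac n])
      then have "span {V p, W p} \<in> Gr22" using pivoted_dim unfolding Gr22_def by blast
      then show "?\<Phi> p \<in> Gr_embed r ` X" using X by blast
    qed
    fix p q :: "real ^ 'n" assume "p \<in> ball 0 1" "q \<in> ball 0 1"
    then have pq: "norm p \<le> 1" "norm q \<le> 1" by simp_all
    note D = Gr_embed_expand[OF r ac n(1,2) n(1,2) n(3,4) n(3,4) K(1)[OF pq(1)] K(2)[OF pq(1)]
        K(1)[OF pq(2)] K(2)[OF pq(2)], folded C_def]
    have c: "\<bar>(p - q) $ i\<bar> \<le> C * dist (?\<Phi> p) (?\<Phi> q)" for i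
    proof -
      obtain b where b: "norm b = 1" "(\<forall>p. V p \<bullet> b = p $ i) \<or> (\<forall>p. W p \<bullet> b = p $ i)"
        using coords by blast
      then have "(p - q) $ i = (V p - V q) \<bullet> b \<or> (p - q) $ i = (W p - W q) \<bullet> b"
        by (auto simp: inner_diff_left)
      then show ?thesis using abs_inner_unit_le[OF b(1) D(1)] abs_inner_unit_le[OF b(1) D(2)] by auto
    qed
    have "dist p q \<le> (\<Sum>i\<in>UNIV. \<bar>(p - q) $ i\<bar>)" unfolding dist_norm by (rule norm_le_l1_cart)
    also have "\<dots> \<le> (\<Sum>i\<in>(UNIV :: 'n set). C * dist (?\<Phi> p) (?\<Phi> q))" by (intro sum_mono c)
    finally show "dist p q \<le> real CARD('n) * C * dist (?\<Phi> p) (?\<Phi> q)" by (simp add: mult.assoc)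
  qed
  then show ?thesis by simp
qed

lemma Gr22_volume_pos:
  assumes r: "r > 0"
  shows "hausdorff_measure 4 (Gr_embed r ` Gr22) > 0"
proof -
  define u :: "4 \<Rightarrow> real ^ 4" where "u i = axis i 1" for i
  have u: "orthonormal_frame u" by (simp add: orthonormal_frame_def u_def inner_axis_axis)
  have "(1 :: 4) \<noteq> 2" by simp
  then obtain i j k l where t: "(i, j, k, l) \<in> tuples" using tuple_extend by metis
  let ?V = "\<lambda>p :: real ^ 4. u i + p $ 1 *\<^sub>R u k + p $ 2 *\<^sub>R u l" and ?W = "\<lambda>p :: real ^ 4. u j + p $ 3 *\<^sub>R u k + p $ 4 *\<^sub>R u l"
  have in_simps: "?V p \<bullet> u i = 1" "?V p \<bullet> u j = 0" "?W p \<bullet> u i = 0" "?W p \<bullet> u j = 1"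
    "?V p \<bullet> u k = p $ 1" "?V p \<bullet> u l = p $ 2" "?W p \<bullet> u k = p $ 3" "?W p \<bullet> u l = p $ 4" for p
    by (simp_all add: tuple_inner[OF u t] inner_add_left)
  have "\<forall>m. \<exists>b. norm b = 1 \<and> ((\<forall>p. ?V p \<bullet> b = p $ m) \<or> (\<forall>p. ?W p \<bullet> b = p $ m))"
    unfolding forall_4 using in_simps frame_norm[OF u] by blast
  then have "hausdorff_measure CARD(4) (Gr_embed r ` Gr22) > 0"
    by (intro chart_volume_pos[where V = ?V and W = ?W and K = 3, OF r frame_norm[OF u, of i] frame_norm[OF u, of j]]
        in_simps norm_combination3_le[OF u] norm_coordinate_le) auto
  then show ?thesis by simp
qed

lemma tuple_extend3:
  assumes "distinct [i, j, k :: 4]" obtains l where "(i, j, k, l) \<in> tuples"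
proof -
  have "card {i, j, k} < card (UNIV :: 4 set)" by (simp add: card_insert_if)
  then obtain l where l: "l \<notin> {i, j, k}" by (metis UNIV_I less_irrefl subset_antisym subsetI)
  show ?thesis using that[of l] assms l by (auto simp: tuples_def)
qed

text \<open>The coordinate at j reads p_1 \<alpha> + \<beta>, because the first vector is not
  normalised there; recovering \<beta> costs a second norm, whence the constant 2.\<close>

lemma chart3'_pivoted:
  fixes p :: "real ^ 3"
  assumes u: "orthonormal_frame u" and t: "(i, j, k, l) \<in> tuples" and p: "\<bar>p $ 1\<bar> \<le> 1"
  shows "pivoted 2 (u i + p $ 1 *\<^sub>R u j) (u j + p $ 2 *\<^sub>R u k + p $ 3 *\<^sub>R u l)"
  unfolding pivoted_def
proof (intro allI conjI)
  fix \<alpha> \<beta>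
  let ?x = "\<alpha> *\<^sub>R (u i + p $ 1 *\<^sub>R u j) + \<beta> *\<^sub>R (u j + p $ 2 *\<^sub>R u k + p $ 3 *\<^sub>R u l)"
  have "?x \<bullet> u i = \<alpha>" "?x \<bullet> u j = \<alpha> * p $ 1 + \<beta>"
    by (simp_all add: tuple_inner[OF u t] inner_add_left)
  then have 1: "\<bar>\<alpha>\<bar> \<le> norm ?x" "\<bar>\<alpha> * p $ 1 + \<beta>\<bar> \<le> norm ?x"
    using abs_inner_unit_le[OF frame_norm[OF u, of i], of ?x "norm ?x"]
      abs_inner_unit_le[OF frame_norm[OF u, of j], of ?x "norm ?x"] by simp_all
  have "\<bar>\<alpha> * p $ 1\<bar> \<le> \<bar>\<alpha>\<bar> * 1" unfolding abs_mult using p by (intro mult_left_mono) auto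
  with 1 show "\<bar>\<alpha>\<bar> \<le> 2 * norm ?x" "\<bar>\<beta>\<bar> \<le> 2 * norm ?x" by linarith+
qed

lemma chart3_simps:
  assumes u: "orthonormal_frame u" and t: "(i, j, k, l) \<in> tuples"
  shows "(u i + a *\<^sub>R u j) \<bullet> u i = 1" "(u i + a *\<^sub>R u j) \<bullet> u k = 0"
    "(u k + b *\<^sub>R u j + c *\<^sub>R u l) \<bullet> u i = 0" "(u k + b *\<^sub>R u j + c *\<^sub>R u l) \<bullet> u k = 1"
    "(u i + a *\<^sub>R u j) \<bullet> u j = a"
    "(u k + b *\<^sub>R u j + c *\<^sub>R u l) \<bullet> u j = b" "(u k + b *\<^sub>R u j + c *\<^sub>R u l) \<bullet> u l = c"
  by (simp_all add: tuple_inner[OF u t] inner_add_left)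

text \<open>Divide a nonzero vector of the intersection by the larger of its two
  coordinates.\<close>

lemma meet_normal_form:
  assumes u: "orthonormal_frame u" and L: "subspace L" and meet: "1 \<le> dim (L \<inter> span {u 1, u 2})"
  obtains i j c where "i \<noteq> j" "i \<in> {1, 2}" "j \<in> {1, 2}" "\<bar>c\<bar> \<le> 1" "u i + c *\<^sub>R u j \<in> L"
proof -
  have "\<not> L \<inter> span {u 1, u 2} \<subseteq> {0}" using meet by (metis dim_eq_0 not_one_le_zero)
  then obtain x where x: "x \<in> L" "x \<in> span {u 1, u 2}" "x \<noteq> 0" by blast
  then obtain \<alpha> \<beta> where ab: "x = \<alpha> *\<^sub>R u 1 + \<beta> *\<^sub>R u 2" by (auto simp: span_pair)
  show ?thesis
  proof (cases "\<bar>\<beta>\<bar> \<le> \<bar>\<alpha>\<bar>")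
    case True
    then have "\<alpha> \<noteq> 0" using x ab by auto
    then have "u 1 + (\<beta> / \<alpha>) *\<^sub>R u 2 = (1 / \<alpha>) *\<^sub>R x" by (simp add: ab scaleR_add_right)
    then have "u 1 + (\<beta> / \<alpha>) *\<^sub>R u 2 \<in> L" using x L by (simp add: subspace_scale)
    moreover have "\<bar>\<beta> / \<alpha>\<bar> \<le> 1" using True \<open>\<alpha> \<noteq> 0\<close> by (simp add: divide_le_eq)
    ultimately show ?thesis by (intro that[of 1 2 "\<beta> / \<alpha>"]) auto
  next
    case False
    then have "\<beta> \<noteq> 0" by auto
    then have "u 2 + (\<alpha> / \<beta>) *\<^sub>R u 1 = (1 / \<beta>) *\<^sub>R x" by (simp add: ab scaleR_add_right)
    then have "u 2 + (\<alpha> / \<beta>) *\<^sub>R u 1 \<in> L" using x L by (simp add: subspace_scale)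
    moreover have "\<bar>\<alpha> / \<beta>\<bar> \<le> 1" using False \<open>\<beta> \<noteq> 0\<close> by (simp add: divide_le_eq)
    ultimately show ?thesis by (intro that[of 2 1 "\<alpha> / \<beta>"]) auto
  qed
qed

text \<open>Take a vector of L outside the line of v, remove its u_i coordinate with a multiple of
  v, and divide by its largest remaining coordinate.\<close>

lemma plane_second_vector:
  assumes u: "orthonormal_frame u" and L: "L \<in> Gr22" and v: "v \<in> L" "v \<bullet> u i = 1"
  obtains k w where "k \<noteq> i" "L = span {v, w}" "w \<bullet> u i = 0" "w \<bullet> u k = 1" "\<And>m. \<bar>w \<bullet> u m\<bar> \<le> 1"
proof -
  have sub: "subspace L" "dim L = 2" using L by (auto simp: Gr22_def)
  have "\<not> L \<subseteq> span {v}"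
  proof
    assume "L \<subseteq> span {v}"
    then have "dim L \<le> card {v}" by (intro dim_le_card) auto
    then show False using sub by simp
  qed
  then obtain y where y: "y \<in> L" "y \<notin> span {v}" by blast
  define z where "z = y - (y \<bullet> u i) *\<^sub>R v"
  have zL: "z \<in> L" using y v sub by (simp add: z_def subspace_diff subspace_scale)
  have zi: "z \<bullet> u i = 0" using v by (simp add: z_def inner_diff_left)
  have "z \<noteq> 0" using y(2) by (auto simp: z_def span_singleton)
  moreover have "z = 0" if "\<And>m. z \<bullet> u m = 0"
    using orthonormal_frame_expand[OF u, of z] that by simp
  ultimately obtain m where m: "z \<bullet> u m \<noteq> 0" by blast
  obtain k where k: "\<And>m. \<bar>z \<bullet> u m\<bar> \<le> \<bar>z \<bullet> u k\<bar>" using finite_max_abs[of "\<lambda>m. z \<bullet> u m"] by blast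
  have k0: "z \<bullet> u k \<noteq> 0" using k[of m] m by auto
  define w where "w = (1 / (z \<bullet> u k)) *\<^sub>R z"
  have w: "w \<bullet> u i = 0" "w \<bullet> u k = 1" "\<bar>w \<bullet> u m\<bar> \<le> 1" for m
    using zi k0 k[of m] by (simp_all add: w_def divide_le_eq)
  have wL: "w \<in> L" using zL sub by (simp add: w_def subspace_scale)
  \<comment> \<open>This crude constant serves only to see that v and w span a plane, which then
    equals L.\<close>
  have piv: "pivoted (1 + norm v) v w"
    unfolding pivoted_def
  proof (intro allI conjI)
    fix \<alpha> \<beta>
    let ?x = "\<alpha> *\<^sub>R v + \<beta> *\<^sub>R w"
    have "?x \<bullet> u i = \<alpha>" "?x \<bullet> u k = \<alpha> * (v \<bullet> u k) + \<beta>" using v w by (simp_all add: inner_add_left)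
    then have 1: "\<bar>\<alpha>\<bar> \<le> norm ?x" "\<bar>\<alpha> * (v \<bullet> u k) + \<beta>\<bar> \<le> norm ?x"
      using abs_inner_unit_le[OF frame_norm[OF u, of i], of ?x "norm ?x"]
        abs_inner_unit_le[OF frame_norm[OF u, of k], of ?x "norm ?x"] by simp_all
    have "\<bar>\<alpha> * (v \<bullet> u k)\<bar> \<le> norm ?x * norm v"
      unfolding abs_mult using 1 abs_inner_unit_le[OF frame_norm[OF u, of k] order.refl, of v]
      by (intro mult_mono) auto
    moreover have "0 \<le> norm v * norm ?x" by simp
    ultimately show "\<bar>\<alpha>\<bar> \<le> (1 + norm v) * norm ?x" "\<bar>\<beta>\<bar> \<le> (1 + norm v) * norm ?x"
      using 1 by (simp_all add: algebra_simps)
  qed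
  have "span {v, w} \<subseteq> L" using v wL sub by (intro span_minimal) auto
  then have "span {v, w} = L"
    using pivoted_dim[OF piv] sub by (intro subspace_dim_equal) auto
  then show ?thesis using w zi k0 by (intro that[of k w]) auto
qed

lemma schubert_volume_finite:
  assumes r: "r > 0" and u: "orthonormal_frame u"
  shows "hausdorff_measure 3 (Gr_embed r ` {L \<in> Gr22. 1 \<le> dim (L \<inter> span {u 1, u 2})}) < \<infinity>"
proof -
  let ?I = "(\<lambda>t p. Gr_embed r (chart3 u t p)) ` tuples" and ?J = "(\<lambda>t p. Gr_embed r (chart3' u t p)) ` tuples"
  let ?A = "Gr_embed r ` {L \<in> Gr22. 1 \<le> dim (L \<inter> span {u 1, u 2})}"
  have "hausdorff_measure CARD(3) ?A < \<infinity>"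
  proof (rule hausdorff_measure_finite)
    \<comment> \<open>The pivot constant 2 is common to both families of charts; the other 2 is
      again the Lipschitz constant of the basis vectors.\<close>
    show "finite (?I \<union> ?J)" "r * (64 * 2 * 2) > 0" using r by simp_all
    fix \<Phi> and p q :: "real ^ 3"
    assume "\<Phi> \<in> ?I \<union> ?J" and p: "\<And>i. \<bar>p $ i\<bar> \<le> 1" and q: "\<And>i. \<bar>q $ i\<bar> \<le> 1"
    then consider i j k l where "(i, j, k, l) \<in> tuples" "\<Phi> = (\<lambda>p. Gr_embed r (chart3 u (i, j, k, l) p))"
      | i j k l where "(i, j, k, l) \<in> tuples" "\<Phi> = (\<lambda>p. Gr_embed r (chart3' u (i, j, k, l) p))"
      by auto
    then show "dist (\<Phi> p) (\<Phi> q) \<le> r * (64 * 2 * 2) * norm (p - q)"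
    proof cases
      case 1
      have piv: "pivoted 2 (u i + p $ 1 *\<^sub>R u j) (u k + p $ 2 *\<^sub>R u j + p $ 3 *\<^sub>R u l)" for p :: "real ^ 3"
        by (rule pivoted_mono[OF pivotedI[of "u i" "u k"]])
          (simp_all only: frame_norm[OF u] chart3_simps[OF u 1(1)] one_le_numeral)
      show ?thesis
        unfolding 1(2) chart3_def prod.case
        by (rule Gr_embed_Lipschitz[OF r _ piv[of p] piv[of q]])
          (simp_all only: combination_Lipschitz[OF u] zero_le_numeral)
    next
      case 2
      show ?thesis
        unfolding 2(2) chart3'_def prod.case
        by (rule Gr_embed_Lipschitz[OF r _ chart3'_pivoted[OF u 2(1) p] chart3'_pivoted[OF u 2(1) q]])
          (simp_all only: combination_Lipschitz[OF u] zero_le_numeral)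
    qed
  next
    show "?A \<subseteq> (\<Union>\<Phi>\<in>?I \<union> ?J. \<Phi> ` {p. \<forall>i. \<bar>p $ i\<bar> \<le> 1})"
    proof (rule image_subsetI)
      fix L assume "L \<in> {L \<in> Gr22. 1 \<le> dim (L \<inter> span {u 1, u 2})}"
      then have L: "L \<in> Gr22" "1 \<le> dim (L \<inter> span {u 1, u 2})" by auto
      then have sub: "subspace L" by (simp add: Gr22_def)
      obtain i j c where ij: "i \<noteq> j" "\<bar>c\<bar> \<le> 1" "u i + c *\<^sub>R u j \<in> L"
        using meet_normal_form[OF u sub L(2)] by metis
      have "(u i + c *\<^sub>R u j) \<bullet> u i = 1" using ij(1) by (simp add: inner_add_left frame_inner[OF u])
      from plane_second_vector[OF u L(1) ij(3) this]
      obtain k w where w: "k \<noteq> i" "L = span {u i + c *\<^sub>R u j, w}" "w \<bullet> u i = 0" "w \<bullet> u k = 1" "\<And>m. \<bar>w \<bullet> u m\<bar> \<le> 1"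
        by metis
      show "Gr_embed r L \<in> (\<Union>\<Phi>\<in>?I \<union> ?J. \<Phi> ` {p. \<forall>i. \<bar>p $ i\<bar> \<le> 1})"
      \<comment> \<open>The pivot of w may be the direction j that already occurs in the first
        vector; this is the case that requires \<open>chart3'\<close>.\<close>
      proof (cases "k = j")
        case True
        obtain k' l where t: "(i, j, k', l) \<in> tuples" using tuple_extend[OF ij(1)] by metis
        define p :: "real ^ 3" where "p = vector [c, w \<bullet> u k', w \<bullet> u l]"
        have "u j + (w \<bullet> u k') *\<^sub>R u k' + (w \<bullet> u l) *\<^sub>R u l = w"
          using tuple_expand[OF u t, of w] w True by simp
        then have "L = chart3' u (i, j, k', l) p"
          unfolding chart3'_def prod.case w(2) p_def vector_3 by (simp only:)
        moreover have "\<forall>i. \<bar>p $ i\<bar> \<le> 1" unfolding forall_3 p_def vector_3 using w ij by blast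
        ultimately show ?thesis using t by blast
      next
        case False
        then obtain l where t: "(i, j, k, l) \<in> tuples"
          using tuple_extend3[of i j k] ij(1) w(1) by auto
        define p :: "real ^ 3" where "p = vector [c, w \<bullet> u j, w \<bullet> u l]"
        have "u k + (w \<bullet> u j) *\<^sub>R u j + (w \<bullet> u l) *\<^sub>R u l = w"
          using tuple_expand[OF u t, of w] w by (simp add: add_ac)
        then have "L = chart3 u (i, j, k, l) p"
          unfolding chart3_def prod.case w(2) p_def vector_3 by (simp only:)
        moreover have "\<forall>i. \<bar>p $ i\<bar> \<le> 1" unfolding forall_3 p_def vector_3 using w ij by blast
        ultimately show ?thesis using t by blast
      qed
    qed
  qed
  then show ?thesis by simp
qed

text \<open>A single chart suffices: in \<open>chart3\<close> for (1, 2, 3, 4) the first basis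
  vector is a nonzero vector of the fixed plane, so the chart stays inside the Schubert
  variety.\<close>

lemma schubert_volume_pos:
  assumes r: "r > 0" and u: "orthonormal_frame u"
  shows "hausdorff_measure 3 (Gr_embed r ` {L \<in> Gr22. 1 \<le> dim (L \<inter> span {u 1, u 2})}) > 0"
proof -
  let ?X = "{L \<in> Gr22. 1 \<le> dim (L \<inter> span {u 1, u 2})}"
  have t: "(1, 2, 3, 4) \<in> tuples" by (simp add: tuples_def)
  let ?V = "\<lambda>p :: real ^ 3. u 1 + p $ 1 *\<^sub>R u 2" and ?W = "\<lambda>p :: real ^ 3. u 3 + p $ 2 *\<^sub>R u 2 + p $ 3 *\<^sub>R u 4"
  note in_simps = chart3_simps[OF u t]
  have meet: "1 \<le> dim (span {?V p, ?W p} \<inter> span {u 1, u 2})" for p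
  proof -
    have "?V p \<in> span {?V p, ?W p}" by (simp add: span_base)
    moreover have "?V p \<in> span {u 1, u 2}" by (intro span_add span_scale span_base) auto
    moreover have "?V p \<noteq> 0" using in_simps(1)[of "p $ 1"] by (metis inner_zero_left zero_neq_one)
    ultimately have "dim (span {?V p, ?W p} \<inter> span {u 1, u 2}) \<noteq> 0"
      unfolding dim_eq_0 by blast
    then show ?thesis by linarith
  qed
  have "\<forall>m. \<exists>b. norm b = 1 \<and> ((\<forall>p. ?V p \<bullet> b = p $ m) \<or> (\<forall>p. ?W p \<bullet> b = p $ m))"
    unfolding forall_3 using in_simps frame_norm[OF u] by blast
  then have "hausdorff_measure CARD(3) (Gr_embed r ` ?X) > 0"
    using meet
    by (intro chart_volume_pos[where V = ?V and W = ?W and K = 3, OF r frame_norm[OF u, of 1] frame_norm[OF u, of 3]]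
        in_simps norm_combination3_le[OF u] norm_combination3_le[OF u, where b = 0, simplified] norm_coordinate_le) auto
  then show ?thesis by simp
qed

lemma young_diagram_1: "young_diagram [1] = {(1, 1)}"
proof -
  have "(i, j) \<in> young_diagram [1] \<longleftrightarrow> (i, j) = (1, 1)" for i j
    by (cases "i = 1") (auto simp: young_diagram_def)
  then show ?thesis by auto
qed

text \<open>Since \<open>enn2real\<close> sends infinity to 0, a positive volume requires the
  Hausdorff measure to be finite as well as positive.\<close>

lemma Gr_vol_Gr22_pos:
  assumes "r > 0" shows "Gr_vol r 4 Gr22 > 0"
  using Gr22_volume_finite[OF assms] Gr22_volume_pos[OF assms]
  by (simp add: Gr_vol_def enn2real_positive_iff)

lemma Gr_vol_box_pos:
  assumes r: "r > 0" and F: "complete_flag F"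
  shows "Gr_vol r (4 - card (young_diagram [1])) (schubert_variety F (young_diagram [1])) > 0"
proof -
  have "(2 :: nat) \<in> {1..4}" by simp
  then have "subspace (F 2)" "dim (F 2) = 2" using F unfolding complete_flag_def by blast+
  then obtain u where u: "orthonormal_frame u" "F 2 = span {u 1, u 2}" by (rule orthonormal_frame_exists)
  have "schubert_variety F (young_diagram [1]) = {L \<in> Gr22. 1 \<le> dim (L \<inter> span {u 1, u 2})}"
    unfolding young_diagram_1 schubert_variety_def using u(2) by (simp add: numeral_2_eq_2)
  moreover have "4 - card (young_diagram [1]) = 3" unfolding young_diagram_1 by simp
  ultimately show ?thesis
    using schubert_volume_finite[OF r u(1)] schubert_volume_pos[OF r u(1)]
    by (simp only: Gr_vol_def enn2real_positive_iff infinity_ennreal_def)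
qed

section \<open>Pairing with point masses\<close>

lemma vK_distr:
  fixes \<xi> :: "'c \<Rightarrow> 'a::euclidean_space"
  assumes T: "T \<in> M \<rightarrow>\<^sub>M N" and \<xi>: "\<xi> \<in> borel_measurable N"
  shows "vK (distr M N T) \<xi> = vK M (\<lambda>\<omega>. \<xi> (T \<omega>))"
proof -
  have "(\<integral>\<omega>. \<bar>u \<bullet> \<xi> \<omega>\<bar> \<partial>distr M N T) = (\<integral>\<omega>. \<bar>u \<bullet> \<xi> (T \<omega>)\<bar> \<partial>M)" for u
    by (rule integral_distr[OF T]) (use \<xi> in measurable)
  then show ?thesis by (simp add: vK_def zonoid_of_def)
qed

text \<open>The specifications of product and pairing speak of laws; this transports them to
  arbitrary sample spaces.\<close>

lemma integrable_law_distr: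
  fixes \<xi> :: "'b \<Rightarrow> 'a::euclidean_space"
  assumes "prob_space M" "integrable M \<xi>"
  shows "integrable_law (distr M borel \<xi>)" "vK M \<xi> = vK (distr M borel \<xi>) (\<lambda>x. x)"
proof -
  have m: "\<xi> \<in> borel_measurable M" using assms(2) by (rule borel_measurable_integrable)
  have "integrable (distr M borel \<xi>) (\<lambda>x. x)"
    using assms(2) by (subst integrable_distr_eq[OF m]) auto
  then show "integrable_law (distr M borel \<xi>)"
    using prob_space.prob_space_distr[OF assms(1) m] by (simp add: integrable_law_def)
  show "vK M \<xi> = vK (distr M borel \<xi>) (\<lambda>x. x)" by (rule vK_distr[OF m, symmetric]) simp
qed

text \<open>The segment from -L/2 to L/2, written as the zonoid of the constant random vector
  L.\<close>

definition segment_vzonoid :: "'a::euclidean_space \<Rightarrow> 'a vzonoid" where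
  "segment_vzonoid L = vK (return borel L) (\<lambda>x. x)"

lemma integrable_law_return: "integrable_law (return borel L)"
proof -
  have "prob_space (return borel L)" by (rule prob_space_return) simp
  moreover have "integrable (return borel L) (\<lambda>x. x)"
    by (rule integrableI_bounded) (simp_all add: nn_integral_return)
  ultimately show ?thesis by (simp add: integrable_law_def)
qed

lemma vpairing_segment:
  fixes \<xi> :: "'b \<Rightarrow> 'a::euclidean_space"
  assumes "prob_space M" "integrable M \<xi>"
  shows "vpairing (vK M \<xi>) (segment_vzonoid L) = (\<integral>\<omega>. \<bar>\<xi> \<omega> \<bullet> L\<bar> \<partial>M)"
proof -
  let ?\<mu> = "distr M borel \<xi>"
  note law = integrable_law_distr[OF assms]
  have m: "\<xi> \<in> borel_measurable M" using assms(2) by (rule borel_measurable_integrable)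
  have "vpairing (vK M \<xi>) (segment_vzonoid L) = (\<integral>(x, y). \<bar>x \<bullet> y\<bar> \<partial>(?\<mu> \<Otimes>\<^sub>M return borel L))"
    unfolding law(2) segment_vzonoid_def by (rule vpairing_spec(2)[OF law(1) integrable_law_return])
  also have "\<dots> = (\<integral>x. (\<integral>y. \<bar>x \<bullet> y\<bar> \<partial>return borel L) \<partial>?\<mu>)"
    using integral_bilinear(1)[OF bilinear_inner law(1) integrable_law_return, where u = "1 :: real"] by simp
  also have "\<dots> = (\<integral>x. \<bar>x \<bullet> L\<bar> \<partial>?\<mu>)"
    by (intro Bochner_Integration.integral_cong refl integral_return) auto
  also have "\<dots> = (\<integral>\<omega>. \<bar>\<xi> \<omega> \<bullet> L\<bar> \<partial>M)"
    by (rule integral_distr[OF m]) measurable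
  finally show ?thesis .
qed

lemma linear_vpairing: "linear (\<lambda>x. vpairing x y)"
  using vpairing_spec(1) unfolding bilinear_def by blast

lemma vpairing_grassmann_segment:
  fixes x :: "(real ^ ('n::finite set)) vzonoid"
  assumes x: "x \<in> grassmann_vzonoids d" and L: "L \<in> simple_vectors d'" and "d \<noteq> d'"
  shows "vpairing x (segment_vzonoid L) = 0"
proof (rule linear_eq_0_on_span[OF linear_vpairing _ x[unfolded grassmann_vzonoids_def]])
  fix z :: "(real ^ ('n set)) vzonoid"
  assume "z \<in> {vK \<mu> (\<lambda>x. x) |\<mu>. integrable_law \<mu> \<and> (AE x in \<mu>. x \<in> simple_vectors d)}"
  then obtain \<mu> where \<mu>: "z = vK \<mu> (\<lambda>x. x)" "integrable_law \<mu>" "AE x in \<mu>. x \<in> simple_vectors d" by blast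
  have "AE x in \<mu>. \<bar>x \<bullet> L\<bar> = 0"
    using \<mu>(3) by eventually_elim (simp add: simple_vectors_orthogonal[OF _ L \<open>d \<noteq> d'\<close>])
  then have "(\<integral>x. \<bar>x \<bullet> L\<bar> \<partial>\<mu>) = 0" by (rule integral_eq_zero_AE)
  then show "vpairing z (segment_vzonoid L) = 0"
    unfolding \<mu>(1)
    by (subst vpairing_segment) (simp_all add: integrable_law_prob integrable_law_integrable \<mu>(2))
qed

text \<open>In the degree of L the segment of L is itself a Grassmann zonoid, because L is simple,
  so null elements pair to 0 with it by definition. In other degrees the pairing vanishes by
  orthogonality.\<close>

lemma vpairing_null_ideal:
  fixes n :: "(real ^ ('n::finite set)) vzonoid"
  assumes n: "n \<in> null_ideal" and L: "L \<in> simple_vectors d"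
  shows "vpairing n (segment_vzonoid L) = 0"
proof (rule linear_eq_0_on_span[OF linear_vpairing _ n[unfolded null_ideal_def]])
  fix x :: "(real ^ ('n set)) vzonoid"
  assume "x \<in> (\<Union>d. null_vzonoids d)"
  then obtain d' where x: "x \<in> null_vzonoids d'" by blast
  show "vpairing x (segment_vzonoid L) = 0"
  proof (cases "d' = d")
    case True
    have "AE x in return borel L. x \<in> simple_vectors d"
      by (rule AE_I[of _ _ "UNIV - {L}"]) (use L in \<open>auto simp: emeasure_return\<close>)
    then have "segment_vzonoid L \<in> grassmann_vzonoids d"
      unfolding grassmann_vzonoids_def segment_vzonoid_def
      by (intro span_base) (use integrable_law_return in blast)
    then show ?thesis using x True unfolding null_vzonoids_def by blast
  next
    case False
    have "x \<in> grassmann_vzonoids d'" using x by (simp add: null_vzonoids_def)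
    then show ?thesis using L False by (rule vpairing_grassmann_segment)
  qed
qed

section \<open>Grassmann zonoids of Schubert varieties\<close>

lemma haar_integrable:
  fixes \<xi> :: "mat22 \<times> mat22 \<Rightarrow> 'a::euclidean_space"
  assumes \<mu>: "haar \<mu>" and \<xi>: "continuous_on UNIV \<xi>"
  shows "integrable \<mu> \<xi>"
proof -
  interpret prob_space \<mu> using \<mu> by (simp add: haar_def)
  have "compact (\<xi> ` H_group)"
    by (rule compact_continuous_image[OF continuous_on_subset[OF \<xi>] compact_H_group]) simp
  then obtain C where C: "\<And>h. h \<in> H_group \<Longrightarrow> norm (\<xi> h) \<le> C"
    using compact_imp_bounded bounded_iff by (metis image_eqI)
  have s: "sets \<mu> = sets H_borel" using \<mu> by (simp add: haar_def)
  show ?thesis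
  proof (rule integrable_const_bound)
    show "AE h in \<mu>. norm (\<xi> h) \<le> C" using C haar_space[OF \<mu>] by (intro AE_I2) auto
    show "\<xi> \<in> borel_measurable \<mu>"
      using measurable_H_borel_borel[OF \<xi>] measurable_cong_sets[OF s refl] by blast
  qed
qed

lemma continuous_on_H_act: "continuous_on UNIV (\<lambda>h. H_act h v)"
  unfolding H_act_def by (intro continuous_on_vec_lambda continuous_intros)

lemma schubert_vector_1: "schubert_vector e f {(1, 1)} = ext_vec (tensor (e 1) (f 1))"
  by (simp add: schubert_vector_def sorted_key_list_of_set_singleton ext_prod_single)

text \<open>The wedge is ordered by the encoding \<open>to_nat\<close> of the boxes, whose values
  are left open here; hence the sign is left undetermined.\<close>

lemma schubert_vector_2:
  assumes "p \<noteq> q"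
  shows "schubert_vector e f {p, q} = ext_prod [tensor (e (fst p)) (f (snd p)), tensor (e (fst q)) (f (snd q))] \<or>
    schubert_vector e f {p, q} = - ext_prod [tensor (e (fst p)) (f (snd p)), tensor (e (fst q)) (f (snd q))]"
  using assms ext_prod_swap[of "tensor (e (fst q)) (f (snd q))" "tensor (e (fst p)) (f (snd p))"]
  by (cases "to_nat p < to_nat q") (simp_all add: schubert_vector_def sorted_key_list_of_set_pair split_beta)

lemma continuous_on_ext_vec [continuous_intros]:
  assumes "continuous_on S g" shows "continuous_on S (\<lambda>x. ext_vec (g x))"
proof -
  have "bounded_linear ext_vec" using linear_ext_vec by (simp add: linear_conv_bounded_linear)
  then show ?thesis by (rule bounded_linear.continuous_on[OF _ assms])
qed

lemma continuous_on_ext_prod_pair [continuous_intros]: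
  assumes "continuous_on S g" "continuous_on S h" shows "continuous_on S (\<lambda>x. ext_prod [g x, h x])"
proof -
  have "bounded_bilinear (\<lambda>v w. ext_prod [v, w])" using bilinear_ext_prod by (simp add: bilinear_conv_bounded_bilinear)
  then show ?thesis by (rule bounded_bilinear.continuous_on[OF _ assms])
qed

section \<open>The defect functional on Schubert classes and on the square\<close>

definition coord :: "2 \<Rightarrow> 2 \<Rightarrow> real ^ (2 \<times> 2)" where
  "coord i j = tensor (axis i 1) (axis j 1)"

lemma inner_coord: "tensor x y \<bullet> coord i j = x $ i * y $ j"
  by (simp add: coord_def inner_tensor inner_axis)

definition row_plane :: "real ^ ((2 \<times> 2) set)" where
  "row_plane = ext_prod [coord 1 1, coord 1 2]"

definition column_plane :: "real ^ ((2 \<times> 2) set)" where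
  "column_plane = ext_prod [coord 1 1, coord 2 1]"

lemma simple_planes:
  "row_plane \<in> simple_vectors 2" "column_plane \<in> simple_vectors 2" "row_plane + column_plane \<in> simple_vectors 2"
proof -
  have s: "ext_prod [v, w] \<in> simple_vectors 2" for v w :: "real ^ (2 \<times> 2)"
    unfolding simple_vectors_def by (rule CollectI, rule exI[of _ 1], rule exI[of _ "[v, w]"]) simp
  show "row_plane \<in> simple_vectors 2" "column_plane \<in> simple_vectors 2"
    unfolding row_plane_def column_plane_def by (rule s)+
  have "row_plane + column_plane = ext_prod [coord 1 1, coord 1 2 + coord 2 1]"
    unfolding row_plane_def column_plane_def by (rule bilinear_radd[OF bilinear_ext_prod, symmetric])
  then show "row_plane + column_plane \<in> simple_vectors 2" using s by simp
qed

text \<open>Written through \<open>vpairing\<close>, it is linear and vanishes on the null ideal for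
  formal reasons; \<open>defect_vK\<close> recovers the expectation.\<close>

definition defect :: "(real ^ ((2 \<times> 2) set)) vzonoid \<Rightarrow> real" where
  "defect x = vpairing x (segment_vzonoid row_plane) + vpairing x (segment_vzonoid column_plane)
     - vpairing x (segment_vzonoid (row_plane + column_plane))"

lemma linear_defect: "linear defect"
  unfolding defect_def by (intro linear_compose_sub linear_compose_add linear_vpairing)

lemma defect_null_ideal: "n \<in> null_ideal \<Longrightarrow> defect n = 0"
  by (simp add: defect_def vpairing_null_ideal[OF _ simple_planes(1)]
      vpairing_null_ideal[OF _ simple_planes(2)] vpairing_null_ideal[OF _ simple_planes(3)])

lemma defect_vK:
  assumes "prob_space M" "integrable M \<xi>"
  shows "defect (vK M \<xi>) = (\<integral>\<omega>. \<bar>\<xi> \<omega> \<bullet> row_plane\<bar> + \<bar>\<xi> \<omega> \<bullet> column_plane\<bar>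
    - \<bar>\<xi> \<omega> \<bullet> row_plane + \<xi> \<omega> \<bullet> column_plane\<bar> \<partial>M)"
proof -
  have i: "integrable M (\<lambda>\<omega>. \<bar>\<xi> \<omega> \<bullet> L\<bar>)" for L
    using integrable_abs_inner[OF assms(2), of L] by (simp add: inner_commute)
  show ?thesis
    using i[of row_plane] i[of column_plane] i[of "row_plane + column_plane"]
    by (simp add: defect_def vpairing_segment[OF assms] inner_add_right)
qed

lemma H_uniform_prob: "prob_space H_uniform"
  using haar_H_uniform by (simp add: haar_def)

lemma defect_codim2:
  assumes pq: "p \<noteq> q"
    and 0: "\<And>h. ext_prod [H_act h (tensor (e (fst p)) (f (snd p))), H_act h (tensor (e (fst q)) (f (snd q)))]
      \<bullet> L = 0" and L: "L = row_plane \<or> L = column_plane"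
  shows "defect (vK H_uniform (\<lambda>h. ext_map (H_act h) (schubert_vector e f {p, q}))) = 0"
proof -
  let ?v = "tensor (e (fst p)) (f (snd p))" and ?w = "tensor (e (fst q)) (f (snd q))"
  let ?\<xi> = "\<lambda>h. ext_map (H_act h) (schubert_vector e f {p, q})"
  let ?\<zeta> = "\<lambda>h. ext_prod [H_act h ?v, H_act h ?w]"
  have \<zeta>: "ext_map (H_act h) (ext_prod [?v, ?w]) = ?\<zeta> h" for h
    by (rule ext_map_ext_prod_pair[OF linear_H_act])
  have cases: "?\<xi> = ?\<zeta> \<or> ?\<xi> = (\<lambda>h. - ?\<zeta> h)"
    using schubert_vector_2[OF pq, of e f] by (auto simp: \<zeta> linear_neg[OF linear_ext_map])
  have "continuous_on UNIV ?\<zeta>" by (intro continuous_intros continuous_on_H_act)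
  then have "continuous_on UNIV ?\<xi>"
    using cases by (elim disjE) (simp_all only: continuous_on_minus)
  then have int: "integrable H_uniform ?\<xi>" by (rule haar_integrable[OF haar_H_uniform])
  have "?\<xi> h = ?\<zeta> h \<or> ?\<xi> h = - ?\<zeta> h" for h
    using schubert_vector_2[OF pq, of e f] by (auto simp: \<zeta> linear_neg[OF linear_ext_map])
  then have "?\<xi> h \<bullet> L = 0" for h
    using 0[of h] by (smt (verit) inner_minus_left)
  then have "?\<xi> h \<bullet> row_plane = 0 \<or> ?\<xi> h \<bullet> column_plane = 0" for h using L by blast
  then have "\<bar>?\<xi> h \<bullet> row_plane\<bar> + \<bar>?\<xi> h \<bullet> column_plane\<bar>
    - \<bar>?\<xi> h \<bullet> row_plane + ?\<xi> h \<bullet> column_plane\<bar> = 0" for h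
    by (metis abs_zero add.left_neutral add.right_neutral diff_self)
  then show ?thesis unfolding defect_vK[OF H_uniform_prob int] by (simp only: integral_zero)
qed

text \<open>For the row diagram both moved tensors share the first factor x, say x \<otimes> y and x
  \<otimes> y', while t_11 and t_21 share the second. The Gram determinant is x_1 y_1 x_2 y'_1 - x_2
  y_1 x_1 y'_1 = 0. The column diagram is the transposed case.\<close>

lemma defect_row_column:
  "defect (vK H_uniform (\<lambda>h. ext_map (H_act h) (schubert_vector e f {(1, 1), (1, 2)}))) = 0"
  "defect (vK H_uniform (\<lambda>h. ext_map (H_act h) (schubert_vector e f {(1, 1), (2, 1)}))) = 0"
  by (rule defect_codim2[where L = column_plane] defect_codim2[where L = row_plane];
      simp add: row_plane_def column_plane_def H_act_tensor inner_ext_prod_pair inner_coord mult_ac)+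

lemma orthogonal_matrix_transitive:
  fixes a b :: "real ^ 'n"
  assumes "norm a = norm b" obtains g where "orthogonal_matrix g" "g *v a = b"
proof -
  obtain T where T: "orthogonal_transformation T" "T a = b"
    using orthogonal_transformation_exists[OF assms] by blast
  then have "orthogonal_matrix (matrix T)" by (simp add: orthogonal_transformation_matrix)
  moreover have "matrix T *v a = b"
    using T orthogonal_transformation_linear[OF T(1)] by (simp add: matrix_works linear_linear)
  ultimately show ?thesis by (rule that)
qed

text \<open>The product of the laws is the law of two independent copies, so the product zonoid may
  be computed on the square of the sample space.\<close>

lemma vwedge_vK:
  fixes \<xi> :: "'b \<Rightarrow> real ^ ('n::finite set)"
  assumes M: "prob_space M" and int: "integrable M \<xi>"
  shows "vwedge (vK M \<xi>) (vK M \<xi>) = vK (M \<Otimes>\<^sub>M M) (\<lambda>p. ext_wedge (\<xi> (fst p)) (\<xi> (snd p)))"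
    and "integrable (M \<Otimes>\<^sub>M M) (\<lambda>p. ext_wedge (\<xi> (fst p)) (\<xi> (snd p)))"
proof -
  let ?\<mu> = "distr M borel \<xi>" and ?T = "\<lambda>(x, y). (\<xi> x, \<xi> y)"
  let ?w = "\<lambda>(x, y). ext_wedge x y :: real ^ ('n set)"
  note law = integrable_law_distr[OF M int]
  have m: "\<xi> \<in> borel_measurable M" using int by (rule borel_measurable_integrable)
  interpret \<mu>: prob_space ?\<mu> using law(1) by (rule integrable_law_prob)
  have prod: "?\<mu> \<Otimes>\<^sub>M ?\<mu> = distr (M \<Otimes>\<^sub>M M) (borel \<Otimes>\<^sub>M borel) ?T"
    by (rule pair_measure_distr[OF m m \<mu>.sigma_finite_measure_axioms])
  have T: "?T \<in> M \<Otimes>\<^sub>M M \<rightarrow>\<^sub>M borel \<Otimes>\<^sub>M borel" using m by measurable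
  have w: "?w \<in> borel_measurable (borel \<Otimes>\<^sub>M borel)"
    using borel_measurable_continuous_onI[OF continuous_on_bilinear[OF bilinear_ext_wedge]] by (simp only: borel_prod)
  have wT: "(\<lambda>p. ?w (?T p)) = (\<lambda>p. ext_wedge (\<xi> (fst p)) (\<xi> (snd p)))" by auto
  have "vwedge (vK M \<xi>) (vK M \<xi>) = vK (?\<mu> \<Otimes>\<^sub>M ?\<mu>) ?w"
    unfolding law(2) by (rule vwedge_spec(2)[OF law(1) law(1)])
  also have "\<dots> = vK (M \<Otimes>\<^sub>M M) (\<lambda>p. ?w (?T p))" unfolding prod by (rule vK_distr[OF T w])
  finally show "vwedge (vK M \<xi>) (vK M \<xi>) = vK (M \<Otimes>\<^sub>M M) (\<lambda>p. ext_wedge (\<xi> (fst p)) (\<xi> (snd p)))"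
    unfolding wT .
  have "integrable (?\<mu> \<Otimes>\<^sub>M ?\<mu>) ?w" by (rule integrable_bilinear[OF bilinear_ext_wedge law(1) law(1)])
  then show "integrable (M \<Otimes>\<^sub>M M) (\<lambda>p. ext_wedge (\<xi> (fst p)) (\<xi> (snd p)))"
    unfolding prod wT[symmetric] by (rule integrable_distr[OF T])
qed

text \<open>A vanishing integral would force the nonnegative integrand \<open>?D\<close> to vanish
  almost everywhere. It is continuous and positive at one pair of group elements, hence on a box of
  open sets, which has positive product measure.\<close>

lemma defect_product:
  fixes a b :: "real ^ 2"
  assumes a: "norm a = 1" and b: "norm b = 1"
  defines "z \<equiv> vK H_uniform (\<lambda>h. ext_map (H_act h) (ext_vec (tensor a b)))"
  shows "defect (vwedge z z) \<noteq> 0"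
proof
  let ?t = "tensor a b" and ?M = "H_uniform \<Otimes>\<^sub>M H_uniform"
  let ?\<xi> = "\<lambda>h. ext_vec (H_act h ?t)"
  let ?\<zeta> = "\<lambda>p. ext_wedge (?\<xi> (fst p)) (?\<xi> (snd p))"
  let ?D = "\<lambda>p. \<bar>?\<zeta> p \<bullet> row_plane\<bar> + \<bar>?\<zeta> p \<bullet> column_plane\<bar> - \<bar>?\<zeta> p \<bullet> row_plane + ?\<zeta> p \<bullet> column_plane\<bar>"
  assume zero: "defect (vwedge z z) = 0"
  interpret prob_space H_uniform by (rule H_uniform_prob)
  interpret P: pair_prob_space H_uniform H_uniform ..
  have z: "z = vK H_uniform ?\<xi>" unfolding z_def by (simp only: ext_map_ext_vec[OF linear_H_act])
  have int: "integrable H_uniform ?\<xi>"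
    by (intro haar_integrable[OF haar_H_uniform] continuous_intros continuous_on_H_act)
  note vw = vwedge_vK[OF H_uniform_prob int]
  have D0: "?D p \<ge> 0" for p using abs_triangle_ineq[of "?\<zeta> p \<bullet> row_plane" "?\<zeta> p \<bullet> column_plane"] by simp
  have intL: "integrable ?M (\<lambda>p. ?\<zeta> p \<bullet> L)" for L by (rule integrable_inner_left[OF vw(2)])
  have Dint: "integrable ?M ?D"
    by (intro Bochner_Integration.integrable_diff Bochner_Integration.integrable_add integrable_abs intL)
  have "(\<integral>p. ?D p \<partial>?M) = 0"
    using zero unfolding z vw(1) defect_vK[OF P.prob_space_axioms vw(2)] .
  then have AE: "AE p in ?M. ?D p = 0"
    using integral_nonneg_eq_0_iff_AE[OF Dint] D0 by blast
  have \<zeta>: "?\<zeta> p = ext_prod [H_act (fst p) ?t, H_act (snd p) ?t]" for p by (simp add: ext_prod_pair)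
  have cont_act: "continuous_on UNIV (\<lambda>p. H_act (g p) v)" if "continuous_on UNIV g" for g :: "(mat22 \<times> mat22) \<times> (mat22 \<times> mat22) \<Rightarrow> _" and v
    by (rule continuous_on_compose2[OF continuous_on_H_act that]) simp
  have "continuous_on UNIV ?D"
    unfolding \<zeta> by (intro continuous_intros cont_act)
  then have op: "open {p. 0 < ?D p}" by (rule open_Collect_less[OF continuous_on_const])
  \<comment> \<open>A unit vector with rational coordinates, both nonzero.\<close>
  define u :: "real ^ 2" where "u = vector [3/5, 4/5]"
  have nu: "norm u = 1" "norm (axis 1 1 :: real ^ 2) = 1"
    by (simp add: u_def norm_vec_def L2_set_def sum_2 power2_eq_square) (rule norm_axis_1)
  have ab: "norm a = norm u" "norm a = norm (axis 1 1 :: real ^ 2)" "norm b = norm u" "norm b = norm (axis 1 1 :: real ^ 2)"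
    using a b nu by simp_all
  obtain g where g: "orthogonal_matrix g" "g *v a = u" by (rule orthogonal_matrix_transitive[OF ab(1)])
  obtain g' where g': "orthogonal_matrix g'" "g' *v a = axis 1 1" by (rule orthogonal_matrix_transitive[OF ab(2)])
  obtain k where k: "orthogonal_matrix k" "k *v b = axis 1 1" by (rule orthogonal_matrix_transitive[OF ab(4)])
  obtain k' where k': "orthogonal_matrix k'" "k' *v b = u" by (rule orthogonal_matrix_transitive[OF ab(3)])
  let ?h = "(g, k)" and ?h' = "(g', k')"
  have hH: "?h \<in> H_group" "?h' \<in> H_group" using g g' k k' by (simp_all add: H_group_iff)
  \<comment> \<open>The moved tensors are (3/5) t_11 + (4/5) t_21 and (3/5) t_11 + (4/5) t_12. Their
    wedge pairs to 12/25 with the row plane and to -12/25 with the column plane, so the sum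
    cancels.\<close>
  have "?D (?h, ?h') = 24 / 25"
    by (simp add: ext_prod_pair[symmetric] H_act_tensor g g' k k' row_plane_def column_plane_def inner_ext_prod_pair
        inner_coord u_def axis_def)
  then have "(?h, ?h') \<in> {p. 0 < ?D p}" by simp
  from open_prod_elim[OF op this] obtain U U' where U: "open U" "open U'" "(?h, ?h') \<in> U \<times> U'" "U \<times> U' \<subseteq> {p. 0 < ?D p}"
    by blast
  let ?B = "(U \<inter> H_group) \<times> (U' \<inter> H_group)"
  have s: "sets H_uniform = sets H_borel" using haar_H_uniform by (simp add: haar_def)
  have Us: "U \<inter> H_group \<in> sets H_uniform" "U' \<inter> H_group \<in> sets H_uniform"
    using U(1,2) by (simp_all add: s sets_restrict_space_iff H_group_borel sets.Int)
  have "emeasure ?M ?B = emeasure H_uniform (U \<inter> H_group) * emeasure H_uniform (U' \<inter> H_group)"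
    by (rule emeasure_pair_measure_Times[OF Us])
  also have "\<dots> > 0"
    using haar_open_pos[OF haar_H_uniform U(1), of ?h] haar_open_pos[OF haar_H_uniform U(2), of ?h'] U(3) hH
    by (simp add: ennreal_zero_less_mult_iff)
  finally have pos: "emeasure ?M ?B > 0" .
  have "AE p in ?M. p \<notin> ?B"
    using AE by eventually_elim (use U(4) in fastforce)
  then have "emeasure ?M ?B = 0"
    using AE_iff_null_sets[OF pair_measureI[OF Us]] null_setsD1 by blast
  with pos show False by simp
qed

lemma young_diagram_2: "young_diagram [2] = {(1, 1), (1, 2)}"
  and young_diagram_11: "young_diagram [1, 1] = {(1, 1), (2, 1)}"
proof -
  have "(i, j) \<in> young_diagram [2] \<longleftrightarrow> i = 1 \<and> (j = 1 \<or> j = 2)"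
    "(i, j) \<in> young_diagram [1, 1] \<longleftrightarrow> (i = 1 \<or> i = 2) \<and> j = 1" for i j
    by (cases "i = 1"; cases "i = 2"; force simp: young_diagram_def)+
  then show "young_diagram [2] = {(1, 1), (1, 2)}" "young_diagram [1, 1] = {(1, 1), (2, 1)}" by auto
qed

lemma defect_schubert_zonoid:
  "defect (schubert_zonoid r F e f (young_diagram [2])) = 0"
  "defect (schubert_zonoid r F e f (young_diagram [1, 1])) = 0"
  unfolding schubert_zonoid_def young_diagram_2 young_diagram_11 linear_scale[OF linear_defect]
  by (simp_all only: defect_row_column scaleR_zero_right)

lemma defect_schubert_zonoid_product:
  assumes r: "r > 0" and F: "complete_flag F" and e: "orthonormal_pair e" and f: "orthonormal_pair f"
  defines "z \<equiv> schubert_zonoid r F e f (young_diagram [1])"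
  shows "defect (vwedge z z) \<noteq> 0"
proof -
  define c where "c = Gr_vol r (4 - card (young_diagram [1])) (schubert_variety F (young_diagram [1])) / Gr_vol r 4 Gr22"
  let ?k = "vK H_uniform (\<lambda>h. ext_map (H_act h) (ext_vec (tensor (e 1) (f 1))))"
  have c: "c > 0" unfolding c_def by (intro divide_pos_pos Gr_vol_box_pos Gr_vol_Gr22_pos r F)
  have "z = c *\<^sub>R ?k"
    unfolding z_def schubert_zonoid_def c_def young_diagram_1 schubert_vector_1 ..
  then have "vwedge z z = (c * c) *\<^sub>R vwedge ?k ?k"
    by (simp add: bilinear_lmul[OF vwedge_spec(1)] bilinear_rmul[OF vwedge_spec(1)])
  then have "defect (vwedge z z) = (c * c) * defect (vwedge ?k ?k)"
    by (simp add: linear_scale[OF linear_defect])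
  moreover have "defect (vwedge ?k ?k) \<noteq> 0"
    using e f by (intro defect_product) (simp_all add: orthonormal_pair_def)
  ultimately show ?thesis using c by simp
qed

section \<open>Cosets of the null ideal and the contradiction\<close>

lemma null_ideal_add: "x \<in> null_ideal \<Longrightarrow> y \<in> null_ideal \<Longrightarrow> x + y \<in> null_ideal"
  and null_ideal_scale: "x \<in> null_ideal \<Longrightarrow> c *\<^sub>R x \<in> null_ideal"
  and null_ideal_0: "0 \<in> null_ideal"
  unfolding null_ideal_def by (rule span_add span_scale span_zero; assumption)+

lemma null_coset: "null_ideal +>\<^bsub>grassmann_ring\<^esub> x = {n + x |n. n \<in> null_ideal}"
  by (auto simp: a_r_coset_def' grassmann_ring_def)

theorem proposition8p14:
  fixes r :: real and F :: "nat \<Rightarrow> (real ^ 4) set" and e f :: "nat \<Rightarrow> real ^ 2"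
  assumes "r > 0" and "complete_flag F" and "orthonormal_pair e" and "orthonormal_pair f"
  shows "\<not> (\<exists>a b :: real.
    schubert_class r F e f (young_diagram [1]) \<otimes>\<^bsub>HE\<^esub> schubert_class r F e f (young_diagram [1])
      = (a \<odot>\<^bsub>HE\<^esub> schubert_class r F e f (young_diagram [2]))
        \<oplus>\<^bsub>HE\<^esub> (b \<odot>\<^bsub>HE\<^esub> schubert_class r F e f (young_diagram [1, 1])))"
proof (rule notI, elim exE)
  fix a b :: real
  assume eq: "schubert_class r F e f (young_diagram [1]) \<otimes>\<^bsub>HE\<^esub> schubert_class r F e f (young_diagram [1])
      = (a \<odot>\<^bsub>HE\<^esub> schubert_class r F e f (young_diagram [2]))
        \<oplus>\<^bsub>HE\<^esub> (b \<odot>\<^bsub>HE\<^esub> schubert_class r F e f (young_diagram [1, 1]))"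
  define z where "z D = schubert_zonoid r F e f D" for D
  have coset: "schubert_class r F e f D = {n + z D |n. n \<in> null_ideal}" for D
    by (simp add: schubert_class_def z_def null_coset)
  have mult: "X \<otimes>\<^bsub>HE\<^esub> Y = (\<Union>x\<in>X. \<Union>y\<in>Y. {n + vwedge x y |n. n \<in> null_ideal})" for X Y
    by (simp add: HE_def Q_ring_def FactRing_def rcoset_mult_def null_coset)
      (simp add: grassmann_ring_def)
  have add: "X \<oplus>\<^bsub>HE\<^esub> Y = {x + y |x y. x \<in> X \<and> y \<in> Y}" for X Y
    by (auto simp: HE_def Q_ring_def FactRing_def set_add_def' grassmann_ring_def)
  have smult: "c \<odot>\<^bsub>HE\<^esub> X = (\<Union>x\<in>X. {n + c *\<^sub>R x |n. n \<in> null_ideal})" for c X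
    by (simp add: HE_def null_coset)
  \<comment> \<open>An element of the scaled class is n + c (m + z) with m, n null; n + c m is
    absorbed into one null element.\<close>
  have smult_class: "\<exists>n\<in>null_ideal. x = n + c *\<^sub>R z D" if "x \<in> c \<odot>\<^bsub>HE\<^esub> schubert_class r F e f D" for x c D
  proof -
    from that obtain m n where "m \<in> null_ideal" "n \<in> null_ideal" "x = n + c *\<^sub>R (m + z D)"
      by (auto simp: smult coset)
    then show ?thesis
      by (intro bexI[of _ "n + c *\<^sub>R m"]) (simp_all add: scaleR_add_right null_ideal_add null_ideal_scale)
  qed
  let ?D = "young_diagram [1]"
  \<comment> \<open>The equation of cosets is exploited at one element, the product of the chosen
    representatives with itself; as a sum of elements of the two scaled classes it would have defect
    0.\<close>
  have "z ?D \<in> schubert_class r F e f ?D" using null_ideal_0 by (auto simp: coset)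
  then have "vwedge (z ?D) (z ?D) \<in> schubert_class r F e f ?D \<otimes>\<^bsub>HE\<^esub> schubert_class r F e f ?D"
    unfolding mult using null_ideal_0 by force
  then obtain x y where xy: "vwedge (z ?D) (z ?D) = x + y"
    "x \<in> a \<odot>\<^bsub>HE\<^esub> schubert_class r F e f (young_diagram [2])"
    "y \<in> b \<odot>\<^bsub>HE\<^esub> schubert_class r F e f (young_diagram [1, 1])"
    unfolding eq add by blast
  obtain m n where mn: "m \<in> null_ideal" "x = m + a *\<^sub>R z (young_diagram [2])"
    "n \<in> null_ideal" "y = n + b *\<^sub>R z (young_diagram [1, 1])"
    using smult_class[OF xy(2)] smult_class[OF xy(3)] by blast
  have "defect (vwedge (z ?D) (z ?D)) = 0"
    unfolding xy(1) mn(2,4) linear_add[OF linear_defect] linear_scale[OF linear_defect]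
      defect_null_ideal[OF mn(1)] defect_null_ideal[OF mn(3)]
    unfolding z_def defect_schubert_zonoid by simp
  then show False using defect_schubert_zonoid_product[OF assms] by (simp add: z_def)
qed

end
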